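(* Let $(\mathcal G,\mathcal X,(I_g),\delta,\mathsf b,\mathsf d,N,\beta,\gamma)$ be $\mathcal G$-LW data over $\mathbb C$, let $\Sigma$ be a compact connected oriented surface with a triangulation $\mathcal T$ and dual trivalent graph $\Gamma$, and let $\Phi$ be an admissible $\mathcal G$-coloring of $\Gamma$. Then the plaquette operators $B_p:\mathcal H(\Gamma,\Phi)\to\mathcal H(\Gamma,\Phi)$ have the following properties. (1) Each $B_p$ is a projector: $B_p^2=B_p$. (2) They mutually commute: $B_pB_{p'}=B_{p'}B_p$ for all plaquettes $p,p'$. (3) Each $B_p$ is Hermitian with respect to the (in general indefinite) Hermitian form $\langle\cdot\mid\cdot\rangle$ on $\mathcal H(\Gamma,\Phi)$.
   Context: **$\mathcal G$-LW data** over a field $\Bbbk$ with involutive automorphism $x\mapsto\bar x$ (here $\Bbbk=\mathbb C$ with complex conjugation) consist of: (1) an abelian group $(\mathcal G,+)$; (2) a subset $\mathcal X\subset\mathcal G$ that is symmetric ($-\mathcal X=\mathcal X$) and small (for every finite $Y\subset \mathcal G$, $\mathcal G\not\subset Y+\mathcal X$); elements of $\mathcal G\setminus\mathcal X$ are called generic; (3) a finite set $I_g$ for each $g\in\mathcal G\setminus\mathcal X$; write $|j|=g$ for $j\in I_g$; (4) an involution $*$ on $\mathsf A=\bigsqcup_{g\in\mathcal G\setminus\mathcal X} I_g$ with $I_g^*=I_{-g}$; (5) a map $\delta:\mathsf A^3\to\mathbb N$ with $\delta_{ijk}=\delta_{jki}=\delta_{k^*j^*i^*}$ and $\delta_{ijk}=0$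 unless $|i|+|j|+|k|=0$; (6) maps $\mathsf d,\mathsf b:\mathsf A\to\Bbbk^*$ with $\overline{\mathsf b}=\mathsf b$, $\overline{\mathsf d}=\mathsf d$, $\mathsf b(i^* )=\mathsf b(i)$, $\mathsf d(i^* )=\mathsf d(i)$ and, whenever $g,g_1,g_2$ are generic with $g=g_1+g_2$, $\mathsf b(j)=\sum_{j_1\in I_{g_1},j_2\in I_{g_2}}\mathsf b(j_1)\mathsf b(j_2)\delta_{j^*j_1j_2}$ for all $j\in I_g$; (7) a map $\beta:\mathsf A\to\Bbbk^*$ and scalars $\gamma^n_{i,j,k}\in\Bbbk^*$ ($1\le n\le\delta_{ijk}$), cyclically invariant in $(i,j,k)$, with $\overline\gamma=\gamma$, $\overline\beta=\beta$, $\beta(i^* )=\beta(i)$ and $\gamma^n_{i,j,k}\gamma^n_{k^*,j^*,i^*}\beta(i)\beta(j)\beta(k)=1$; (8) modified $6j$-symbols $N:\mathsf A^6\times(\mathbb N^* )^4\to\Bbbk$, with $N^{j_1j_2j_3}_{j_4j_5j_6}(^{a_1a_2}_{a_3a_4})=0$ unless $1\le a_1\le\delta_{j_1j_2j_3^*}$, $1\le a_2\le\delta_{j_3j_4j_5^*}$, $1\le a_3\le\delta_{j_5j_6^*j_1^*}$, $1\le a_4\le\delta_{j_6j_4^*j_2^*}$. They satisfy (the identities are required when the multiplicity indices not summed over are admissible and the degree forced on the summed label is generic): (a) $N^{j_1 j_2 j_3}_{j_4 j_5 j_6}(^{a_1a_2}_{a_3a_4})= N^{j_2 j_3^*j_1^*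 }_{j_5 j_6j_4 }(^{a_1a_3}_{a_4a_2})= N^{j_3 j_4 j_5}_{j_6^* j_1 j_2^*}(^{a_2a_3}_{a_1a_4})$; (b) $\sum_{j,c_1,c_2,c_3}\mathsf d(j)N^{j_1 j_2 j_5}_{j_3 j_6 j}(^{a_1a_2}_{c_1c_2}) N^{j_1 j j_6}_{j_4 j_0 j_7}(^{c_1a_3}_{a_0c_3})N^{j_2 j_3 j}_{j_4 j_7 j_8}(^{c_2c_3}_{a_4a_5})=\sum_{c_4}N^{j_5 j_3 j_6}_{j_4 j_0 j_8}(^{a_2a_3}_{c_4a_5})N^{j_1 j_2 j_5}_{j_8 j_0 j_7}(^{a_1c_4}_{a_0a_4})$; (c) $\sum_{n,a_3,a_4}\mathsf d(n)N^{i j p}_{l m n}(^{a_1a_2}_{a_3a_4})N^{k j^* i}_{n m l}(^{a'_1a_3}_{a'_2a_4})=\delta_{k,p}\delta_{a_1,a_1'}\delta_{a_2,a_2'}/\mathsf d(k)$ (Kronecker deltas); (d) $\overline{N^{j_1 j_2 j_3}_{j_4j_5j_6}(^{a_1a_2}_{a_3a_4})}=N^{j_2^* j_1^* j_3^*}_{j_5j_4j_6}(^{a_1a_2}_{a_4a_3})\,\gamma^{a_1}_{j_1,j_2,j_3^*}\gamma^{a_2}_{j_3,j_4,j_5^*}\gamma^{a_3}_{j_1^*,j_5,j_6^*}\gamma^{a_4}_{j_2^*,j_6,j_4^*}\prod_{i=1}^6\beta(j_i)$. **State space.** $\Sigma$ has no boundary. At each vertex of the dual trivalent graph $\Gamma$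 the three edges are cyclically ordered clockwise. $\Gamma_0,\Gamma_1$ are the sets of vertices and unoriented edges; a plaquette is a component of $\Sigma\setminus\Gamma$. A $\mathcal G$-coloring is a map $\Phi$ from oriented edges to $\mathcal G$ with $\Phi(-e)=-\Phi(e)$ and, at each vertex, the sum of the colors of the three edges oriented toward the vertex is $0$. It is admissible if all its values are generic. A state $\sigma$ of an admissible $\Phi$ assigns to each oriented edge $e$ an element $\sigma(e)\in I_{\Phi(e)}$ with $\sigma(-e)=\sigma(e)^*$ and to each vertex $v$ an integer $0\le\sigma_0(v)\le\delta_{\sigma(e_1)\sigma(e_2)\sigma(e_3)}$, where $e_1,e_2,e_3$ are the ordered edges at $v$ oriented toward $v$. $\mathcal H(\Gamma,\Phi)$ is the complex vector space with basis $|\Gamma,\sigma\rangle$, $\sigma$ a state of $\Phi$. With $\gamma(\sigma(v))=\gamma^{\sigma_0(v)}_{\sigma(e_1),\sigma(e_2),\sigma(e_3)}$ (and $\gamma(\sigma(v))=1$ if $\sigma_0(v)=0$), the Hermitian form is $$\langle\Gamma,\sigma\mid\Gamma,\sigma'\rangle=\delta_{\sigma,\sigma'}\frac{\prod_{v\in\Gamma_0}\gamma(\sigma(v))\prod_{e\in\Gamma_1}\beta(\sigma(e))}{\prod_{e\in\Gamma_1}\mathsf d(\sigma(e))}.$$ **Plaquette operators.** Let $p$ be a plaquette with $n$ sides. Going counterclockwise around $p$, let $v_1,\dots,v_n$ be its vertices; let $j_i$ be the label of the side from $v_{i-1}$ to $v_i$ oriented that way (indices mod $n$), $k_i$ the label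 of the third edge at $v_i$ oriented away from $v_i$, and $C_i=\sigma_0(v_i)$. For $g\in \mathcal G$ let $g.\delta p$ be the coloring equal to $g$ on the sides of $p$ oriented from $v_i$ to $v_{i-1}$ (that is, clockwise around $p$), $-g$ on their opposites, and $0$ on other edges. For $g$ generic, $s\in I_g$, and $\Phi$, $\Phi+g.\delta p$ admissible, $B^s_p:\mathcal H(\Gamma,\Phi)\to\mathcal H(\Gamma,\Phi+g.\delta p)$ sends the basis state with data $(j_i,C_i)$ to $$\sum_{j'_1,\dots,j'_n}\ \sum_{A_1,\dots,A_n}\ \sum_{C_1',\dots,C_n'}\ \prod_{i=1}^n\mathsf d(j_i')\,N^{j_i'\,s\,j_i}_{j_{i+1}^*\,k_i\,j_{i+1}'^{*}}\big(^{A_i\,C_i}_{C_i'\,A_{i+1}}\big)$$ times the basis state in which each $(j_i,C_i)$ is replaced by $(j_i',C_i')$ and everything else is unchanged. Put $B_p^g=\sum_{s\in I_g}\mathsf b(s)B_p^s$ and $B_p=B_p^{g}B_p^{-g}:\mathcal H(\Gamma,\Phi)\to\mathcal H(\Gamma,\Phi)$ for any generic $g$ such that $\Phi-g.\delta p$ is admissible (such $g$ exist since $\mathcal X$ is small, and $B_p$ does not depend on $g$). *)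

theory Defs
  imports "HOL-Analysis.Analysis"
begin

section \<open>LW data graded by an abelian group\<close>

text \<open>
  The disjoint union of the label sets \<open>I\<^sub>g\<close>, with \<open>g\<close> generic, is represented by a family
  \<open>label_set\<close> together with the degree map \<open>deg\<close>, which forces the sets to be disjoint.
  Only labels of generic degree matter; all functions below are unconstrained on other
  arguments.  \<open>gam n i j k\<close> is \<open>\<gamma>\<^sup>n\<close> with lower indices \<open>i,j,k\<close>, and
  \<open>sixj j1 j2 j3 j4 j5 j6 a1 a2 a3 a4\<close> is the modified 6j-symbol with upper row
  \<open>j1 j2 j3\<close>, lower row \<open>j4 j5 j6\<close> and multiplicity indices \<open>a1 a2\<close> (top), \<open>a3 a4\<close> (bottom).
\<close>

record ('g, 'a) LW_data =
  nongeneric :: "'g set"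
  label_set :: "'g \<Rightarrow> 'a set"
  deg :: "'a \<Rightarrow> 'g"
  dual :: "'a \<Rightarrow> 'a"
  mult :: "'a \<Rightarrow> 'a \<Rightarrow> 'a \<Rightarrow> nat"
  dcoef :: "'a \<Rightarrow> complex"
  bcoef :: "'a \<Rightarrow> complex"
  bet :: "'a \<Rightarrow> complex"
  gam :: "nat \<Rightarrow> 'a \<Rightarrow> 'a \<Rightarrow> 'a \<Rightarrow> complex"
  sixj :: "'a \<Rightarrow> 'a \<Rightarrow> 'a \<Rightarrow> 'a \<Rightarrow> 'a \<Rightarrow> 'a \<Rightarrow> nat \<Rightarrow> nat \<Rightarrow> nat \<Rightarrow> nat \<Rightarrow> complex"

definition generic :: "('g, 'a, 'z) LW_data_scheme \<Rightarrow> 'g \<Rightarrow> bool" where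
  "generic D g \<longleftrightarrow> g \<notin> nongeneric D"

definition labels :: "('g, 'a, 'z) LW_data_scheme \<Rightarrow> 'a set" where
  "labels D = (\<Union>g\<in>{g. generic D g}. label_set D g)"

definition mult_ix :: "('g, 'a, 'z) LW_data_scheme \<Rightarrow> 'a \<Rightarrow> 'a \<Rightarrow> 'a \<Rightarrow> nat set" where
  "mult_ix D i j k = {1..mult D i j k}"

definition sixj_admissible ::
  "('g, 'a, 'z) LW_data_scheme \<Rightarrow> 'a \<Rightarrow> 'a \<Rightarrow> 'a \<Rightarrow> 'a \<Rightarrow> 'a \<Rightarrow> 'a \<Rightarrow> nat \<Rightarrow> nat \<Rightarrow> nat \<Rightarrow> nat \<Rightarrow> bool" where
  "sixj_admissible D j1 j2 j3 j4 j5 j6 a1 a2 a3 a4 \<longleftrightarrow>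
     a1 \<in> mult_ix D j1 j2 (dual D j3) \<and>
     a2 \<in> mult_ix D j3 j4 (dual D j5) \<and>
     a3 \<in> mult_ix D j5 (dual D j6) (dual D j1) \<and>
     a4 \<in> mult_ix D j6 (dual D j4) (dual D j2)"

text \<open>
  In \<open>pentagon\<close> and \<open>orthogonality\<close> the label summed over has the only degree for which the
  summands can be nonzero, and each multiplicity index summed over runs through the range
  outside of which the summands vanish.
\<close>

locale LW =
  fixes D :: "('g::ab_group_add, 'a) LW_data"
  assumes nongeneric_symmetric: "uminus ` nongeneric D = nongeneric D"
    and nongeneric_small:
      "finite Y \<Longrightarrow> \<not> UNIV \<subseteq> {y + x | y x. y \<in> Y \<and> x \<in> nongeneric D}"
    and finite_label_set: "generic D g \<Longrightarrow> finite (label_set D g)"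
    and deg_label: "generic D g \<Longrightarrow> j \<in> label_set D g \<Longrightarrow> deg D j = g"
    and dual_dual: "j \<in> labels D \<Longrightarrow> dual D (dual D j) = j"
    and dual_label_set: "generic D g \<Longrightarrow> dual D ` label_set D g = label_set D (- g)"
    and mult_cyclic:
      "\<lbrakk>i \<in> labels D; j \<in> labels D; k \<in> labels D\<rbrakk> \<Longrightarrow> mult D i j k = mult D j k i"
    and mult_dual:
      "\<lbrakk>i \<in> labels D; j \<in> labels D; k \<in> labels D\<rbrakk>
        \<Longrightarrow> mult D i j k = mult D (dual D k) (dual D j) (dual D i)"
    and mult_eq_0:
      "\<lbrakk>i \<in> labels D; j \<in> labels D; k \<in> labels D; deg D i + deg D j + deg D k \<noteq> 0\<rbrakk>
        \<Longrightarrow> mult D i j k = 0"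
    and dcoef: "j \<in> labels D \<Longrightarrow>
      dcoef D j \<noteq> 0 \<and> cnj (dcoef D j) = dcoef D j \<and> dcoef D (dual D j) = dcoef D j"
    and bcoef: "j \<in> labels D \<Longrightarrow>
      bcoef D j \<noteq> 0 \<and> cnj (bcoef D j) = bcoef D j \<and> bcoef D (dual D j) = bcoef D j"
    and bcoef_sum:
      "\<lbrakk>generic D g1; generic D g2; generic D (g1 + g2); j \<in> label_set D (g1 + g2)\<rbrakk> \<Longrightarrow>
        bcoef D j = (\<Sum>j1\<in>label_set D g1. \<Sum>j2\<in>label_set D g2.
          bcoef D j1 * bcoef D j2 * of_nat (mult D (dual D j) j1 j2))"
    and bet: "j \<in> labels D \<Longrightarrow>
      bet D j \<noteq> 0 \<and> cnj (bet D j) = bet D j \<and> bet D (dual D j) = bet D j"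
    and gam:
      "\<lbrakk>i \<in> labels D; j \<in> labels D; k \<in> labels D; n \<in> mult_ix D i j k\<rbrakk> \<Longrightarrow>
        gam D n i j k \<noteq> 0 \<and> cnj (gam D n i j k) = gam D n i j k \<and>
        gam D n i j k = gam D n j k i"
    and gam_bet:
      "\<lbrakk>i \<in> labels D; j \<in> labels D; k \<in> labels D; n \<in> mult_ix D i j k\<rbrakk> \<Longrightarrow>
        gam D n i j k * gam D n (dual D k) (dual D j) (dual D i) *
        bet D i * bet D j * bet D k = 1"
    and sixj_eq_0:
      "\<lbrakk>{j1, j2, j3, j4, j5, j6} \<subseteq> labels D;
        \<not> sixj_admissible D j1 j2 j3 j4 j5 j6 a1 a2 a3 a4\<rbrakk> \<Longrightarrow>
        sixj D j1 j2 j3 j4 j5 j6 a1 a2 a3 a4 = 0"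
    and sixj_symmetry:
      "\<lbrakk>{j1, j2, j3, j4, j5, j6} \<subseteq> labels D;
        sixj_admissible D j1 j2 j3 j4 j5 j6 a1 a2 a3 a4\<rbrakk> \<Longrightarrow>
        sixj D j1 j2 j3 j4 j5 j6 a1 a2 a3 a4 =
          sixj D j2 (dual D j3) (dual D j1) j5 j6 j4 a1 a3 a4 a2 \<and>
        sixj D j1 j2 j3 j4 j5 j6 a1 a2 a3 a4 =
          sixj D j3 j4 j5 (dual D j6) j1 (dual D j2) a2 a3 a1 a4"
    and pentagon:
      "\<lbrakk>{j0, j1, j2, j3, j4, j5, j6, j7, j8} \<subseteq> labels D;
        a0 \<in> mult_ix D j0 (dual D j7) (dual D j1);
        a1 \<in> mult_ix D j1 j2 (dual D j5);
        a2 \<in> mult_ix D j5 j3 (dual D j6);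
        a3 \<in> mult_ix D j6 j4 (dual D j0);
        a4 \<in> mult_ix D j7 (dual D j8) (dual D j2);
        a5 \<in> mult_ix D j8 (dual D j4) (dual D j3);
        generic D (deg D j2 + deg D j3)\<rbrakk> \<Longrightarrow>
        (\<Sum>j\<in>label_set D (deg D j2 + deg D j3).
          \<Sum>c1\<in>mult_ix D j6 (dual D j) (dual D j1).
          \<Sum>c2\<in>mult_ix D j (dual D j3) (dual D j2).
          \<Sum>c3\<in>mult_ix D j7 (dual D j4) (dual D j).
            dcoef D j * sixj D j1 j2 j5 j3 j6 j a1 a2 c1 c2
                      * sixj D j1 j j6 j4 j0 j7 c1 a3 a0 c3
                      * sixj D j2 j3 j j4 j7 j8 c2 c3 a4 a5) =
        (\<Sum>c4\<in>mult_ix D j0 (dual D j8) (dual D j5).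
            sixj D j5 j3 j6 j4 j0 j8 a2 a3 c4 a5 * sixj D j1 j2 j5 j8 j0 j7 a1 c4 a0 a4)"
    and orthogonality:
      "\<lbrakk>{i, j, k, l, m, p} \<subseteq> labels D;
        a1 \<in> mult_ix D i j (dual D p);
        a2 \<in> mult_ix D p l (dual D m);
        a1' \<in> mult_ix D k (dual D j) (dual D i);
        a2' \<in> mult_ix D m (dual D l) (dual D k);
        generic D (deg D j + deg D l)\<rbrakk> \<Longrightarrow>
        (\<Sum>n\<in>label_set D (deg D j + deg D l).
          \<Sum>a3\<in>mult_ix D m (dual D n) (dual D i).
          \<Sum>a4\<in>mult_ix D n (dual D l) (dual D j).
            dcoef D n * sixj D i j p l m n a1 a2 a3 a4
                      * sixj D k (dual D j) i n m l a1' a3 a2' a4) =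
        (if k = p \<and> a1 = a1' \<and> a2 = a2' then 1 / dcoef D k else 0)"
    and sixj_cnj:
      "\<lbrakk>{j1, j2, j3, j4, j5, j6} \<subseteq> labels D;
        sixj_admissible D j1 j2 j3 j4 j5 j6 a1 a2 a3 a4\<rbrakk> \<Longrightarrow>
        cnj (sixj D j1 j2 j3 j4 j5 j6 a1 a2 a3 a4) =
          sixj D (dual D j2) (dual D j1) (dual D j3) j5 j4 j6 a1 a2 a4 a3 *
          gam D a1 j1 j2 (dual D j3) * gam D a2 j3 j4 (dual D j5) *
          gam D a3 (dual D j1) j5 (dual D j6) * gam D a4 (dual D j2) j6 (dual D j4) *
          (bet D j1 * bet D j2 * bet D j3 * bet D j4 * bet D j5 * bet D j6)"


section \<open>Triangulated closed oriented surfaces\<close>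

definition closed_surface :: "'x topology \<Rightarrow> bool" where
  "closed_surface X \<longleftrightarrow>
     compact_space X \<and> Hausdorff_space X \<and>
     (\<forall>x\<in>topspace X. \<exists>U. openin X U \<and> x \<in> U \<and>
        subtopology X U homeomorphic_space (euclidean :: (real^2) topology))"

definition triangulates ::
  "'e::euclidean_space set set \<Rightarrow> ('e \<Rightarrow> 'x) \<Rightarrow> 'x topology \<Rightarrow> bool" where
  "triangulates K h X \<longleftrightarrow>
     simplicial_complex K \<and> homeomorphic_map (top_of_set (\<Union>K)) X h"

definition is_triangle :: "'e::euclidean_space set set \<Rightarrow> 'e \<Rightarrow> 'e \<Rightarrow> 'e \<Rightarrow> bool" where
  "is_triangle K a b c \<longleftrightarrow>
     card {a, b, c} = 3 \<and> \<not> affine_dependent {a, b, c} \<and> convex hull {a, b, c} \<in> K"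

text \<open>
  An orientation of the triangulated surface is given by the set of triples \<open>(a, b, c)\<close> of
  vertices of a triangle, listed counterclockwise.  Each triangle receives one of its two
  cyclic orders, and two different triangles with a common side induce opposite directions
  on this side.
\<close>

definition surface_orientation ::
  "'e::euclidean_space set set \<Rightarrow> ('e \<times> 'e \<times> 'e) set \<Rightarrow> bool" where
  "surface_orientation K R \<longleftrightarrow>
     (\<forall>a b c. (a, b, c) \<in> R \<longrightarrow> is_triangle K a b c \<and> (b, c, a) \<in> R) \<and>
     (\<forall>a b c. is_triangle K a b c \<longrightarrow> ((a, b, c) \<in> R) \<noteq> ((a, c, b) \<in> R)) \<and>
     (\<forall>a b c c'. (a, b, c) \<in> R \<and> (a, b, c') \<in> R \<longrightarrow> c = c')"


section \<open>The dual graph and its colorings\<close>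

text \<open>
  The vertices, unoriented edges and plaquettes of the dual trivalent graph correspond to the
  2-simplices, 1-simplices and vertices of the triangulation.  The oriented dual edges are
  encoded by pairs \<open>(a, b)\<close> of adjacent vertices of the triangulation: \<open>(a, b)\<close> stands for the
  edge dual to the side \<open>ab\<close>, oriented towards the triangle \<open>abc\<close> with \<open>(a, b, c)\<close>
  counterclockwise (so it crosses the directed side from right to left), and \<open>(b, a)\<close> is the
  opposite edge.  Hence, for \<open>(a, b, c)\<close> counterclockwise, the three dual edges oriented towards
  the dual vertex \<open>abc\<close> are, in clockwise order, \<open>(a, b)\<close>, \<open>(c, a)\<close>, \<open>(b, c)\<close>.
\<close>

definition dual_vertices :: "'e::euclidean_space set set \<Rightarrow> 'e set set" where
  "dual_vertices K = {T \<in> K. 2 simplex T}"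

definition dual_edges :: "'e::euclidean_space set set \<Rightarrow> 'e set set" where
  "dual_edges K = {E \<in> K. 1 simplex E}"

definition plaquettes :: "'e::euclidean_space set set \<Rightarrow> 'e set" where
  "plaquettes K = {p. {p} \<in> K}"

definition oriented_edges :: "'e::euclidean_space set set \<Rightarrow> ('e \<times> 'e) set" where
  "oriented_edges K = {(a, b). a \<noteq> b \<and> convex hull {a, b} \<in> K}"

text \<open>Representatives; everything they are used for is invariant under change of representative.\<close>

definition edge_rep :: "'e::euclidean_space set set \<Rightarrow> 'e set \<Rightarrow> 'e \<times> 'e" where
  "edge_rep K E = (SOME (a, b). (a, b) \<in> oriented_edges K \<and> convex hull {a, b} = E)"

definition triangle_rep ::
  "('e::euclidean_space \<times> 'e \<times> 'e) set \<Rightarrow> 'e set \<Rightarrow> 'e \<times> 'e \<times> 'e" where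
  "triangle_rep R T = (SOME (a, b, c). (a, b, c) \<in> R \<and> convex hull {a, b, c} = T)"

text \<open>Only the values of a coloring on \<open>oriented_edges K\<close> are relevant.\<close>

definition coloring ::
  "'e::euclidean_space set set \<Rightarrow> ('e \<times> 'e \<times> 'e) set \<Rightarrow> ('e \<times> 'e \<Rightarrow> 'g::ab_group_add) \<Rightarrow> bool" where
  "coloring K R \<Phi> \<longleftrightarrow>
     (\<forall>(a, b) \<in> oriented_edges K. \<Phi> (b, a) = - \<Phi> (a, b)) \<and>
     (\<forall>(a, b, c) \<in> R. \<Phi> (a, b) + \<Phi> (c, a) + \<Phi> (b, c) = 0)"

definition admissible_coloring ::
  "('g::ab_group_add, 'a) LW_data \<Rightarrow> 'e::euclidean_space set set \<Rightarrow> ('e \<times> 'e \<times> 'e) set \<Rightarrow>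
    ('e \<times> 'e \<Rightarrow> 'g) \<Rightarrow> bool" where
  "admissible_coloring D K R \<Phi> \<longleftrightarrow>
     coloring K R \<Phi> \<and> (\<forall>e \<in> oriented_edges K. generic D (\<Phi> e))"


section \<open>States and the Hermitian form\<close>

type_synonym ('e, 'a) state = "('e \<times> 'e \<Rightarrow> 'a) \<times> ('e set \<Rightarrow> nat)"

definition states ::
  "('g::ab_group_add, 'a) LW_data \<Rightarrow> 'e::euclidean_space set set \<Rightarrow> ('e \<times> 'e \<times> 'e) set \<Rightarrow>
    ('e \<times> 'e \<Rightarrow> 'g) \<Rightarrow> ('e, 'a) state set" where
  "states D K R \<Phi> = {(\<sigma>, \<sigma>0).
     \<sigma> \<in> (\<Pi>\<^sub>E e\<in>oriented_edges K. label_set D (\<Phi> e)) \<and>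
     (\<forall>(a, b) \<in> oriented_edges K. \<sigma> (b, a) = dual D (\<sigma> (a, b))) \<and>
     \<sigma>0 \<in> extensional (dual_vertices K) \<and>
     (\<forall>(a, b, c) \<in> R. \<sigma>0 (convex hull {a, b, c}) \<le> mult D (\<sigma> (a, b)) (\<sigma> (c, a)) (\<sigma> (b, c)))}"

text \<open>
  A vector \<open>\<Sum>\<^sub>s \<psi>\<^sub>s |\<Gamma>, s\<rangle>\<close> is represented by its coefficient function \<open>\<psi>\<close>, extended by 0.
\<close>

definition state_space ::
  "('g::ab_group_add, 'a) LW_data \<Rightarrow> 'e::euclidean_space set set \<Rightarrow> ('e \<times> 'e \<times> 'e) set \<Rightarrow>
    ('e \<times> 'e \<Rightarrow> 'g) \<Rightarrow> (('e, 'a) state \<Rightarrow> complex) set" where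
  "state_space D K R \<Phi> = {\<psi>. \<forall>s. s \<notin> states D K R \<Phi> \<longrightarrow> \<psi> s = 0}"

definition gam_at ::
  "('g::ab_group_add, 'a) LW_data \<Rightarrow> ('e::euclidean_space \<times> 'e \<times> 'e) set \<Rightarrow>
    ('e, 'a) state \<Rightarrow> 'e set \<Rightarrow> complex" where
  "gam_at D R s T = (case s of (\<sigma>, \<sigma>0) \<Rightarrow> case triangle_rep R T of (a, b, c) \<Rightarrow>
     if \<sigma>0 T = 0 then 1 else gam D (\<sigma>0 T) (\<sigma> (a, b)) (\<sigma> (c, a)) (\<sigma> (b, c)))"

definition basis_form ::
  "('g::ab_group_add, 'a) LW_data \<Rightarrow> 'e::euclidean_space set set \<Rightarrow> ('e \<times> 'e \<times> 'e) set \<Rightarrow>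
    ('e, 'a) state \<Rightarrow> ('e, 'a) state \<Rightarrow> complex" where
  "basis_form D K R s s' =
     (if s = s'
      then (\<Prod>T\<in>dual_vertices K. gam_at D R s T) * (\<Prod>E\<in>dual_edges K. bet D (fst s (edge_rep K E)))
           / (\<Prod>E\<in>dual_edges K. dcoef D (fst s (edge_rep K E)))
      else 0)"

definition herm_form ::
  "('g::ab_group_add, 'a) LW_data \<Rightarrow> 'e::euclidean_space set set \<Rightarrow> ('e \<times> 'e \<times> 'e) set \<Rightarrow>
    ('e \<times> 'e \<Rightarrow> 'g) \<Rightarrow> (('e, 'a) state \<Rightarrow> complex) \<Rightarrow> (('e, 'a) state \<Rightarrow> complex) \<Rightarrow> complex" where
  "herm_form D K R \<Phi> \<psi> \<phi> =
     (\<Sum>s\<in>states D K R \<Phi>. \<Sum>s'\<in>states D K R \<Phi>. cnj (\<psi> s) * \<phi> s' * basis_form D K R s s')"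


section \<open>Plaquette operators\<close>

text \<open>
  Let \<open>p\<close> be a plaquette, that is, a vertex of the triangulation.  Its sides are the dual edges
  \<open>(p, u)\<close>, with \<open>u\<close> adjacent to \<open>p\<close>, which are oriented counterclockwise around \<open>p\<close>.  The side
  \<open>(p, u)\<close> ends at the dual vertex \<open>{p, u, w}\<close> with \<open>(p, u, w)\<close> counterclockwise, the next side is
  \<open>(p, w)\<close>, and the third edge at this dual vertex, oriented away from it, is \<open>(w, u)\<close>.  So with
  sides indexed by \<open>u\<close> instead of \<open>i\<close>, and \<open>w\<close> in the place of \<open>i + 1\<close>, one has
  \<open>j\<^sub>i = \<sigma> (p, u)\<close>, \<open>k\<^sub>i = \<sigma> (w, u)\<close> and \<open>C\<^sub>i = \<sigma>0 (convex hull {p, u, w})\<close>.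
\<close>

definition neighbours :: "'e::euclidean_space set set \<Rightarrow> 'e \<Rightarrow> 'e set" where
  "neighbours K p = {u. (p, u) \<in> oriented_edges K}"

definition next_neighbour :: "('e \<times> 'e \<times> 'e) set \<Rightarrow> 'e \<Rightarrow> 'e \<Rightarrow> 'e" where
  "next_neighbour R p u = (THE w. (p, u, w) \<in> R)"

definition boundary_coloring :: "'e \<Rightarrow> 'g::ab_group_add \<Rightarrow> 'e \<times> 'e \<Rightarrow> 'g" where
  "boundary_coloring p g = (\<lambda>(a, b). if b = p then g else if a = p then - g else 0)"

definition shift_coloring :: "('e \<times> 'e \<Rightarrow> 'g::ab_group_add) \<Rightarrow> 'e \<Rightarrow> 'g \<Rightarrow> 'e \<times> 'e \<Rightarrow> 'g" where
  "shift_coloring \<Phi> p g = (\<lambda>e. \<Phi> e + boundary_coloring p g e)"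

definition agree_off_plaquette ::
  "'e::euclidean_space set set \<Rightarrow> 'e \<Rightarrow> ('e, 'a) state \<Rightarrow> ('e, 'a) state \<Rightarrow> bool" where
  "agree_off_plaquette K p s t \<longleftrightarrow>
     (\<forall>(a, b) \<in> oriented_edges K. a \<noteq> p \<and> b \<noteq> p \<longrightarrow> fst s (a, b) = fst t (a, b)) \<and>
     (\<forall>T \<in> dual_vertices K. p \<notin> T \<longrightarrow> snd s T = snd t T)"

text \<open>
  The coefficient of \<open>|\<Gamma>, (\<tau>, \<tau>0)\<rangle>\<close> in the image of \<open>|\<Gamma>, (\<sigma>, \<sigma>0)\<rangle>\<close> under the operator of the
  label \<open>s\<close>, for states agreeing off \<open>p\<close>; \<open>\<tau>\<close>, \<open>\<tau>0\<close> provide the primed labels and indices.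
  The range of each \<open>A u\<close> is the one outside of which the 6j-symbols vanish.
\<close>

definition plaquette_coeff ::
  "('g::ab_group_add, 'a) LW_data \<Rightarrow> 'e::euclidean_space set set \<Rightarrow> ('e \<times> 'e \<times> 'e) set \<Rightarrow>
    'e \<Rightarrow> 'a \<Rightarrow> ('e, 'a) state \<Rightarrow> ('e, 'a) state \<Rightarrow> complex" where
  "plaquette_coeff D K R p s = (\<lambda>(\<sigma>, \<sigma>0) (\<tau>, \<tau>0).
     \<Sum>A \<in> (\<Pi>\<^sub>E u\<in>neighbours K p. mult_ix D (\<tau> (p, u)) s (dual D (\<sigma> (p, u)))).
       \<Prod>u\<in>neighbours K p.
         let w = next_neighbour R p u; v = convex hull {p, u, w}
         in dcoef D (\<tau> (p, u)) *
            sixj D (\<tau> (p, u)) s (\<sigma> (p, u))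
                   (dual D (\<sigma> (p, w))) (\<sigma> (w, u)) (dual D (\<tau> (p, w)))
                   (A u) (\<sigma>0 v) (\<tau>0 v) (A w))"

definition plaquette_op_label ::
  "('g::ab_group_add, 'a) LW_data \<Rightarrow> 'e::euclidean_space set set \<Rightarrow> ('e \<times> 'e \<times> 'e) set \<Rightarrow>
    ('e \<times> 'e \<Rightarrow> 'g) \<Rightarrow> 'e \<Rightarrow> 'a \<Rightarrow> (('e, 'a) state \<Rightarrow> complex) \<Rightarrow> ('e, 'a) state \<Rightarrow> complex" where
  "plaquette_op_label D K R \<Phi> p s \<psi> = (\<lambda>t.
     \<Sum>r\<in>states D K R \<Phi>. \<psi> r *
       (if t \<in> states D K R (shift_coloring \<Phi> p (deg D s)) \<and> agree_off_plaquette K p r t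
        then plaquette_coeff D K R p s r t else 0))"

definition plaquette_op_deg ::
  "('g::ab_group_add, 'a) LW_data \<Rightarrow> 'e::euclidean_space set set \<Rightarrow> ('e \<times> 'e \<times> 'e) set \<Rightarrow>
    ('e \<times> 'e \<Rightarrow> 'g) \<Rightarrow> 'e \<Rightarrow> 'g \<Rightarrow> (('e, 'a) state \<Rightarrow> complex) \<Rightarrow> ('e, 'a) state \<Rightarrow> complex" where
  "plaquette_op_deg D K R \<Phi> p g \<psi> = (\<lambda>t.
     \<Sum>s\<in>label_set D g. bcoef D s * plaquette_op_label D K R \<Phi> p s \<psi> t)"

text \<open>
  The operator \<open>B\<^sub>p\<close> does not depend on the degree \<open>g\<close> used; a suitable one is chosen.
\<close>

definition plaquette_op ::
  "('g::ab_group_add, 'a) LW_data \<Rightarrow> 'e::euclidean_space set set \<Rightarrow> ('e \<times> 'e \<times> 'e) set \<Rightarrow>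
    ('e \<times> 'e \<Rightarrow> 'g) \<Rightarrow> 'e \<Rightarrow> (('e, 'a) state \<Rightarrow> complex) \<Rightarrow> ('e, 'a) state \<Rightarrow> complex" where
  "plaquette_op D K R \<Phi> p =
     (let g = (SOME g. generic D g \<and> admissible_coloring D K R (shift_coloring \<Phi> p (- g)))
      in plaquette_op_deg D K R (shift_coloring \<Phi> p (- g)) p g \<circ> plaquette_op_deg D K R \<Phi> p (- g))"

lemma plaquette_op_deg_state_space:
  assumes "LW D" "generic D g"
  shows "plaquette_op_deg D K R \<Phi> p g \<psi> \<in> state_space D K R (shift_coloring \<Phi> p g)"
  using LW.deg_label[OF assms]
  by (auto simp: plaquette_op_deg_def plaquette_op_label_def state_space_def intro!: sum.neutral)

lemma shift_coloring_minus: "shift_coloring (shift_coloring \<Phi> p (- g)) p g = \<Phi>"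
  by (auto simp: shift_coloring_def boundary_coloring_def fun_eq_iff)

lemma plaquette_op_state_space:
  assumes "LW D" "\<exists>g. generic D g \<and> admissible_coloring D K R (shift_coloring \<Phi> p (- g))"
  shows "plaquette_op D K R \<Phi> p \<psi> \<in> state_space D K R \<Phi>"
proof -
  define g where "g = (SOME g. generic D g \<and> admissible_coloring D K R (shift_coloring \<Phi> p (- g)))"
  have "generic D g"
    using someI_ex[OF assms(2)] by (simp add: g_def)
  from plaquette_op_deg_state_space[OF assms(1) this, of K R "shift_coloring \<Phi> p (- g)" p]
  show ?thesis
    by (simp add: plaquette_op_def Let_def shift_coloring_minus flip: g_def)
qed

end

theory Submission
  imports Defs
begin

text \<open>
  The operator \<open>B\<^sub>p\<^sup>s\<close> fuses a loop labelled \<open>s\<close> into the boundary of the plaquette \<open>p\<close>. Its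
  matrix coefficients are sums over \<open>A\<close> of products of 6j-symbols, one for every corner of \<open>p\<close>,
  and consecutive corners share an index \<open>A\<^sub>i\<close>: a transfer matrix around the boundary of \<open>p\<close>. All
  three properties come from local identities at the corners and sides.

  Projector. In the composite \<open>B\<^sub>p\<^sup>s B\<^sub>p\<^sup>t\<close> the pentagon identity turns the two symbols at a
  corner into one symbol for a fused label \<open>r\<close>, flanked by one symbol for each adjacent side
  (\<open>corner_fusion\<close>). Summing over the intermediate label of a side, the two flanking symbols that
  meet there are contracted by orthogonality, which identifies the fused labels of the two corners
  at this side (\<open>side_orthogonality\<close>). Since the corners of \<open>p\<close> form a single cycle, only one \<open>r\<close>
  survives, with multiplicity \<open>\<delta>\<close>, so that \<open>B\<^sub>p\<^sup>s B\<^sub>p\<^sup>t = \<Sum>\<^sub>r \<delta>(s,t,r\<^sup>*) B\<^sub>p\<^sup>r\<close> (\<open>cycle_fusion\<close>,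
  \<open>kernel_product\<close>). The equation satisfied by \<open>b\<close> gives \<open>B\<^sub>p\<^sup>g B\<^sub>p\<^sup>h = B\<^sub>p\<^sup>g\<^sup>+\<^sup>h\<close> for generic
  \<open>g\<close>, \<open>h\<close>, \<open>g + h\<close> (\<open>plaquette_op_deg_product\<close>). Hence \<open>B\<^sub>p\<^sup>g B\<^sub>p\<^sup>-\<^sup>g\<close> does not depend on \<open>g\<close> and
  \<open>B\<^sub>p B\<^sub>p = B\<^sub>p\<^sup>g (B\<^sub>p\<^sup>-\<^sup>g B\<^sub>p\<^sup>h) B\<^sub>p\<^sup>-\<^sup>h = B\<^sub>p\<^sup>h B\<^sub>p\<^sup>-\<^sup>h = B\<^sub>p\<close>; smallness of the nongeneric set
  provides degrees for which all intermediate colorings are admissible.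

  Commutation. If two plaquettes have no common edge, neither operator changes what the other one
  depends on. Two plaquettes with a common edge share exactly two triangles. At each of them the
  pentagon rewrites the product of the two corner symbols in one order as a combination of such
  products in the other order (\<open>corner_exchange\<close>). The transition coefficients at the two
  triangles are values of the same 6j-symbol, by its tetrahedral symmetry, so the sums over the
  label of the common edge agree (\<open>edge_sum_exchange\<close>, \<open>kernel_commute\<close>).

  Hermiticity. Conjugating a corner symbol gives the corner symbol of the reverse transition for
  the dual label, times factors \<open>\<gamma>\<close> and \<open>\<beta>\<close>. Around the boundary these telescope to the quotient
  of the weights of the two states in the Hermitian form, so \<open>B\<^sub>p\<^sup>s\<close> and \<open>B\<^sub>p\<^sup>s\<^sup>*\<close> are adjoint
  (\<open>kernel_adjoint\<close>).

  The topology of the surface enters through two facts: every edge has a triangle on both sides,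
  by invariance of domain, and the triangles at a vertex form a single cycle, because a disc stays
  connected after removal of a point.
\<close>

section \<open>Simplices of a complex\<close>

lemma simplicial_Int_face:
  assumes "simplicial_complex K" "S \<in> K" "S' \<in> K"
  shows "S \<inter> S' face_of S"
  using assms unfolding simplicial_complex_def by simp

lemma simplicial_face:
  assumes K: "simplicial_complex K" and "S \<in> K" and "S = convex hull V"
    and "\<not> affine_dependent V" and "W \<subseteq> V"
  shows "convex hull W face_of S" "convex hull W \<in> K"
proof -
  show f: "convex hull W face_of S"
    using assms face_of_convex_hull_affine_independent by blast
  show "convex hull W \<in> K"
    using K f assms(2) unfolding simplicial_complex_def by blast
qed

lemma simplex_obtain:
  assumes "simplicial_complex K" "S \<in> K"
  obtains V where "\<not> affine_dependent V" "S = convex hull V"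
proof -
  obtain n where "n simplex S" using assms unfolding simplicial_complex_def by blast
  then obtain V where "\<not> affine_dependent V" "S = convex hull V" unfolding simplex by auto
  then show thesis by (rule that)
qed

lemma vertex_of_simplex:
  assumes K: "simplicial_complex K" and "{v} \<in> K" and "S \<in> K" and "v \<in> S"
    and S: "S = convex hull V"
  shows "v \<in> V"
proof -
  have "S \<inter> {v} face_of S"
    by (rule simplicial_Int_face[OF K assms(3,2)])
  then have "v extreme_point_of S"
    using \<open>v \<in> S\<close> by (simp add: face_of_singleton)
  then show ?thesis
    using S extreme_point_of_convex_hull by blast
qed

lemma oriented_edge_vertices:
  assumes K: "simplicial_complex K" and e: "(a, b) \<in> oriented_edges K"
  shows "{a} \<in> K" "{b} \<in> K"
proof -
  have ab: "a \<noteq> b" "convex hull {a, b} \<in> K"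
    using e by (auto simp: oriented_edges_def)
  have "\<not> affine_dependent {a, b}"
    by (simp add: affine_independent_2)
  from simplicial_face(2)[OF K ab(2) refl this, of "{a}"] simplicial_face(2)[OF K ab(2) refl this, of "{b}"]
  show "{a} \<in> K" "{b} \<in> K" by auto
qed

section \<open>Edges and vertices of a triangulated surface\<close>

lemma surface_chart:
  assumes X: "closed_surface X" and T: "triangulates K h X" and x: "x \<in> \<Union>K"
  obtains U f g where "openin (top_of_set (\<Union>K)) U" "x \<in> U"
    "homeomorphism U (UNIV :: (real^2) set) f g"
proof -
  have hm: "homeomorphic_map (top_of_set (\<Union>K)) X h"
    using T by (simp add: triangulates_def)
  have "h x \<in> topspace X"
    using homeomorphic_imp_surjective_map[OF hm] x by auto
  then obtain U' where U': "openin X U'" "h x \<in> U'"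
    "subtopology X U' homeomorphic_space (euclidean :: (real^2) topology)"
    using X unfolding closed_surface_def by blast
  define U where "U = {y \<in> \<Union>K. h y \<in> U'}"
  have opU: "openin (top_of_set (\<Union>K)) U"
    using openin_continuous_map_preimage[OF homeomorphic_imp_continuous_map[OF hm] U'(1)]
    by (simp add: U_def)
  have "homeomorphic_map (subtopology (top_of_set (\<Union>K)) U) (subtopology X U') h"
    by (rule homeomorphic_map_subtopologies_alt[OF hm]) (auto simp: U_def)
  then have "subtopology (top_of_set (\<Union>K)) U homeomorphic_space subtopology X U'"
    by (rule homeomorphic_map_imp_homeomorphic_space)
  moreover have "subtopology (top_of_set (\<Union>K)) U = top_of_set U"
  proof -
    have "\<Union>K \<inter> U = U" by (auto simp: U_def)
    then show ?thesis by (simp add: subtopology_subtopology)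
  qed
  ultimately have "top_of_set U homeomorphic_space (euclidean :: (real^2) topology)"
    using homeomorphic_space_trans[OF _ U'(3)] by simp
  then obtain f g where "homeomorphic_maps (top_of_set U) (euclidean :: (real^2) topology) f g"
    unfolding homeomorphic_space_def by blast
  then have fg: "continuous_on U f" "continuous_on UNIV g" "range g \<subseteq> U"
    "\<And>y. y \<in> U \<Longrightarrow> g (f y) = y" "\<And>z. f (g z) = z"
    by (auto simp: homeomorphic_maps_def continuous_map_in_subtopology)
  have "homeomorphism U (UNIV :: (real^2) set) f g"
    by (rule homeomorphismI) (use fg in auto)
  then show thesis
    using that[OF opU] U'(2) x by (auto simp: U_def)
qed

text \<open>
  Open stars of faces have this form.
\<close>

lemma openin_avoiding_simplices:
  assumes "simplicial_complex K"
  shows "openin (top_of_set (\<Union>K)) (\<Union>K - \<Union>{C \<in> K. P C})"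
proof -
  have "closed (\<Union>{C \<in> K. P C})"
    using assms unfolding simplicial_complex_def
    by (intro closed_Union) (auto intro: closed_simplex)
  then have "open (- \<Union>{C \<in> K. P C})" by (simp only: open_Compl)
  from openin_open_Int[OF this, of "\<Union>K"] show ?thesis
    by (simp only: Diff_eq)
qed

lemma openin_chart_image:
  fixes f :: "'e::euclidean_space \<Rightarrow> 'b::euclidean_space"
  assumes hom: "homeomorphism U (UNIV :: 'b set) f g"
    and "openin (top_of_set S) U" and "openin (top_of_set S) W"
  shows "open (f ` (U \<inter> W))"
proof -
  obtain T where T: "open T" "W = S \<inter> T" using assms(3) by (auto simp: openin_open)
  have "U \<inter> W = U \<inter> T" using openin_imp_subset[OF assms(2)] T(2) by blast
  then have "openin (top_of_set U) (U \<inter> W)" using openin_open_Int[OF T(1)] by simp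
  then have "openin (top_of_set UNIV) (f ` (U \<inter> W))"
    by (rule homeomorphism_imp_open_map[OF hom])
  then show ?thesis by (simp only: subtopology_UNIV open_openin)
qed

text \<open>
  A simplex properly larger than its edge \<open>ab\<close> has a further vertex \<open>c\<close>, and \<open>abc\<close> is a face of
  it; a vertex besides \<open>a\<close>, \<open>b\<close>, \<open>c\<close> would give a second triangle at \<open>ab\<close>.
\<close>

lemma subset_single_triangle:
  assumes K: "simplicial_complex K" and ab: "(a, b) \<in> oriented_edges K"
    and C: "C \<in> K" "a \<in> C" "b \<in> C"
    and x: "x \<in> C" "x \<notin> convex hull {a, b}"
  obtains c where "is_triangle K a b c" "c \<in> C"
    "(\<And>c'. is_triangle K a b c' \<Longrightarrow> c' = c) \<Longrightarrow> C = convex hull {a, b, c}"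
proof -
  obtain V where V: "\<not> affine_dependent V" "C = convex hull V"
    using simplex_obtain[OF K C(1)] .
  have abV: "a \<in> V" "b \<in> V" and abne: "a \<noteq> b"
    using vertex_of_simplex[OF K _ C(1) _ V(2)] oriented_edge_vertices[OF K ab] C ab
    by (auto simp: oriented_edges_def)
  have tri: "is_triangle K a b c" if "c \<in> V" "c \<noteq> a" "c \<noteq> b" for c
    unfolding is_triangle_def
    using that abV abne simplicial_face(2)[OF K C(1) V(2,1), of "{a, b, c}"]
      affine_independent_subset[OF V(1), of "{a, b, c}"] by auto
  have "\<not> V \<subseteq> {a, b}"
    using x V(2) hull_mono[of V "{a, b}" convex] by blast
  then obtain c where c: "c \<in> V" "c \<noteq> a" "c \<noteq> b" by auto
  show thesis
  proof (rule that[OF tri[OF c]])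
    show "c \<in> C" using c V(2) hull_subset[of V convex] by auto
    assume "\<And>c'. is_triangle K a b c' \<Longrightarrow> c' = c"
    then have "V = {a, b, c}" using tri c abV by blast
    then show "C = convex hull {a, b, c}" using V(2) by simp
  qed
qed

lemma not_in_segment:
  assumes "\<not> affine_dependent {a, b, c}" "card {a, b, c} = 3"
  shows "c \<notin> convex hull {a, b}"
proof
  assume "c \<in> convex hull {a, b}"
  then have "c \<in> affine hull {a, b}" using convex_hull_subset_affine_hull by blast
  moreover have "{a, b, c} - {c} = {a, b}" using assms(2) by (auto simp: card_insert_if split: if_splits)
  ultimately show False using assms(1) unfolding affine_dependent_def by auto
qed

text \<open>
  If at most one triangle contained the edge \<open>ab\<close>, its open star would be contained in a segment
  or in a triangle with \<open>ab\<close> as a side. Through a chart at the midpoint \<open>x\<close>, an open subset of the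
  plane would embed in a line, against invariance of dimension, or onto a relatively open
  neighbourhood of \<open>x\<close> inside the triangle, against invariance of domain: \<open>x\<close> lies on the relative
  boundary of the triangle.
\<close>

lemma two_triangles_at_edge:
  assumes X: "closed_surface X" and T: "triangulates K h X" and ab: "(a, b) \<in> oriented_edges K"
  obtains c c' where "c \<noteq> c'" "is_triangle K a b c" "is_triangle K a b c'"
proof (rule ccontr)
  assume "\<not> thesis"
  then have uniq: "\<And>c c'. is_triangle K a b c \<Longrightarrow> is_triangle K a b c' \<Longrightarrow> c = c'"
    using that by blast
  have K: "simplicial_complex K" using T by (simp add: triangulates_def)
  have abne: "a \<noteq> b" and seg: "convex hull {a, b} \<in> K"
    using ab by (auto simp: oriented_edges_def)
  define x where "x = midpoint a b"
  define W where "W = \<Union>K - \<Union>{C \<in> K. \<not> {a, b} \<subseteq> C}"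
  have xo: "x \<in> open_segment a b" unfolding x_def using abne by simp
  have xseg: "x \<in> convex hull {a, b}"
    using xo by (simp add: segment_convex_hull[symmetric] open_segment_def)
  have xW: "x \<in> W"
  proof -
    have "{a, b} \<subseteq> C" if "C \<in> K" "x \<in> C" for C
    proof -
      have "(convex hull {a, b}) \<inter> C face_of (convex hull {a, b})"
        by (rule simplicial_Int_face[OF K seg that(1)])
      then show ?thesis
        using xo xseg that(2) hull_subset[of "{a, b}" convex] unfolding face_of_def by blast
    qed
    then show ?thesis using xseg seg unfolding W_def by blast
  qed
  obtain U f g where U: "openin (top_of_set (\<Union>K)) U" "x \<in> U"
    and fg: "homeomorphism U (UNIV :: (real^2) set) f g"
    using surface_chart[OF X T, of x] xseg seg by blast
  have op: "open (f ` (U \<inter> W))"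
    by (rule openin_chart_image[OF fg U(1)]) (simp only: W_def openin_avoiding_simplices[OF K])
  have gf: "\<And>y. y \<in> U \<Longrightarrow> g (f y) = y" "\<And>z. f (g z) = z" "continuous_on UNIV g"
    using fg by (simp_all add: homeomorphism_def)
  have gim: "g ` (f ` (U \<inter> W)) = U \<inter> W"
    using gf(1) by (auto simp: image_image intro!: image_eqI)
  have gcont: "continuous_on (f ` (U \<inter> W)) g"
    by (rule continuous_on_subset[OF gf(3)]) simp
  have ginj: "inj_on g (f ` (U \<inter> W))"
    by (rule inj_on_inverseI[of _ f]) (rule gf(2))
  have ne: "f ` (U \<inter> W) \<noteq> {}" using U xW by auto
  have contain: "C \<in> K \<and> a \<in> C \<and> b \<in> C" if "y \<in> W" "y \<in> C" "C \<in> K" for y C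
    using that unfolding W_def by blast
  have WK: "W \<subseteq> \<Union>K" by (auto simp: W_def)
  show False
  proof (cases "\<exists>c. is_triangle K a b c")
    case False
    have "W \<subseteq> convex hull {a, b}"
    proof (rule subsetI, rule ccontr)
      fix y assume y: "y \<in> W" "y \<notin> convex hull {a, b}"
      then obtain C where C: "C \<in> K" "y \<in> C" using WK by blast
      then show False
        using subset_single_triangle[OF K ab C(1) _ _ C(2) y(2)] contain[OF y(1) C(2,1)] False by blast
    qed
    then have "g ` (f ` (U \<inter> W)) \<subseteq> affine hull {a, b}"
      using gim convex_hull_subset_affine_hull[of "{a, b}"] by auto
    then have "aff_dim (UNIV :: (real^2) set) \<le> aff_dim (affine hull {a, b})"
      using invariance_of_dimension_affine_sets[of UNIV "f ` (U \<inter> W)" "affine hull {a, b}" g]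
        op gcont ginj ne by (auto simp: image_subset_iff_funcset)
    then show False using aff_dim_2[of a b] abne by (simp add: aff_dim_affine_hull)
  next
    case True
    then obtain c where c: "is_triangle K a b c" by blast
    define S where "S = convex hull {a, b, c}"
    have "W \<subseteq> S"
    proof
      fix y assume y: "y \<in> W"
      then obtain C where C: "C \<in> K" "y \<in> C" using WK by blast
      show "y \<in> S"
      proof (cases "y \<in> convex hull {a, b}")
        case True
        then show ?thesis unfolding S_def using hull_mono[of "{a, b}" "{a, b, c}" convex] by blast
      next
        case False
        obtain c' where c': "is_triangle K a b c'"
          "(\<And>c''. is_triangle K a b c'' \<Longrightarrow> c'' = c') \<Longrightarrow> C = convex hull {a, b, c'}"
          using subset_single_triangle[OF K ab C(1) _ _ C(2) False] contain[OF y C(2,1)] by metis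
        then show ?thesis using C uniq c unfolding S_def by blast
      qed
    qed
    have aff: "aff_dim S = 2"
      using c affine_independent_iff_card[of "{a, b, c}"]
      by (auto simp: S_def is_triangle_def aff_dim_convex_hull)
    have "openin (top_of_set (affine hull S)) (g ` (f ` (U \<inter> W)))"
      using gim \<open>W \<subseteq> S\<close> hull_subset[of S affine] op
      by (intro invariance_of_domain_affine_sets[where U = "UNIV :: (real^2) set"])
         (auto simp: aff intro: gcont ginj)
    then have "U \<inter> W \<subseteq> rel_interior S"
      using rel_interior_maximal[of "U \<inter> W" S] \<open>W \<subseteq> S\<close> gim by auto
    then have "x \<in> rel_interior S" using U xW by blast
    moreover have "convex hull {a, b} face_of S"
      using c simplicial_face(1)[OF K, of S "{a, b, c}" "{a, b}"] by (auto simp: S_def is_triangle_def)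
    moreover have "convex hull {a, b} \<noteq> S"
      using c not_in_segment[of a b c] hull_subset[of "{a, b, c}" convex]
      by (auto simp: S_def is_triangle_def)
    ultimately show False
      using face_of_disjoint_rel_interior xseg by blast
  qed
qed

lemma triangle_of_simplex:
  assumes K: "simplicial_complex K" and C: "C \<in> K" and v: "{a} \<in> K" "{b} \<in> K" "{c} \<in> K"
    and inC: "a \<in> C" "b \<in> C" "c \<in> C" and ne: "a \<noteq> b" "a \<noteq> c" "b \<noteq> c"
  shows "is_triangle K a b c"
proof -
  obtain V where V: "\<not> affine_dependent V" "C = convex hull V"
    using simplex_obtain[OF K C] .
  have sub: "{a, b, c} \<subseteq> V"
    using vertex_of_simplex[OF K _ C _ V(2)] v inC by auto
  have "\<not> affine_dependent {a, b, c}"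
    using affine_independent_subset[OF V(1) sub] .
  moreover have "convex hull {a, b, c} \<in> K"
    by (rule simplicial_face(2)[OF K C V(2,1) sub])
  ultimately show ?thesis using ne by (simp add: is_triangle_def)
qed

lemma edge_of_simplex:
  assumes K: "simplicial_complex K" and C: "C \<in> K" and v: "{a} \<in> K" "{b} \<in> K"
    and inC: "a \<in> C" "b \<in> C" and ne: "a \<noteq> b"
  shows "(a, b) \<in> oriented_edges K"
proof -
  obtain V where V: "\<not> affine_dependent V" "C = convex hull V"
    using simplex_obtain[OF K C] .
  have "{a, b} \<subseteq> V"
    using vertex_of_simplex[OF K _ C _ V(2)] v inC by auto
  then show ?thesis
    using simplicial_face(2)[OF K C V(2,1)] ne by (simp add: oriented_edges_def)
qed

text \<open>
  Suppose that the neighbours of \<open>p\<close> split into two classes not joined by triangles at \<open>p\<close>. Every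
  simplex at \<open>p\<close> has its other vertices in a single class, so the open star of \<open>p\<close> minus \<open>p\<close> is
  the disjoint union of two open sets \<open>V N1\<close> and \<open>V N2\<close>. A small disc around \<open>p\<close> stays connected
  when \<open>p\<close> is removed, and it meets \<open>V N\<close> for every nonempty class \<open>N\<close>, so one of the classes is
  empty. Without neighbours the punctured disc would be empty.
\<close>

lemma link_connected:
  assumes X: "closed_surface X" and T: "triangulates K h X" and p: "p \<in> plaquettes K"
    and sep: "\<And>u w. u \<in> N1 \<Longrightarrow> w \<in> N2 \<Longrightarrow> \<not> is_triangle K p u w"
    and un: "N1 \<union> N2 = neighbours K p" and disj: "N1 \<inter> N2 = {}"
  shows "neighbours K p \<noteq> {} \<and> (N1 = {} \<or> N2 = {})"
proof (rule ccontr)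
  assume neg: "\<not> (neighbours K p \<noteq> {} \<and> (N1 = {} \<or> N2 = {}))"
  have K: "simplicial_complex K" using T by (simp add: triangulates_def)
  have pK: "{p} \<in> K" using p by (simp add: plaquettes_def)
  have nb: "{u} \<in> K" "u \<noteq> p" "convex hull {p, u} \<in> K" if "u \<in> neighbours K p" for u
    using that oriented_edge_vertices[OF K, of p u] by (auto simp: neighbours_def oriented_edges_def)
  define W where "W = \<Union>K - \<Union>{C \<in> K. p \<notin> C}"
  define V where "V M = \<Union>K - \<Union>{C \<in> K. p \<notin> C \<or> C \<inter> M = {}}" for M
  obtain U f g where U: "openin (top_of_set (\<Union>K)) U" "p \<in> U"
    and fg: "homeomorphism U (UNIV :: (real^2) set) f g"
    using surface_chart[OF X T, of p] pK by blast
  have gf: "\<And>y. y \<in> U \<Longrightarrow> g (f y) = y" "\<And>z. f (g z) = z" "continuous_on UNIV g" "\<And>z. g z \<in> U"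
    using fg by (auto simp: homeomorphism_def)
  have op: "open (f ` (U \<inter> W))"
    by (rule openin_chart_image[OF fg U(1)]) (simp only: W_def openin_avoiding_simplices[OF K])
  have opV: "open (f ` (U \<inter> V M))" for M
    by (rule openin_chart_image[OF fg U(1)]) (simp only: V_def openin_avoiding_simplices[OF K])
  have pW: "p \<in> W" using pK by (auto simp: W_def)
  then obtain r where r: "r > 0" "ball (f p) r \<subseteq> f ` (U \<inter> W)"
    using op U(2) by (meson IntI imageI openE)
  define B where "B = ball (f p) r - {f p}"
  have aff: "aff_dim (ball (f p) r) = 2"
    using r(1) by (simp add: aff_dim_open)
  have conn: "connected B"
    unfolding B_def by (rule connected_punctured_convex) (use aff in auto)
  \<comment> \<open>A point of the star outside both sets lies in two simplices, one without vertices in \<open>N1\<close> and one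
    without vertices in \<open>N2\<close>; their intersection is a simplex with \<open>p\<close> as its only vertex.\<close>
  have cover: "x = p \<or> x \<in> V N1 \<or> x \<in> V N2" if x: "x \<in> W" for x
  proof (rule ccontr)
    assume "\<not> ?thesis"
    then have xp: "x \<noteq> p" and n: "x \<notin> V N1" "x \<notin> V N2" by auto
    have pC: "p \<in> C" if "C \<in> K" "x \<in> C" for C using x that by (auto simp: W_def)
    obtain C1 where C1: "C1 \<in> K" "x \<in> C1" "C1 \<inter> N1 = {}"
      using n(1) x pC by (auto simp: V_def W_def)
    obtain C2 where C2: "C2 \<in> K" "x \<in> C2" "C2 \<inter> N2 = {}"
      using n(2) x pC by (auto simp: V_def W_def)
    have "C1 \<inter> C2 face_of C1" by (rule simplicial_Int_face[OF K C1(1) C2(1)])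
    then have CK: "C1 \<inter> C2 \<in> K"
      using K C1(1) unfolding simplicial_complex_def by blast
    obtain S where S: "\<not> affine_dependent S" "C1 \<inter> C2 = convex hull S"
      using simplex_obtain[OF K CK] .
    have "S \<subseteq> {p}"
    proof
      fix v assume v: "v \<in> S"
      have vC: "v \<in> C1 \<inter> C2" using v S(2) hull_subset[of S convex] by auto
      have vK: "{v} \<in> K" using simplicial_face(2)[OF K CK S(2,1), of "{v}"] v by simp
      show "v \<in> {p}"
      proof (rule ccontr)
        assume "v \<notin> {p}"
        then have "v \<in> neighbours K p"
          using edge_of_simplex[OF K CK pK vK _ vC] pC C1 C2 by (auto simp: neighbours_def)
        then show False using un vC C1 C2 by blast
      qed
    qed
    then have "C1 \<inter> C2 \<subseteq> {p}" using S(2) hull_mono[of S "{p}" convex] by simp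
    then show False using C1 C2 xp by blast
  qed
  have disjV: "V N1 \<inter> V N2 = {}"
  proof (rule ccontr)
    assume "V N1 \<inter> V N2 \<noteq> {}"
    then obtain x where x12: "x \<in> V N1" "x \<in> V N2" by blast
    then obtain C where "C \<in> K" "x \<in> C" by (auto simp: V_def)
    note x = x12 this
    have pC: "p \<in> C" and "C \<inter> N1 \<noteq> {}" "C \<inter> N2 \<noteq> {}" using x by (auto simp: V_def)
    then obtain u w where u: "u \<in> C" "u \<in> N1" and w: "w \<in> C" "w \<in> N2" by auto
    have "is_triangle K p u w"
      using triangle_of_simplex[OF K x(3) pK _ _ pC u(1) w(1)] nb[of u] nb[of w] u w un disj by auto
    then show False using sep u w by blast
  qed
  have Bimg: "g z \<in> U \<and> g z \<in> W \<and> g z \<noteq> p" if z: "z \<in> B" for z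
  proof -
    obtain y where y: "y \<in> U" "y \<in> W" "z = f y" using z r(2) unfolding B_def by blast
    then show ?thesis using gf(1)[of y] z by (auto simp: B_def)
  qed
  have Bcov: "B \<subseteq> f ` (U \<inter> V N1) \<union> f ` (U \<inter> V N2)"
  proof
    fix z assume z: "z \<in> B"
    have "g z \<in> V N1 \<or> g z \<in> V N2" using cover[of "g z"] Bimg[OF z] by blast
    then show "z \<in> f ` (U \<inter> V N1) \<union> f ` (U \<inter> V N2)"
      using Bimg[OF z] gf(2)[of z] by (metis IntI UnI1 UnI2 imageI)
  qed
  have Bdisj: "f ` (U \<inter> V N1) \<inter> f ` (U \<inter> V N2) \<inter> B = {}"
    using disjV gf(1) by (auto; metis disjoint_iff)
  \<comment> \<open>The points of the edge \<open>pu\<close> close to \<open>p\<close>.\<close>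
  have meets: "f ` (U \<inter> V M) \<inter> B \<noteq> {}" if M: "u \<in> M" "M \<subseteq> neighbours K p" for u M
  proof -
    have u: "u \<noteq> p" "convex hull {p, u} \<in> K" using nb M by auto
    define y where "y t = p + t *\<^sub>R (u - p)" for t :: real
    have yV: "y t \<in> V M" "y t \<noteq> p" if t: "0 < t" "t < 1" for t
    proof -
      have yo: "y t \<in> open_segment p u"
        using t u by (auto simp: in_segment y_def algebra_simps intro!: exI[of _ t])
      then have ys: "y t \<in> convex hull {p, u}"
        by (simp add: segment_convex_hull[symmetric] open_segment_def)
      show "y t \<noteq> p" using yo by (auto simp: open_segment_def)
      have "p \<in> C \<and> u \<in> C" if C: "C \<in> K" "y t \<in> C" for C
      proof -
        have "(convex hull {p, u}) \<inter> C face_of (convex hull {p, u})"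
          by (rule simplicial_Int_face[OF K u(2) C(1)])
        then show ?thesis
          using yo ys C(2) hull_subset[of "{p, u}" convex] unfolding face_of_def by blast
      qed
      then show "y t \<in> V M" using ys u(2) M(1) unfolding V_def by blast
    qed
    have opW: "openin (top_of_set (\<Union>K)) (U \<inter> f -` ball (f p) r)"
      using fg U(1) by (meson continuous_openin_preimage_gen homeomorphism_def open_ball openin_trans)
    then obtain O' where O': "open O'" "U \<inter> f -` ball (f p) r = \<Union>K \<inter> O'"
      by (auto simp: openin_open)
    have "p \<in> O'" using O'(2) U(2) r(1) by auto
    then obtain e where e: "e > 0" "ball p e \<subseteq> O'" using O'(1) openE by blast
    define t where "t = min (1/2) (e / (2 * norm (u - p)))"
    have nz: "norm (u - p) > 0" using u(1) by simp
    have t: "0 < t" "t < 1" using e(1) nz by (auto simp: t_def)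
    have "t * norm (u - p) \<le> e / 2"
      using nz by (auto simp: t_def min_def field_simps)
    then have "dist p (y t) < e" using e(1) t by (simp add: y_def dist_norm)
    then have "y t \<in> O'" using e(2) by auto
    moreover have "y t \<in> \<Union>K" using yV(1)[OF t] by (auto simp: V_def)
    ultimately have "y t \<in> U" "f (y t) \<in> ball (f p) r" using O'(2) by blast+
    moreover have "f (y t) \<noteq> f p" using \<open>y t \<in> U\<close> U(2) gf(1) yV(2)[OF t] by metis
    ultimately show ?thesis using yV(1)[OF t] by (auto simp: B_def)
  qed
  show False
  proof (cases "neighbours K p = {}")
    case True
    then have "N1 = {}" "N2 = {}" using un by auto
    then have "V N1 = {}" "V N2 = {}" unfolding V_def by auto
    then have "B = {}" using Bcov by auto
    then have "ball (f p) r \<subseteq> {f p}" by (auto simp: B_def)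
    then have "aff_dim (ball (f p) r) \<le> aff_dim {f p}" by (rule aff_dim_subset)
    then show False using aff by simp
  next
    case False
    then obtain u w where "u \<in> N1" "w \<in> N2" using neg by auto
    then have "f ` (U \<inter> V N1) \<inter> B \<noteq> {}" "f ` (U \<inter> V N2) \<inter> B \<noteq> {}"
      using meets un by blast+
    then show False
      using connectedD[OF conn opV opV Bdisj Bcov] by blast
  qed
qed

section \<open>Labels, multiplicities and 6j-symbols\<close>

context LW
begin

lemma generic_minus [simp]: "generic D (- g) \<longleftrightarrow> generic D g"
proof -
  have "- g \<in> nongeneric D \<longleftrightarrow> g \<in> nongeneric D"
    using nongeneric_symmetric by (metis (no_types) imageI minus_minus)
  then show ?thesis by (simp add: generic_def)
qed

lemma label_in_labels: "generic D g \<Longrightarrow> j \<in> label_set D g \<Longrightarrow> j \<in> labels D"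
  by (auto simp: labels_def)

lemma labelsD:
  assumes "j \<in> labels D"
  shows "generic D (deg D j)" "j \<in> label_set D (deg D j)"
  using assms deg_label by (auto simp: labels_def)

lemma dual_in_label_set:
  "generic D g \<Longrightarrow> j \<in> label_set D g \<Longrightarrow> dual D j \<in> label_set D (- g)"
  using dual_label_set by blast

lemma dual_labels [simp]: "j \<in> labels D \<Longrightarrow> dual D j \<in> labels D"
  using labelsD[of j] dual_in_label_set[of "deg D j" j] label_in_labels[of "- deg D j" "dual D j"]
  by simp

lemma deg_dual [simp]: "j \<in> labels D \<Longrightarrow> deg D (dual D j) = - deg D j"
  using labelsD[of j] dual_in_label_set[of "deg D j" j] deg_label[of "- deg D j" "dual D j"]
  by simp

lemma dual_eq_iff: "i \<in> labels D \<Longrightarrow> j \<in> labels D \<Longrightarrow> dual D i = dual D j \<longleftrightarrow> i = j"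
  using dual_dual by metis

lemma bij_betw_dual: "generic D g \<Longrightarrow> bij_betw (dual D) (label_set D g) (label_set D (- g))"
  unfolding bij_betw_def
  using dual_label_set[of g] dual_eq_iff label_in_labels[of g] by (auto intro!: inj_onI)

lemma sum_label_dual:
  "generic D g \<Longrightarrow> (\<Sum>j\<in>label_set D (- g). f j) = (\<Sum>j\<in>label_set D g. f (dual D j))"
  using sum.reindex_bij_betw[OF bij_betw_dual] by metis

lemma finite_mult_ix [simp]: "finite (mult_ix D i j k)"
  by (simp add: mult_ix_def)

lemma mult_ix_rot:
  "i \<in> labels D \<Longrightarrow> j \<in> labels D \<Longrightarrow> k \<in> labels D \<Longrightarrow> mult_ix D i j k = mult_ix D j k i"
  using mult_cyclic[of i j k] by (simp add: mult_ix_def)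

lemma mult_ix_rot2:
  "i \<in> labels D \<Longrightarrow> j \<in> labels D \<Longrightarrow> k \<in> labels D \<Longrightarrow> mult_ix D i j k = mult_ix D k i j"
  using mult_ix_rot[of k i j] by simp

lemma mult_ix_dual:
  "i \<in> labels D \<Longrightarrow> j \<in> labels D \<Longrightarrow> k \<in> labels D \<Longrightarrow>
    mult_ix D i j k = mult_ix D (dual D k) (dual D j) (dual D i)"
  using mult_dual[of i j k] by (simp add: mult_ix_def)

text \<open>
  The two generating symmetries hold for all indices, because admissibility is itself invariant:
  both sides vanish together.
\<close>

lemma sixj_rot1:
  assumes "{j1, j2, j3, j4, j5, j6} \<subseteq> labels D"
  shows "sixj D j1 j2 j3 j4 j5 j6 a1 a2 a3 a4 =
    sixj D j2 (dual D j3) (dual D j1) j5 j6 j4 a1 a3 a4 a2"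
proof (cases "sixj_admissible D j1 j2 j3 j4 j5 j6 a1 a2 a3 a4")
  case True
  then show ?thesis using sixj_symmetry[OF assms] by blast
next
  case False
  have "\<not> sixj_admissible D j2 (dual D j3) (dual D j1) j5 j6 j4 a1 a3 a4 a2"
    using False assms mult_ix_rot[of j1 j2 "dual D j3"] mult_ix_rot[of "dual D j1" j5 "dual D j6"]
      mult_ix_rot[of j3 j4 "dual D j5"]
    by (auto simp: sixj_admissible_def dual_dual)
  then show ?thesis using False assms sixj_eq_0 by simp
qed

lemma sixj_rot2:
  assumes "{j1, j2, j3, j4, j5, j6} \<subseteq> labels D"
  shows "sixj D j1 j2 j3 j4 j5 j6 a1 a2 a3 a4 =
    sixj D j3 j4 j5 (dual D j6) j1 (dual D j2) a2 a3 a1 a4"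
proof (cases "sixj_admissible D j1 j2 j3 j4 j5 j6 a1 a2 a3 a4")
  case True
  then show ?thesis using sixj_symmetry[OF assms] by blast
next
  case False
  have "\<not> sixj_admissible D j3 j4 j5 (dual D j6) j1 (dual D j2) a2 a3 a1 a4"
    using False assms mult_ix_rot[of j1 j2 "dual D j3"] mult_ix_rot[of "dual D j1" j5 "dual D j6"]
      mult_ix_rot[of "dual D j2" j6 "dual D j4"]
    by (auto simp: sixj_admissible_def dual_dual)
  then show ?thesis using False assms sixj_eq_0 by simp
qed

text \<open>
  The 6j-symbol that \<open>s\<close> contributes at a corner: \<open>j\<close> and \<open>l\<close> are the labels of the side before
  and of the side after the corner, both oriented counterclockwise, primes mark the labels of the
  image, \<open>k\<close> is the third edge, oriented outwards; \<open>c\<close>, \<open>c'\<close> are the vertex indices before and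
  after, \<open>a\<close>, \<open>b\<close> the indices attached to the two sides.
\<close>

definition corner :: "'a \<Rightarrow> 'a \<Rightarrow> 'a \<Rightarrow> 'a \<Rightarrow> 'a \<Rightarrow> 'a \<Rightarrow> nat \<Rightarrow> nat \<Rightarrow> nat \<Rightarrow> nat \<Rightarrow> complex" where
  "corner s j' j k l' l a c c' b = sixj D j' s j (dual D l) k (dual D l') a c c' b"

lemma corner_eq_0:
  assumes "{s, j', j, k, l', l} \<subseteq> labels D"
    and "a \<notin> mult_ix D j' s (dual D j) \<or> c \<notin> mult_ix D j (dual D l) (dual D k) \<or>
      c' \<notin> mult_ix D j' (dual D l') (dual D k) \<or> b \<notin> mult_ix D l' s (dual D l)"
  shows "corner s j' j k l' l a c c' b = 0"
proof -
  have "mult_ix D j' (dual D l') (dual D k) = mult_ix D k l' (dual D j')"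
    "mult_ix D l' s (dual D l) = mult_ix D (dual D l') l (dual D s)"
    using assms(1) mult_ix_dual[of j' "dual D l'" "dual D k"]
      mult_ix_dual[of l' s "dual D l"] mult_ix_rot2[of l "dual D s" "dual D l'"]
    by (simp_all add: dual_dual)
  then have "\<not> sixj_admissible D j' s j (dual D l) k (dual D l') a c c' b"
    using assms by (auto simp: sixj_admissible_def dual_dual)
  then show ?thesis unfolding corner_def using assms(1) by (intro sixj_eq_0) auto
qed

text \<open>
  This is the pentagon identity: the product of the corner symbols of \<open>t\<close> and then \<open>s\<close>, summed
  over the index of the intermediate state, is its right-hand side. On the left-hand side, apart
  from the corner symbol of the fused label \<open>r\<close>, one symbol depends only on the labels of the
  incoming side of the corner and one only on those of the outgoing side. When an outer index \<open>c\<close>,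
  \<open>c''\<close> is out of range, both sides are 0.
\<close>

lemma corner_fusion:
  assumes lab: "{s, t, j'', j', j, k, l'', l', l} \<subseteq> labels D"
    and a': "a' \<in> mult_ix D j'' s (dual D j')" and a: "a \<in> mult_ix D j' t (dual D j)"
    and b': "b' \<in> mult_ix D l'' s (dual D l')" and b: "b \<in> mult_ix D l' t (dual D l)"
    and gen: "generic D (deg D s + deg D t)"
  shows "(\<Sum>c'\<in>mult_ix D j' (dual D l') (dual D k).
      corner s j'' j' k l'' l' a' c' c'' b' * corner t j' j k l' l a c c' b) =
    (\<Sum>r\<in>label_set D (deg D s + deg D t). \<Sum>c1\<in>mult_ix D j'' r (dual D j).
      \<Sum>c2\<in>mult_ix D s t (dual D r). \<Sum>c3\<in>mult_ix D l'' r (dual D l).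
        dcoef D r * sixj D j'' s j' t j r a' a c1 c2 * corner r j'' j k l'' l c1 c c'' c3 *
        sixj D s t r (dual D l) (dual D l'') (dual D l') c2 c3 b' b)"
proof -
  let ?X = "\<lambda>r c1 c2. sixj D j'' s j' t j r a' a c1 c2"
    and ?Y = "\<lambda>r c2 c3. sixj D s t r (dual D l) (dual D l'') (dual D l') c2 c3 b' b"
    and ?lhs = "\<Sum>c'\<in>mult_ix D j' (dual D l') (dual D k).
      corner s j'' j' k l'' l' a' c' c'' b' * corner t j' j k l' l a c c' b"
  have r_lab: "r \<in> labels D" if "r \<in> label_set D (deg D s + deg D t)" for r
    using label_in_labels[OF gen that] .
  show ?thesis
  proof (cases "c \<in> mult_ix D j (dual D l) (dual D k) \<and> c'' \<in> mult_ix D j'' (dual D l'') (dual D k)")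
    case False
    have z: "corner s j'' j' k l'' l' a' c' c'' b' * corner t j' j k l' l a c c' b = 0" for c'
      using False lab corner_eq_0[of s j'' j' k l'' l' a' c' c'' b'] corner_eq_0[of t j' j k l' l a c c' b]
      by auto
    moreover have "corner r j'' j k l'' l c1 c c'' c3 = 0"
      if "r \<in> label_set D (deg D s + deg D t)" for r c1 c3
      using False lab r_lab[OF that] by (intro corner_eq_0) auto
    ultimately show ?thesis unfolding z by simp
  next
    case True
    have l: "s \<in> labels D" "t \<in> labels D" "j'' \<in> labels D" "j' \<in> labels D" "j \<in> labels D"
      "k \<in> labels D" "l'' \<in> labels D" "l' \<in> labels D" "l \<in> labels D"
      using lab by auto
    note d = dual_dual[OF l(1)] dual_dual[OF l(2)] dual_dual[OF l(3)] dual_dual[OF l(4)]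
      dual_dual[OF l(5)] dual_dual[OF l(6)] dual_dual[OF l(7)] dual_dual[OF l(8)] dual_dual[OF l(9)]
    have p: "c'' \<in> mult_ix D k (dual D (dual D l'')) (dual D j'')"
      "b' \<in> mult_ix D (dual D l'') (dual D (dual D l')) (dual D s)"
      "b \<in> mult_ix D (dual D l') (dual D (dual D l)) (dual D t)"
      "mult_ix D k (dual D (dual D l')) (dual D j') = mult_ix D j' (dual D l') (dual D k)"
      using True b b' l mult_ix_dual[of j'' "dual D l''" "dual D k"] mult_ix_dual[of j' "dual D l'" "dual D k"]
        mult_ix_dual[of l'' s "dual D l'"] mult_ix_rot2[of l' "dual D s" "dual D l''"]
        mult_ix_dual[of l' t "dual D l"] mult_ix_rot2[of l "dual D t" "dual D l'"]
      by (simp_all add: dual_dual)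
    note P = pentagon[of k j'' s t "dual D l" j' j "dual D l''" "dual D l'" c'' a' a c b' b,
        OF _ p(1) a' a _ p(2) p(3) gen]
    have "?lhs =
      (\<Sum>c4\<in>mult_ix D k (dual D (dual D l')) (dual D j').
        sixj D j' t j (dual D l) k (dual D l') a c c4 b *
        sixj D j'' s j' (dual D l') k (dual D l'') a' c4 c'' b')"
      unfolding p(4) by (simp add: corner_def mult.commute)
    also have "\<dots> = (\<Sum>r\<in>label_set D (deg D s + deg D t).
        \<Sum>c1\<in>mult_ix D j (dual D r) (dual D j'').
        \<Sum>c2\<in>mult_ix D r (dual D t) (dual D s).
        \<Sum>c3\<in>mult_ix D (dual D l'') (dual D (dual D l)) (dual D r).
          dcoef D r * ?X r c1 c2
                    * sixj D j'' r j (dual D l) k (dual D l'') c1 c c'' c3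
                    * ?Y r c2 c3)"
      by (rule P[symmetric]) (use True lab in auto)
    also have "\<dots> = (\<Sum>r\<in>label_set D (deg D s + deg D t). \<Sum>c1\<in>mult_ix D j'' r (dual D j).
      \<Sum>c2\<in>mult_ix D s t (dual D r). \<Sum>c3\<in>mult_ix D l'' r (dual D l).
        dcoef D r * ?X r c1 c2 * corner r j'' j k l'' l c1 c c'' c3 *
        ?Y r c2 c3)"
    proof (rule sum.cong[OF refl])
      fix r assume "r \<in> label_set D (deg D s + deg D t)"
      then have r: "r \<in> labels D" by (rule r_lab)
      have m: "mult_ix D j (dual D r) (dual D j'') = mult_ix D j'' r (dual D j)"
        "mult_ix D r (dual D t) (dual D s) = mult_ix D s t (dual D r)"
        "mult_ix D (dual D l'') (dual D (dual D l)) (dual D r) = mult_ix D l'' r (dual D l)"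
        using l r mult_ix_dual[of j'' r "dual D j"] mult_ix_dual[of s t "dual D r"]
          mult_ix_dual[of l'' r "dual D l"] mult_ix_rot2[of l "dual D r" "dual D l''"]
        by (simp_all add: dual_dual)
      show "(\<Sum>c1\<in>mult_ix D j (dual D r) (dual D j'').
        \<Sum>c2\<in>mult_ix D r (dual D t) (dual D s).
        \<Sum>c3\<in>mult_ix D (dual D l'') (dual D (dual D l)) (dual D r).
          dcoef D r * ?X r c1 c2
                    * sixj D j'' r j (dual D l) k (dual D l'') c1 c c'' c3
                    * ?Y r c2 c3) =
        (\<Sum>c1\<in>mult_ix D j'' r (dual D j).
      \<Sum>c2\<in>mult_ix D s t (dual D r). \<Sum>c3\<in>mult_ix D l'' r (dual D l).
        dcoef D r * ?X r c1 c2 * corner r j'' j k l'' l c1 c c'' c3 *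
        ?Y r c2 c3)"
        unfolding m corner_def ..
    qed
    finally show ?thesis .
  qed
qed

text \<open>
  The two symbols left by \<open>corner_fusion\<close> at a side, one from each of its end corners, are the two
  factors in the orthogonality relation, up to a rotation of the first and the substitution of
  \<open>j'\<close> by its dual.
\<close>

lemma side_orthogonality:
  assumes lab: "{s, t, j'', j, r, r'} \<subseteq> labels D"
    and c1: "c1 \<in> mult_ix D j'' r (dual D j)" and c2: "c2 \<in> mult_ix D s t (dual D r)"
    and c2': "c2' \<in> mult_ix D s t (dual D r')" and c3': "c3' \<in> mult_ix D j'' r' (dual D j)"
    and gen: "generic D (deg D j - deg D t)"
  shows "(\<Sum>j'\<in>label_set D (deg D j - deg D t). \<Sum>a'\<in>mult_ix D j'' s (dual D j').
      \<Sum>a\<in>mult_ix D j' t (dual D j).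
        dcoef D j' * sixj D j'' s j' t j r a' a c1 c2 *
        sixj D s t r' (dual D j) (dual D j'') (dual D j') c2' c3' a' a) =
    (if r = r' \<and> c2 = c2' \<and> c1 = c3' then 1 / dcoef D r else 0)"
proof -
  have l: "s \<in> labels D" "t \<in> labels D" "j'' \<in> labels D" "j \<in> labels D" "r \<in> labels D" "r' \<in> labels D"
    using lab by auto
  have m: "c3' \<in> mult_ix D r' (dual D j) (dual D (dual D j''))"
    "c2 \<in> mult_ix D r (dual D t) (dual D s)"
    "c1 \<in> mult_ix D (dual D j'') (dual D (dual D j)) (dual D r)"
    using c1 c2 c3' l mult_ix_rot[of j'' r' "dual D j"] mult_ix_dual[of s t "dual D r"]
      mult_ix_dual[of j'' r "dual D j"] mult_ix_rot2[of j "dual D r" "dual D j''"]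
    by (simp_all add: dual_dual)
  have g: "deg D t + deg D (dual D j) = - (deg D j - deg D t)" using l by simp
  have "(\<Sum>n\<in>label_set D (deg D t + deg D (dual D j)).
          \<Sum>a3\<in>mult_ix D (dual D j'') (dual D n) (dual D s).
          \<Sum>a4\<in>mult_ix D n (dual D (dual D j)) (dual D t).
            dcoef D n * sixj D s t r' (dual D j) (dual D j'') n c2' c3' a3 a4
                      * sixj D r (dual D t) s n (dual D j'') (dual D j) c2 a3 c1 a4) =
        (if r = r' \<and> c2' = c2 \<and> c3' = c1 then 1 / dcoef D r else 0)"
    using l by (intro orthogonality[OF _ c2' m(1) m(2) m(3)]) (simp_all only: g generic_minus gen, auto)
  also have "(\<Sum>n\<in>label_set D (deg D t + deg D (dual D j)).
          \<Sum>a3\<in>mult_ix D (dual D j'') (dual D n) (dual D s).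
          \<Sum>a4\<in>mult_ix D n (dual D (dual D j)) (dual D t).
            dcoef D n * sixj D s t r' (dual D j) (dual D j'') n c2' c3' a3 a4
                      * sixj D r (dual D t) s n (dual D j'') (dual D j) c2 a3 c1 a4) =
     (\<Sum>j'\<in>label_set D (deg D j - deg D t). \<Sum>a'\<in>mult_ix D j'' s (dual D j').
      \<Sum>a\<in>mult_ix D j' t (dual D j).
        dcoef D j' * sixj D j'' s j' t j r a' a c1 c2 *
        sixj D s t r' (dual D j) (dual D j'') (dual D j') c2' c3' a' a)"
    unfolding g sum_label_dual[OF gen]
  proof (rule sum.cong[OF refl])
    fix j' assume "j' \<in> label_set D (deg D j - deg D t)"
    then have j': "j' \<in> labels D" by (rule label_in_labels[OF gen])
    have x: "mult_ix D (dual D j'') (dual D (dual D j')) (dual D s) = mult_ix D j'' s (dual D j')"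
      "mult_ix D (dual D j') (dual D (dual D j)) (dual D t) = mult_ix D j' t (dual D j)"
      using l j' mult_ix_dual[of j'' s "dual D j'"] mult_ix_rot2[of j' "dual D s" "dual D j''"]
        mult_ix_dual[of j' t "dual D j"] mult_ix_rot2[of j "dual D t" "dual D j'"]
      by (simp_all add: dual_dual)
    have y: "sixj D j'' s j' t j r a' a c1 c2 =
        sixj D r (dual D t) s (dual D j') (dual D j'') (dual D j) c2 a' c1 a" for a' a
      using l j' sixj_rot1[of j'' s j' t j r a' a c1 c2]
        sixj_rot2[of s "dual D j'" "dual D j''" j r t a' c1 c2 a]
        sixj_rot2[of "dual D j''" j r "dual D t" s j' c1 c2 a' a]
      by (simp add: dual_dual)
    show "(\<Sum>a3\<in>mult_ix D (dual D j'') (dual D (dual D j')) (dual D s).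
          \<Sum>a4\<in>mult_ix D (dual D j') (dual D (dual D j)) (dual D t).
            dcoef D (dual D j') * sixj D s t r' (dual D j) (dual D j'') (dual D j') c2' c3' a3 a4
                      * sixj D r (dual D t) s (dual D j') (dual D j'') (dual D j) c2 a3 c1 a4) =
     (\<Sum>a'\<in>mult_ix D j'' s (dual D j').
      \<Sum>a\<in>mult_ix D j' t (dual D j).
        dcoef D j' * sixj D j'' s j' t j r a' a c1 c2 *
        sixj D s t r' (dual D j) (dual D j'') (dual D j') c2' c3' a' a)"
      unfolding x y using dcoef[OF j'] by (simp add: mult_ac)
  qed
  finally show ?thesis by (auto simp: eq_commute)
qed

lemma sixj_rot11:
  assumes "{j1, j2, j3, j4, j5, j6} \<subseteq> labels D"
  shows "sixj D j1 j2 j3 j4 j5 j6 a1 a2 a3 a4 =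
    sixj D (dual D j3) j1 (dual D j2) j6 j4 j5 a1 a4 a2 a3"
  using assms sixj_rot1[of j1 j2 j3 j4 j5 j6 a1 a2 a3 a4]
    sixj_rot1[of j2 "dual D j3" "dual D j1" j5 j6 j4 a1 a3 a4 a2]
  by (simp add: dual_dual)

text \<open>
  The transition symbol of \<open>corner_exchange\<close> is unchanged when the two plaquettes at an edge trade
  places: \<open>s\<close> and \<open>t\<close> are swapped and the labels of the edge are replaced by their duals.
\<close>

lemma sixj_exchange_symmetry:
  assumes "{s, t, j'', x, j, y} \<subseteq> labels D"
  shows "sixj D (dual D j) (dual D t) (dual D x) j'' (dual D s) y b a a' b' =
    sixj D j (dual D s) y (dual D j'') (dual D t) (dual D x) a' b' b a"
  using assms sixj_rot1[of "dual D j" "dual D t" "dual D x" j'' "dual D s" y b a a' b']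
    sixj_rot2[of "dual D t" x j "dual D s" y j'' b a' b' a]
  by (simp add: dual_dual)

text \<open>
  The triangle has vertices \<open>p\<close>, \<open>q\<close>, \<open>w\<close>; \<open>j\<close>, \<open>k\<close>, \<open>l\<close> are the labels of the edges \<open>(p, q)\<close>,
  \<open>(p, w)\<close>, \<open>(q, w)\<close>, which \<open>t\<close> at \<open>q\<close> and \<open>s\<close> at \<open>p\<close> together change to \<open>j''\<close>, \<open>k'\<close>, \<open>l'\<close>. The
  left-hand side applies \<open>t\<close> first, with \<open>x\<close> as intermediate label of \<open>(p, q)\<close>; on the right \<open>s\<close>
  comes first, with intermediate label \<open>y\<close>. After rotating the two symbols so that their common
  index becomes the one summed over on the right of the pentagon, this is the pentagon identity.
\<close>

lemma corner_exchange:
  assumes lab: "{s, t, j'', x, j, k, k', l, l'} \<subseteq> labels D"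
    and a: "a \<in> mult_ix D j'' s (dual D x)" and b: "b \<in> mult_ix D (dual D x) t j"
    and a1: "a1 \<in> mult_ix D k' s (dual D k)" and b1: "b1 \<in> mult_ix D l' t (dual D l)"
    and gen: "generic D (deg D j'' - deg D t)"
  shows "(\<Sum>c'\<in>mult_ix D x (dual D k) l'.
      corner t l' l k (dual D x) (dual D j) b1 c c' b *
      corner s j'' x (dual D l') k' k a c' c'' a1) =
    (\<Sum>y\<in>label_set D (deg D j'' - deg D t).
      \<Sum>a'\<in>mult_ix D y s (dual D j). \<Sum>b'\<in>mult_ix D (dual D j'') t y.
        dcoef D y * sixj D (dual D j) (dual D t) (dual D x) j'' (dual D s) y b a a' b' *
        (\<Sum>c'\<in>mult_ix D y (dual D k') l.
          corner s y j (dual D l) k' k a' c c' a1 *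
          corner t l' l k' (dual D j'') (dual D y) b1 c' c'' b'))"
proof -
  let ?M = "\<lambda>y a' b'. sixj D (dual D j) (dual D t) (dual D x) j'' (dual D s) y b a a' b'"
    and ?Q = "\<lambda>y a' b'. \<Sum>c'\<in>mult_ix D y (dual D k') l. corner s y j (dual D l) k' k a' c c' a1 *
      corner t l' l k' (dual D j'') (dual D y) b1 c' c'' b'"
    and ?lhs = "\<Sum>c'\<in>mult_ix D x (dual D k) l'. corner t l' l k (dual D x) (dual D j) b1 c c' b *
      corner s j'' x (dual D l') k' k a c' c'' a1"
  have y_lab: "y \<in> labels D" if "y \<in> label_set D (deg D j'' - deg D t)" for y
    using label_in_labels[OF gen that] .
  have L: "s \<in> labels D" "t \<in> labels D" "j'' \<in> labels D" "x \<in> labels D" "j \<in> labels D"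
    "k \<in> labels D" "k' \<in> labels D" "l \<in> labels D" "l' \<in> labels D"
    using lab by auto
  show ?thesis
  proof (cases "c \<in> mult_ix D l j (dual D k) \<and> c'' \<in> mult_ix D j'' (dual D k') l'")
    case False
    have z: "corner t l' l k (dual D x) (dual D j) b1 c c' b *
      corner s j'' x (dual D l') k' k a c' c'' a1 = 0" for c'
      using False L corner_eq_0[of t l' l k "dual D x" "dual D j" b1 c c' b]
        corner_eq_0[of s j'' x "dual D l'" k' k a c' c'' a1]
      by (auto simp: dual_dual)
    have zero: "corner s y j (dual D l) k' k a' c c' a1 *
          corner t l' l k' (dual D j'') (dual D y) b1 c' c'' b' = 0"
      if "y \<in> label_set D (deg D j'' - deg D t)" for y a' b' c'
      using False L y_lab[OF that] corner_eq_0[of s y j "dual D l" k' k a' c c' a1]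
        corner_eq_0[of t l' l k' "dual D j''" "dual D y" b1 c' c'' b']
        mult_ix_rot[of l j "dual D k"] mult_ix_rot[of l' j'' "dual D k'"]
      by (auto simp: dual_dual)
    have "?Q y a' b' = 0"
      if "y \<in> label_set D (deg D j'' - deg D t)" for y a' b'
      by (rule sum.neutral) (rule ballI, rule zero[OF that])
    then show ?thesis unfolding z by simp
  next
    case True
    have p: "c \<in> mult_ix D (dual D k) (dual D (dual D l)) (dual D (dual D j))"
      "b \<in> mult_ix D (dual D j) (dual D t) (dual D (dual D x))"
      "a \<in> mult_ix D (dual D x) j'' (dual D (dual D s))"
      "a1 \<in> mult_ix D (dual D s) (dual D k') (dual D (dual D k))"
      "b1 \<in> mult_ix D (dual D l) (dual D (dual D l')) (dual D (dual D t))"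
      "c'' \<in> mult_ix D (dual D l') (dual D (dual D k')) (dual D j'')"
      "deg D (dual D t) + deg D j'' = deg D j'' - deg D t"
      using True a b a1 b1 L
        mult_ix_rot2[of l j "dual D k"] mult_ix_dual[of "dual D x" t j]
        mult_ix_rot2[of j'' s "dual D x"] mult_ix_dual[of k' s "dual D k"]
        mult_ix_rot[of k "dual D s" "dual D k'"] mult_ix_rot2[of l' t "dual D l"]
        mult_ix_dual[of j'' "dual D k'" l']
      by (simp_all add: dual_dual)
    have fac: "corner t l' l k (dual D x) (dual D j) b1 c c' b =
        sixj D (dual D j) (dual D t) (dual D x) (dual D l') (dual D k) (dual D l) b c' c b1"
      "corner s j'' x (dual D l') k' k a c' c'' a1 =
        sixj D (dual D x) j'' (dual D s) (dual D k') (dual D k) (dual D l') a a1 c' c''" for c'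
      using L sixj_rot1[of l' t l j k x b1 c c' b] sixj_rot2[of t "dual D l" "dual D l'" k x j b1 c' b c]
        sixj_rot2[of "dual D l'" k x "dual D j" t l c' b b1 c]
        sixj_rot1[of x "dual D j" t "dual D l" "dual D l'" "dual D k" b b1 c' c]
        sixj_rot11[of j'' s x "dual D k" "dual D l'" "dual D k'" a c' c'' a1]
      by (simp_all add: corner_def dual_dual)
    have "?lhs =
      (\<Sum>c4\<in>mult_ix D (dual D k) (dual D (dual D l')) (dual D (dual D x)).
        sixj D (dual D x) j'' (dual D s) (dual D k') (dual D k) (dual D l') a a1 c4 c'' *
        sixj D (dual D j) (dual D t) (dual D x) (dual D l') (dual D k) (dual D l) b c4 c b1)"
      unfolding fac using L mult_ix_rot[of x "dual D k" l'] by (simp add: dual_dual mult.commute)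
    also have "\<dots> = (\<Sum>y\<in>label_set D (deg D j'' - deg D t).
          \<Sum>c1\<in>mult_ix D (dual D s) (dual D y) (dual D (dual D j)).
          \<Sum>c2\<in>mult_ix D y (dual D j'') (dual D (dual D t)).
          \<Sum>c3\<in>mult_ix D (dual D l) (dual D (dual D k')) (dual D y).
            dcoef D y * ?M y c1 c2
                      * sixj D (dual D j) y (dual D s) (dual D k') (dual D k) (dual D l) c1 a1 c c3
                      * sixj D (dual D t) j'' y (dual D k') (dual D l) (dual D l') c2 c3 b1 c'')"
      unfolding p(7)[symmetric]
      by (rule pentagon[symmetric, OF _ p(1,2,3,4,5,6)]) (use L gen in \<open>auto simp: p(7)\<close>)
    also have "\<dots> = (\<Sum>y\<in>label_set D (deg D j'' - deg D t).
      \<Sum>a'\<in>mult_ix D y s (dual D j). \<Sum>b'\<in>mult_ix D (dual D j'') t y.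
        dcoef D y * ?M y a' b' *
        ?Q y a' b')"
    proof (rule sum.cong[OF refl])
      fix y assume "y \<in> label_set D (deg D j'' - deg D t)"
      then have y: "y \<in> labels D" by (rule y_lab)
      have m: "mult_ix D (dual D s) (dual D y) (dual D (dual D j)) = mult_ix D y s (dual D j)"
        "mult_ix D y (dual D j'') (dual D (dual D t)) = mult_ix D (dual D j'') t y"
        "mult_ix D (dual D l) (dual D (dual D k')) (dual D y) = mult_ix D y (dual D k') l"
        using L y mult_ix_dual[of y s "dual D j"] mult_ix_rot[of j "dual D s" "dual D y"]
          mult_ix_rot[of y "dual D j''" t] mult_ix_dual[of y "dual D k'" l]
        by (simp_all add: dual_dual)
      have fac2: "corner s y j (dual D l) k' k a' c c' a1 =
          sixj D (dual D j) y (dual D s) (dual D k') (dual D k) (dual D l) a' a1 c c'"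
        "corner t l' l k' (dual D j'') (dual D y) b1 c' c'' b' =
          sixj D (dual D t) j'' y (dual D k') (dual D l) (dual D l') b' c' b1 c''" for a' c' b'
        using L y sixj_rot11[of y s j "dual D k" "dual D l" "dual D k'" a' c c' a1]
          sixj_rot11[of l' t l y k' j'' b1 c' c'' b']
          sixj_rot2[of "dual D l" l' "dual D t" j'' y k' b1 b' c' c'']
        by (simp_all add: corner_def dual_dual)
      show "(\<Sum>c1\<in>mult_ix D (dual D s) (dual D y) (dual D (dual D j)).
          \<Sum>c2\<in>mult_ix D y (dual D j'') (dual D (dual D t)).
          \<Sum>c3\<in>mult_ix D (dual D l) (dual D (dual D k')) (dual D y).
            dcoef D y * ?M y c1 c2
                      * sixj D (dual D j) y (dual D s) (dual D k') (dual D k) (dual D l) c1 a1 c c3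
                      * sixj D (dual D t) j'' y (dual D k') (dual D l) (dual D l') c2 c3 b1 c'') =
        (\<Sum>a'\<in>mult_ix D y s (dual D j). \<Sum>b'\<in>mult_ix D (dual D j'') t y.
        dcoef D y * ?M y a' b' *
        ?Q y a' b')"
        unfolding m fac2 sum_distrib_left by (simp only: mult.assoc)
    qed
    finally show ?thesis .
  qed
qed

lemma corner_cnj:
  assumes lab: "{s, j', j, k, l', l} \<subseteq> labels D"
    and ix: "a \<in> mult_ix D j' s (dual D j)" "c \<in> mult_ix D j (dual D l) (dual D k)"
      "c' \<in> mult_ix D j' (dual D l') (dual D k)" "b \<in> mult_ix D l' s (dual D l)"
  shows "cnj (corner s j' j k l' l a c c' b) =
    corner (dual D s) j j' k l l' a c' c b *
    gam D a j' s (dual D j) * gam D c j (dual D l) (dual D k) * gam D c' (dual D j') k l' *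
    gam D b (dual D s) (dual D l') l *
    (bet D j' * bet D s * bet D j * bet D l * bet D k * bet D l')"
proof -
  have L: "s \<in> labels D" "j' \<in> labels D" "j \<in> labels D" "k \<in> labels D" "l' \<in> labels D" "l \<in> labels D"
    using lab by auto
  have adm: "sixj_admissible D j' s j (dual D l) k (dual D l') a c c' b"
    using ix L mult_ix_dual[of j' "dual D l'" "dual D k"]
      mult_ix_dual[of l' s "dual D l"] mult_ix_rot2[of l "dual D s" "dual D l'"]
    by (simp add: sixj_admissible_def dual_dual)
  have rot: "sixj D (dual D s) (dual D j') (dual D j) k (dual D l) (dual D l') a c b c' =
      corner (dual D s) j j' k l l' a c' c b"
    using L sixj_rot11[of "dual D s" "dual D j'" "dual D j" k "dual D l" "dual D l'" a c b c']
    by (simp add: corner_def dual_dual)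
  show ?thesis
    using sixj_cnj[OF _ adm] L rot bet by (simp add: corner_def dual_dual)
qed

end

section \<open>Fusion around a cycle of corners\<close>

lemma sum_PiE_prod2:
  fixes f :: "'i \<Rightarrow> 'x \<Rightarrow> 'y \<Rightarrow> 'c::comm_semiring_1"
  assumes "finite N" "\<And>u. u \<in> N \<Longrightarrow> finite (L u)" "\<And>u j. u \<in> N \<Longrightarrow> j \<in> L u \<Longrightarrow> finite (M u j)"
  shows "(\<Sum>J\<in>PiE N L. \<Sum>A\<in>PiE N (\<lambda>u. M u (J u)). \<Prod>u\<in>N. f u (J u) (A u)) =
    (\<Prod>u\<in>N. \<Sum>j\<in>L u. \<Sum>a\<in>M u j. f u j a)"
proof -
  have "(\<Sum>A\<in>PiE N (\<lambda>u. M u (J u)). \<Prod>u\<in>N. f u (J u) (A u)) = (\<Prod>u\<in>N. \<Sum>a\<in>M u (J u). f u (J u) a)"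
    if "J \<in> PiE N L" for J
    using assms that by (intro prod_sum_PiE[symmetric]) auto
  then have "(\<Sum>J\<in>PiE N L. \<Sum>A\<in>PiE N (\<lambda>u. M u (J u)). \<Prod>u\<in>N. f u (J u) (A u)) =
    (\<Sum>J\<in>PiE N L. \<Prod>u\<in>N. \<Sum>a\<in>M u (J u). f u (J u) a)"
    by (rule sum.cong[OF refl])
  also have "\<dots> = (\<Prod>u\<in>N. \<Sum>j\<in>L u. \<Sum>a\<in>M u j. f u j a)"
    using assms by (intro prod_sum_PiE[symmetric]) auto
  finally show ?thesis .
qed

lemma sum_PiE_prod3:
  fixes f :: "'i \<Rightarrow> 'x \<Rightarrow> 'y \<Rightarrow> 'z \<Rightarrow> 'c::comm_semiring_1"
  assumes "finite N" "\<And>u. u \<in> N \<Longrightarrow> finite (L u)" "\<And>u j. u \<in> N \<Longrightarrow> j \<in> L u \<Longrightarrow> finite (M u j)"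
    "\<And>u j. u \<in> N \<Longrightarrow> j \<in> L u \<Longrightarrow> finite (M' u j)"
  shows "(\<Sum>J\<in>PiE N L. \<Sum>A\<in>PiE N (\<lambda>u. M u (J u)). \<Sum>A'\<in>PiE N (\<lambda>u. M' u (J u)).
      \<Prod>u\<in>N. f u (J u) (A u) (A' u)) =
    (\<Prod>u\<in>N. \<Sum>j\<in>L u. \<Sum>a\<in>M u j. \<Sum>a'\<in>M' u j. f u j a a')"
proof -
  have "(\<Sum>A'\<in>PiE N (\<lambda>u. M' u (J u)). \<Prod>u\<in>N. f u (J u) (A u) (A' u)) =
      (\<Prod>u\<in>N. \<Sum>a'\<in>M' u (J u). f u (J u) (A u) a')" if "J \<in> PiE N L" for J A
    using that by (intro prod_sum_PiE[symmetric] assms(1) assms(4)) auto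
  then have "(\<Sum>J\<in>PiE N L. \<Sum>A\<in>PiE N (\<lambda>u. M u (J u)). \<Sum>A'\<in>PiE N (\<lambda>u. M' u (J u)).
      \<Prod>u\<in>N. f u (J u) (A u) (A' u)) =
    (\<Sum>J\<in>PiE N L. \<Sum>A\<in>PiE N (\<lambda>u. M u (J u)). \<Prod>u\<in>N. \<Sum>a'\<in>M' u (J u). f u (J u) (A u) a')"
    by (intro sum.cong refl)
  also have "\<dots> = (\<Prod>u\<in>N. \<Sum>j\<in>L u. \<Sum>a\<in>M u j. \<Sum>a'\<in>M' u j. f u j a a')"
    by (rule sum_PiE_prod2) (use assms in auto)
  finally show ?thesis .
qed

lemma sum_Sigma4:
  assumes "finite L" "\<And>r. r \<in> L \<Longrightarrow> finite (X r)" "\<And>r. r \<in> L \<Longrightarrow> finite (Y r)" "\<And>r. r \<in> L \<Longrightarrow> finite (Z r)"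
  shows "(\<Sum>r\<in>L. \<Sum>x\<in>X r. \<Sum>y\<in>Y r. \<Sum>z\<in>Z r. f (r, x, y, z)) = sum f (SIGMA r:L. X r \<times> Y r \<times> Z r)"
proof -
  have "(\<Sum>x\<in>X r. \<Sum>y\<in>Y r. \<Sum>z\<in>Z r. f (r, x, y, z)) = (\<Sum>w\<in>X r \<times> Y r \<times> Z r. f (r, w))"
    if "r \<in> L" for r
    using assms that by (simp add: sum.cartesian_product')
  then have "(\<Sum>r\<in>L. \<Sum>x\<in>X r. \<Sum>y\<in>Y r. \<Sum>z\<in>Z r. f (r, x, y, z)) =
    (\<Sum>r\<in>L. \<Sum>w\<in>X r \<times> Y r \<times> Z r. f (r, w))"
    by (rule sum.cong[OF refl])
  also have "\<dots> = (\<Sum>(r, w)\<in>(SIGMA r:L. X r \<times> Y r \<times> Z r). f (r, w))"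
    using assms by (intro sum.Sigma) auto
  finally show ?thesis by (simp add: case_prod_unfold)
qed

context LW
begin

text \<open>
  The set \<open>N\<close> indexes the sides of a plaquette and \<open>nx\<close> is the step to the next side; \<open>j\<close>, \<open>J\<close>,
  \<open>j''\<close> are the initial, intermediate and final labels of the sides. Each corner is replaced by
  its fused form, a sum over quadruples \<open>\<theta> u = (r, c1, c2, c3)\<close>. The sum over \<open>J\<close> and both index
  families then factors over the sides, and orthogonality leaves those \<open>\<theta>\<close> for which \<open>r\<close> and \<open>c2\<close>
  agree at consecutive corners and \<open>c3\<close> is the next \<open>c1\<close>. By transitivity \<open>r\<close> and \<open>c2\<close> are
  constant; the sum over \<open>c2\<close> gives the multiplicity, and \<open>c1\<close> becomes the index family of the
  fused operator.
\<close>

lemma cycle_fusion: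
  fixes N :: "'i set" and nx :: "'i \<Rightarrow> 'i"
  assumes fin: "finite N" and ne: "N \<noteq> {}" and bij: "bij_betw nx N N"
    and trans: "\<And>S. S \<subseteq> N \<Longrightarrow> S \<noteq> {} \<Longrightarrow> (\<And>u. u \<in> S \<Longrightarrow> nx u \<in> S) \<Longrightarrow> S = N"
    and st: "s \<in> labels D" "t \<in> labels D" and gen: "generic D (deg D s + deg D t)"
    and lab: "\<And>u. u \<in> N \<Longrightarrow> j u \<in> labels D \<and> j'' u \<in> labels D \<and> k u \<in> labels D"
    and gen': "\<And>u. u \<in> N \<Longrightarrow> generic D (deg D (j u) - deg D t)"
  shows "(\<Sum>J\<in>PiE N (\<lambda>u. label_set D (deg D (j u) - deg D t)).
      \<Sum>C\<in>PiE N (\<lambda>u. {0..mult D (J u) (dual D (J (nx u))) (dual D (k u))}).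
      (\<Sum>A\<in>PiE N (\<lambda>u. mult_ix D (J u) t (dual D (j u))). \<Prod>u\<in>N. dcoef D (J u) *
        corner t (J u) (j u) (k u) (J (nx u)) (j (nx u)) (A u) (c u) (C u) (A (nx u))) *
      (\<Sum>A'\<in>PiE N (\<lambda>u. mult_ix D (j'' u) s (dual D (J u))). \<Prod>u\<in>N. dcoef D (j'' u) *
        corner s (j'' u) (J u) (k u) (j'' (nx u)) (J (nx u)) (A' u) (C u) (c'' u) (A' (nx u)))) =
    (\<Sum>r\<in>label_set D (deg D s + deg D t). of_nat (mult D s t (dual D r)) *
      (\<Sum>A\<in>PiE N (\<lambda>u. mult_ix D (j'' u) r (dual D (j u))). \<Prod>u\<in>N. dcoef D (j'' u) *
        corner r (j'' u) (j u) (k u) (j'' (nx u)) (j (nx u)) (A u) (c u) (c'' u) (A (nx u))))"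
proof -
  let ?ct = "\<lambda>J A u x. corner t (J u) (j u) (k u) (J (nx u)) (j (nx u)) (A u) (c u) x (A (nx u))"
  let ?cs = "\<lambda>J A u x. corner s (j'' u) (J u) (k u) (j'' (nx u)) (J (nx u)) (A u) x (c'' u) (A (nx u))"
  let ?cr = "\<lambda>r A u. corner r (j'' u) (j u) (k u) (j'' (nx u)) (j (nx u)) (A u) (c u) (c'' u) (A (nx u))"
  let ?C = "\<lambda>J u. {0..mult D (J u) (dual D (J (nx u))) (dual D (k u))}"
  define L where "L u = label_set D (deg D (j u) - deg D t)" for u
  define Lr where "Lr = label_set D (deg D s + deg D t)"
  define M where "M u J = mult_ix D J t (dual D (j u))" for u J
  define M' where "M' u J = mult_ix D (j'' u) s (dual D J)" for u J
  define Mr where "Mr u r = mult_ix D (j'' u) r (dual D (j u))" for u r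
  define Mst where "Mst r = mult_ix D s t (dual D r)" for r
  define \<Theta> where "\<Theta> u = (SIGMA r:Lr. Mr u r \<times> Mst r \<times> Mr (nx u) r)" for u
  define X where "X u x a' a = (\<lambda>(r, c1, c2, c3::nat). sixj D (j'' u) s x t (j u) r a' a c1 c2)" for u x a' a
  define Y where "Y u x a' a = (\<lambda>(r, c1::nat, c2, c3).
    sixj D s t r (dual D (j u)) (dual D (j'' u)) (dual D x) c2 c3 a' a)" for u x a' a
  define W where "W u = (\<lambda>(r, c1, c2::nat, c3). dcoef D r *
    corner r (j'' u) (j u) (k u) (j'' (nx u)) (j (nx u)) c1 (c u) (c'' u) c3)" for u
  define pv where "pv = the_inv_into N nx"
  let ?w = "\<lambda>\<theta>. \<Prod>u\<in>N. dcoef D (j'' u) * W u (\<theta> u)"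
    and ?xy = "\<lambda>J A' A \<theta>. \<Prod>u\<in>N. dcoef D (J u) * X u (J u) (A' u) (A u) (\<theta> u) * Y u (J u) (A' u) (A u) (\<theta> (pv u))"
    and ?XWY = "\<lambda>J A A' u \<theta>. X u (J u) (A' u) (A u) \<theta> * W u \<theta> * Y (nx u) (J (nx u)) (A' (nx u)) (A (nx u)) \<theta>"
    and ?I = "\<lambda>J. PiE N (\<lambda>u. M u (J u))" and ?I' = "\<lambda>J. PiE N (\<lambda>u. M' u (J u))" and ?IC = "\<lambda>J. PiE N (?C J)"
  have inj: "inj_on nx N" and img: "nx ` N = N" using bij by (auto simp: bij_betw_def)
  have nxN: "nx u \<in> N" if "u \<in> N" for u using img that by blast
  have pv_nx: "pv (nx u) = u" if "u \<in> N" for u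
    unfolding pv_def using the_inv_into_f_f[OF inj that] .
  have nx_pv: "nx (pv u) = u" if "u \<in> N" for u
    unfolding pv_def using f_the_inv_into_f[OF inj] img that by blast
  have pvN: "pv u \<in> N" if "u \<in> N" for u
    unfolding pv_def using the_inv_into_into[OF inj _ subset_refl] img that by blast
  have Lr_lab: "r \<in> labels D" if "r \<in> Lr" for r
    using label_in_labels[OF gen] that by (simp add: Lr_def)
  have L_lab: "x \<in> labels D" if "u \<in> N" "x \<in> L u" for u x
    using label_in_labels[OF gen'] that by (simp add: L_def)
  have finLr: "finite Lr" unfolding Lr_def by (rule finite_label_set[OF gen])
  have finL: "finite (L u)" if "u \<in> N" for u
    unfolding L_def by (rule finite_label_set[OF gen'[OF that]])
  have finM: "finite (M u x)" "finite (M' u x)" "finite (Mr u x)" "finite (Mst x)" for u x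
    by (simp_all add: M_def M'_def Mr_def Mst_def)
  have fin\<Theta>: "finite (\<Theta> u)" for u
    unfolding \<Theta>_def using finLr finM by auto

  have corner_sum: "(\<Sum>c'\<in>?C J u.
      ?cs J A' u c' * ?ct J A u c') =
    (\<Sum>\<theta>\<in>\<Theta> u. ?XWY J A A' u \<theta>)"
    if J: "J \<in> PiE N L" and A: "A \<in> ?I J" and A': "A' \<in> ?I' J"
      and u: "u \<in> N" for J A A' u
  proof -
    have l: "{s, t, j'' u, J u, j u, k u, j'' (nx u), J (nx u), j (nx u)} \<subseteq> labels D"
      using st lab[OF u] lab[OF nxN[OF u]] L_lab[OF u, of "J u"] L_lab[OF nxN[OF u], of "J (nx u)"]
        J u nxN[OF u] by auto
    have "(\<Sum>c'\<in>?C J u.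
      ?cs J A' u c' * ?ct J A u c') =
      (\<Sum>c'\<in>mult_ix D (J u) (dual D (J (nx u))) (dual D (k u)).
      ?cs J A' u c' * ?ct J A u c')"
    proof (rule sum.mono_neutral_right)
      show "mult_ix D (J u) (dual D (J (nx u))) (dual D (k u))
          \<subseteq> ?C J u"
        by (auto simp: mult_ix_def)
      show "\<forall>i\<in>?C J u -
            mult_ix D (J u) (dual D (J (nx u))) (dual D (k u)).
          ?cs J A' u i * ?ct J A u i = 0"
        using l corner_eq_0[of t "J u" "j u" "k u" "J (nx u)" "j (nx u)"] by auto
    qed simp
    also have "\<dots> = (\<Sum>r\<in>Lr. \<Sum>c1\<in>Mr u r. \<Sum>c2\<in>Mst r. \<Sum>c3\<in>Mr (nx u) r.
        X u (J u) (A' u) (A u) (r, c1, c2, c3) * W u (r, c1, c2, c3) *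
        Y (nx u) (J (nx u)) (A' (nx u)) (A (nx u)) (r, c1, c2, c3))"
      unfolding Lr_def Mr_def Mst_def X_def W_def Y_def split_conv
      using A A' u nxN[OF u] gen l
      by (subst corner_fusion) (auto simp: M_def M'_def PiE_iff mult_ac)
    also have "\<dots> = (\<Sum>\<theta>\<in>\<Theta> u. ?XWY J A A' u \<theta>)"
      unfolding \<Theta>_def using finLr finM by (subst sum_Sigma4[symmetric]) auto
    finally show ?thesis .
  qed

  \<comment> \<open>The symbol for the outgoing side of a corner is moved to the next corner, so that the factors
    are grouped by sides.\<close>
  have shift_Y: "(\<Prod>u\<in>N. Y (nx u) (J (nx u)) (A' (nx u)) (A (nx u)) (\<theta> u)) =
      (\<Prod>u\<in>N. Y u (J u) (A' u) (A u) (\<theta> (pv u)))" for J A A' \<theta>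
  proof -
    have "(\<Prod>u\<in>N. Y u (J u) (A' u) (A u) (\<theta> (pv u))) =
        (\<Prod>u\<in>N. Y (nx u) (J (nx u)) (A' (nx u)) (A (nx u)) (\<theta> (pv (nx u))))"
      by (rule prod.reindex_bij_betw[OF bij, symmetric])
    also have "\<dots> = (\<Prod>u\<in>N. Y (nx u) (J (nx u)) (A' (nx u)) (A (nx u)) (\<theta> u))"
      by (rule prod.cong) (use pv_nx in auto)
    finally show ?thesis by simp
  qed

  have step1: "(\<Sum>C\<in>?IC J.
      (\<Sum>A\<in>?I J. \<Prod>u\<in>N. dcoef D (J u) * ?ct J A u (C u)) *
      (\<Sum>A'\<in>?I' J. \<Prod>u\<in>N. dcoef D (j'' u) * ?cs J A' u (C u))) =
    (\<Sum>A'\<in>?I' J. \<Sum>A\<in>?I J. \<Sum>\<theta>\<in>PiE N \<Theta>.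
      ?w \<theta> *
      ?xy J A' A \<theta>)"
    if J: "J \<in> PiE N L" for J
  proof -
    have "(\<Sum>C\<in>?IC J.
      (\<Sum>A\<in>?I J. \<Prod>u\<in>N. dcoef D (J u) * ?ct J A u (C u)) *
      (\<Sum>A'\<in>?I' J. \<Prod>u\<in>N. dcoef D (j'' u) * ?cs J A' u (C u))) =
      (\<Sum>C\<in>?IC J.
       \<Sum>A\<in>?I J. \<Sum>A'\<in>?I' J.
        \<Prod>u\<in>N. dcoef D (J u) * dcoef D (j'' u) *
        (?cs J A' u (C u) * ?ct J A u (C u)))"
      unfolding sum_product prod.distrib[symmetric]
      by (intro sum.cong prod.cong refl) (simp add: mult_ac)
    also have "\<dots> = (\<Sum>A'\<in>?I' J. \<Sum>A\<in>?I J.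
      \<Sum>C\<in>?IC J.
        \<Prod>u\<in>N. dcoef D (J u) * dcoef D (j'' u) *
        (?cs J A' u (C u) * ?ct J A u (C u)))"
      by (subst (2) sum.swap, subst sum.swap, rule sum.cong[OF refl], rule sum.swap)
    also have "\<dots> = (\<Sum>A'\<in>?I' J. \<Sum>A\<in>?I J.
        \<Sum>\<theta>\<in>PiE N \<Theta>. ?w \<theta> *
      ?xy J A' A \<theta>)"
    proof (rule sum.cong[OF refl], rule sum.cong[OF refl])
      fix A A' assume A: "A \<in> ?I J" and A': "A' \<in> ?I' J"
      have "(\<Sum>C\<in>?IC J.
        \<Prod>u\<in>N. dcoef D (J u) * dcoef D (j'' u) *
        (?cs J A' u (C u) * ?ct J A u (C u))) =
        (\<Prod>u\<in>N. \<Sum>c'\<in>?C J u.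
          dcoef D (J u) * dcoef D (j'' u) *
        (?cs J A' u c' * ?ct J A u c'))"
        by (rule prod_sum_PiE[symmetric]) (use fin in auto)
      also have "\<dots> = (\<Prod>u\<in>N. \<Sum>\<theta>\<in>\<Theta> u. dcoef D (J u) * dcoef D (j'' u) *
          (?XWY J A A' u \<theta>))"
        unfolding sum_distrib_left[symmetric]
        by (rule prod.cong[OF refl]) (simp only: corner_sum[OF J A A'])
      also have "\<dots> = (\<Sum>\<theta>\<in>PiE N \<Theta>. \<Prod>u\<in>N. dcoef D (J u) * dcoef D (j'' u) *
          (X u (J u) (A' u) (A u) (\<theta> u) * W u (\<theta> u) * Y (nx u) (J (nx u)) (A' (nx u)) (A (nx u)) (\<theta> u)))"
        by (rule prod_sum_PiE) (use fin fin\<Theta> in auto)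
      also have "\<dots> = (\<Sum>\<theta>\<in>PiE N \<Theta>. ?w \<theta> *
      ?xy J A' A \<theta>)"
        unfolding prod.distrib shift_Y by (simp only: mult_ac)
      finally show "(\<Sum>C\<in>?IC J.
        \<Prod>u\<in>N. dcoef D (J u) * dcoef D (j'' u) *
        (?cs J A' u (C u) * ?ct J A u (C u))) =
        (\<Sum>\<theta>\<in>PiE N \<Theta>. ?w \<theta> *
      ?xy J A' A \<theta>)" .
    qed
    finally show ?thesis .
  qed

  \<comment> \<open>The matching conditions at the side \<open>u\<close>, between the corners \<open>pv u\<close> and \<open>u\<close>.\<close>
  define ok where "ok \<theta> u = (fst (\<theta> u) = fst (\<theta> (pv u)) \<and>
    fst (snd (snd (\<theta> u))) = fst (snd (snd (\<theta> (pv u)))) \<and>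
    fst (snd (\<theta> u)) = snd (snd (snd (\<theta> (pv u)))))" for \<theta> :: "'i \<Rightarrow> 'a \<times> nat \<times> nat \<times> nat" and u
  let ?ok = "\<lambda>\<theta>. \<Prod>u\<in>N. if ok \<theta> u then 1 / dcoef D (fst (\<theta> u)) else 0"
  have orth: "(\<Sum>x\<in>L u. \<Sum>a'\<in>M' u x. \<Sum>a\<in>M u x.
      dcoef D x * X u x a' a (\<theta> u) * Y u x a' a (\<theta> (pv u))) =
    (if ok \<theta> u then 1 / dcoef D (fst (\<theta> u)) else 0)"
    if \<theta>: "\<theta> \<in> PiE N \<Theta>" and u: "u \<in> N" for \<theta> u
  proof -
    obtain r c1 c2 c3 where 1: "\<theta> u = (r, c1, c2, c3)" by (cases "\<theta> u") auto
    obtain r' c1' c2' c3' where 2: "\<theta> (pv u) = (r', c1', c2', c3')" by (cases "\<theta> (pv u)") auto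
    have "\<theta> u \<in> \<Theta> u" "\<theta> (pv u) \<in> \<Theta> (pv u)" using \<theta> u pvN by auto
    then have h: "r \<in> Lr" "c1 \<in> Mr u r" "c2 \<in> Mst r" "r' \<in> Lr" "c2' \<in> Mst r'" "c3' \<in> Mr u r'"
      unfolding 1 2 using nx_pv[OF u] by (auto simp: \<Theta>_def)
    show ?thesis
      unfolding L_def M'_def M_def X_def Y_def ok_def 1 2 split_conv fst_conv snd_conv
      using st lab[OF u] h Lr_lab gen'[OF u]
      by (intro side_orthogonality) (auto simp: Mr_def Mst_def)
  qed

  have "(\<Sum>J\<in>PiE N L. \<Sum>C\<in>?IC J.
      (\<Sum>A\<in>?I J. \<Prod>u\<in>N. dcoef D (J u) * ?ct J A u (C u)) *
      (\<Sum>A'\<in>?I' J. \<Prod>u\<in>N. dcoef D (j'' u) * ?cs J A' u (C u))) =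
    (\<Sum>J\<in>PiE N L. \<Sum>A'\<in>?I' J. \<Sum>A\<in>?I J. \<Sum>\<theta>\<in>PiE N \<Theta>.
      ?w \<theta> *
      ?xy J A' A \<theta>)"
    by (rule sum.cong[OF refl]) (rule step1)
  also have "\<dots> = (\<Sum>\<theta>\<in>PiE N \<Theta>. \<Sum>J\<in>PiE N L. \<Sum>A'\<in>?I' J.
      \<Sum>A\<in>?I J. ?w \<theta> *
      ?xy J A' A \<theta>)"
    by (simp only: sum.swap[of _ "PiE N \<Theta>"])
  also have "\<dots> = (\<Sum>\<theta>\<in>PiE N \<Theta>. ?w \<theta> *
      ?ok \<theta>)"
  proof (rule sum.cong[OF refl])
    fix \<theta> assume \<theta>: "\<theta> \<in> PiE N \<Theta>"
    have "(\<Sum>J\<in>PiE N L. \<Sum>A'\<in>?I' J. \<Sum>A\<in>?I J.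
      \<Prod>u\<in>N. dcoef D (J u) * X u (J u) (A' u) (A u) (\<theta> u) * Y u (J u) (A' u) (A u) (\<theta> (pv u))) =
      (\<Prod>u\<in>N. \<Sum>x\<in>L u. \<Sum>a'\<in>M' u x. \<Sum>a\<in>M u x.
        dcoef D x * X u x a' a (\<theta> u) * Y u x a' a (\<theta> (pv u)))"
      by (rule sum_PiE_prod3[OF fin finL finM(2) finM(1)])
    also have "\<dots> = ?ok \<theta>"
      by (rule prod.cong[OF refl]) (rule orth[OF \<theta>])
    finally show "(\<Sum>J\<in>PiE N L. \<Sum>A'\<in>?I' J.
      \<Sum>A\<in>?I J. ?w \<theta> *
      ?xy J A' A \<theta>) =
      ?w \<theta> *
      ?ok \<theta>"
      by (simp only: sum_distrib_left[symmetric])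
  qed
  also have "\<dots> = (\<Sum>\<theta>\<in>{\<theta> \<in> PiE N \<Theta>. \<forall>u\<in>N. ok \<theta> u}.
      \<Prod>u\<in>N. dcoef D (j'' u) * W u (\<theta> u) / dcoef D (fst (\<theta> u)))"
  proof (rule sum.mono_neutral_cong_right)
    show "finite (PiE N \<Theta>)" using fin fin\<Theta> by (intro finite_PiE) auto
    show "\<forall>\<theta>\<in>PiE N \<Theta> - {\<theta> \<in> PiE N \<Theta>. \<forall>u\<in>N. ok \<theta> u}.
       ?w \<theta> *
       ?ok \<theta> = 0"
      using fin by (auto simp: prod_zero_iff)
    show "?w \<theta> *
       ?ok \<theta> =
       (\<Prod>u\<in>N. dcoef D (j'' u) * W u (\<theta> u) / dcoef D (fst (\<theta> u)))"
      if "\<theta> \<in> {\<theta> \<in> PiE N \<Theta>. \<forall>u\<in>N. ok \<theta> u}" for \<theta>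
      unfolding prod.distrib[symmetric] using that by (intro prod.cong) auto
  qed auto
  also have "\<dots> = (\<Sum>(r, c2, A)\<in>(SIGMA r:Lr. Mst r \<times> PiE N (\<lambda>u. Mr u r)).
      \<Prod>u\<in>N. dcoef D (j'' u) * ?cr r A u)"
  proof -
    obtain u0 where u0: "u0 \<in> N" using ne by blast
    let ?i = "\<lambda>(r, c2, A). \<lambda>u\<in>N. (r, A u, c2, A (nx u))"
    let ?j = "\<lambda>\<theta>. (fst (\<theta> u0), fst (snd (snd (\<theta> u0))), \<lambda>u\<in>N. fst (snd (\<theta> u)))"
    have const: "fst (\<theta> u) = fst (\<theta> u0) \<and> fst (snd (snd (\<theta> u))) = fst (snd (snd (\<theta> u0)))"
      if ok: "\<forall>u\<in>N. ok \<theta> u" and u: "u \<in> N" for \<theta> :: "'i \<Rightarrow> 'a \<times> nat \<times> nat \<times> nat" and u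
    proof -
      let ?S = "{v \<in> N. fst (\<theta> v) = fst (\<theta> u0) \<and> fst (snd (snd (\<theta> v))) = fst (snd (snd (\<theta> u0)))}"
      have "?S = N"
      proof (rule trans)
        show "?S \<noteq> {}" using u0 by auto
        show "nx v \<in> ?S" if "v \<in> ?S" for v
          using that ok[rule_format, of "nx v"] nxN[of v] pv_nx[of v] by (auto simp: ok_def)
      qed auto
      then show ?thesis using u by blast
    qed
    show ?thesis
    proof (rule sum.reindex_bij_witness[where i = ?i and j = ?j])
      fix \<theta> assume "\<theta> \<in> {\<theta> \<in> PiE N \<Theta>. \<forall>u\<in>N. ok \<theta> u}"
      then have \<theta>: "\<theta> \<in> PiE N \<Theta>" and ok: "\<forall>u\<in>N. ok \<theta> u" by auto
      have form: "\<theta> u = (fst (\<theta> u0), fst (snd (\<theta> u)), fst (snd (snd (\<theta> u0))), fst (snd (\<theta> (nx u))))"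
        if u: "u \<in> N" for u
      proof -
        have c: "fst (\<theta> u0) = fst (\<theta> u)" "fst (snd (snd (\<theta> u0))) = fst (snd (snd (\<theta> u)))"
          using const[OF ok u] by simp_all
        have o: "fst (snd (\<theta> (nx u))) = snd (snd (snd (\<theta> u)))"
          using ok[rule_format, OF nxN[OF u]] pv_nx[OF u] by (simp add: ok_def)
        show ?thesis unfolding c o by simp
      qed
      show "?i (?j \<theta>) = \<theta>"
      proof
        fix u show "?i (?j \<theta>) u = \<theta> u"
        proof (cases "u \<in> N")
          case True
          then have "?i (?j \<theta>) u = (fst (\<theta> u0), fst (snd (\<theta> u)), fst (snd (snd (\<theta> u0))), fst (snd (\<theta> (nx u))))"
            using nxN by simp
          then show ?thesis by (simp only: form[OF True, symmetric])
        next
          case False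
          then show ?thesis using PiE_arb[OF \<theta>] by simp
        qed
      qed
      have mem: "fst (\<theta> u0) \<in> Lr \<and> fst (snd (\<theta> u)) \<in> Mr u (fst (\<theta> u0)) \<and> fst (snd (snd (\<theta> u0))) \<in> Mst (fst (\<theta> u0))"
        if u: "u \<in> N" for u
      proof -
        have "\<theta> u \<in> \<Theta> u" using \<theta> u by auto
        then show ?thesis by (subst (asm) form[OF u]) (auto simp: \<Theta>_def)
      qed
      then show "?j \<theta> \<in> (SIGMA r:Lr. Mst r \<times> PiE N (\<lambda>u. Mr u r))"
        using u0 by auto
      have d: "dcoef D (fst (\<theta> u0)) \<noteq> 0" using dcoef Lr_lab mem[OF u0] by blast
      show "(case ?j \<theta> of (r, c2, A) \<Rightarrow> \<Prod>u\<in>N. dcoef D (j'' u) * ?cr r A u) =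
        (\<Prod>u\<in>N. dcoef D (j'' u) * W u (\<theta> u) / dcoef D (fst (\<theta> u)))"
        unfolding split_conv
      proof (rule prod.cong[OF refl])
        fix u assume u: "u \<in> N"
        have w: "W u (\<theta> u) = dcoef D (fst (\<theta> u0)) * corner (fst (\<theta> u0)) (j'' u) (j u) (k u)
            (j'' (nx u)) (j (nx u)) (fst (snd (\<theta> u))) (c u) (c'' u) (fst (snd (\<theta> (nx u))))"
          by (subst form[OF u]) (simp add: W_def)
        show "dcoef D (j'' u) * corner (fst (\<theta> u0)) (j'' u) (j u) (k u) (j'' (nx u)) (j (nx u))
             ((\<lambda>u\<in>N. fst (snd (\<theta> u))) u) (c u) (c'' u) ((\<lambda>u\<in>N. fst (snd (\<theta> u))) (nx u)) =
          dcoef D (j'' u) * W u (\<theta> u) / dcoef D (fst (\<theta> u))"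
          unfolding w using d u nxN[OF u] const[OF ok u] by simp
      qed
    next
      fix b assume b: "b \<in> (SIGMA r:Lr. Mst r \<times> PiE N (\<lambda>u. Mr u r))"
      obtain r c2 A where bb: "b = (r, c2, A)" by (cases b) auto
      have h: "r \<in> Lr" "c2 \<in> Mst r" "A \<in> PiE N (\<lambda>u. Mr u r)" using b bb by auto
      have hA: "A u \<in> Mr u r" if "u \<in> N" for u using h(3) that by (rule PiE_mem)
      have "(\<lambda>u\<in>N. fst (snd ((\<lambda>u\<in>N. (r, A u, c2, A (nx u))) u))) = restrict A N"
        by (rule restrict_ext) simp
      then show "?j (?i b) = b" using u0 PiE_restrict[OF h(3)] by (simp add: bb)
      show "?i b \<in> {\<theta> \<in> PiE N \<Theta>. \<forall>u\<in>N. ok \<theta> u}"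
        using h(1,2) hA nxN pvN nx_pv by (auto simp: bb ok_def \<Theta>_def)
    qed
  qed
  also have "\<dots> = (\<Sum>r\<in>Lr. of_nat (mult D s t (dual D r)) *
      (\<Sum>A\<in>PiE N (\<lambda>u. Mr u r). \<Prod>u\<in>N. dcoef D (j'' u) * ?cr r A u))"
  proof -
    have "(\<Sum>w\<in>Mst r \<times> PiE N (\<lambda>u. Mr u r). case (r, w) of (r, c2, A) \<Rightarrow>
        \<Prod>u\<in>N. dcoef D (j'' u) * ?cr r A u) =
      of_nat (mult D s t (dual D r)) *
      (\<Sum>A\<in>PiE N (\<lambda>u. Mr u r). \<Prod>u\<in>N. dcoef D (j'' u) * ?cr r A u)" for r
      by (simp add: sum.cartesian_product' Mst_def mult_ix_def)
    moreover have "sum f (SIGMA r:Lr. Mst r \<times> PiE N (\<lambda>u. Mr u r)) =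
        (\<Sum>r\<in>Lr. \<Sum>w\<in>Mst r \<times> PiE N (\<lambda>u. Mr u r). f (r, w))" for f :: "_ \<Rightarrow> complex"
      using finLr finM fin by (subst sum.Sigma) (auto intro!: finite_PiE)
    ultimately show ?thesis by simp
  qed
  finally show ?thesis
    unfolding L_def Lr_def M_def M'_def Mr_def .
qed

end

section \<open>Combinatorics of oriented triangulations\<close>

text \<open>
  The topology of a closed surface is captured by the last two assumptions: they say that every
  edge lies in two triangles and that the link of a vertex is nonempty and connected.
\<close>

locale oriented_triangulation =
  fixes K :: "'e::euclidean_space set set" and R :: "('e \<times> 'e \<times> 'e) set"
  assumes K: "simplicial_complex K" and R: "surface_orientation K R"
    and two_triangles: "(a, b) \<in> oriented_edges K \<Longrightarrow>
      \<exists>c c'. c \<noteq> c' \<and> is_triangle K a b c \<and> is_triangle K a b c'"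
    and link: "\<lbrakk>p \<in> plaquettes K; \<And>u w. u \<in> N1 \<Longrightarrow> w \<in> N2 \<Longrightarrow> \<not> is_triangle K p u w;
      N1 \<union> N2 = neighbours K p; N1 \<inter> N2 = {}\<rbrakk>
      \<Longrightarrow> neighbours K p \<noteq> {} \<and> (N1 = {} \<or> N2 = {})"

lemma oriented_triangulation_closed_surface:
  assumes "closed_surface X" "triangulates K h X" "surface_orientation K R"
  shows "oriented_triangulation K R"
proof
  show "simplicial_complex K" using assms by (simp add: triangulates_def)
  show "surface_orientation K R" by fact
  show "\<exists>c c'. c \<noteq> c' \<and> is_triangle K a b c \<and> is_triangle K a b c'"
    if "(a, b) \<in> oriented_edges K" for a b
    using two_triangles_at_edge[OF assms(1,2) that] by blast
  show "neighbours K p \<noteq> {} \<and> (N1 = {} \<or> N2 = {})"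
    if "p \<in> plaquettes K" "\<And>u w. u \<in> N1 \<Longrightarrow> w \<in> N2 \<Longrightarrow> \<not> is_triangle K p u w"
      "N1 \<union> N2 = neighbours K p" "N1 \<inter> N2 = {}" for p N1 N2
    using link_connected[OF assms(1,2) that] .
qed

context oriented_triangulation
begin

abbreviation "E \<equiv> oriented_edges K"
abbreviation "nb \<equiv> neighbours K"
abbreviation "nx \<equiv> next_neighbour R"
abbreviation "tri p u \<equiv> convex hull {p, u, next_neighbour R p u}"

lemma edge_sym: "(a, b) \<in> E \<Longrightarrow> (b, a) \<in> E"
  by (auto simp: oriented_edges_def insert_commute)

lemma edge_neq: "(a, b) \<in> E \<Longrightarrow> a \<noteq> b"
  by (auto simp: oriented_edges_def)

lemma edge_plaquette: "(a, b) \<in> E \<Longrightarrow> a \<in> plaquettes K" "(a, b) \<in> E \<Longrightarrow> b \<in> plaquettes K"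
  using oriented_edge_vertices[OF K] by (auto simp: plaquettes_def)

lemma finite_plaquettes: "finite (plaquettes K)"
proof -
  have "finite ((\<lambda>p. {p}) -` K)"
    using K by (intro finite_vimageI) (auto simp: simplicial_complex_def)
  then show ?thesis by (simp add: plaquettes_def vimage_def)
qed

lemma finite_edges: "finite E"
  by (rule finite_subset[of _ "plaquettes K \<times> plaquettes K"])
    (use edge_plaquette finite_plaquettes in auto)

lemma finite_nb [simp]: "finite (nb p)"
  by (rule finite_subset[OF _ finite_plaquettes]) (use edge_plaquette in \<open>auto simp: neighbours_def\<close>)

lemma nb_iff: "u \<in> nb p \<longleftrightarrow> (p, u) \<in> E"
  by (simp add: neighbours_def)

lemma nb_sym: "u \<in> nb p \<longleftrightarrow> p \<in> nb u"
  using edge_sym by (auto simp: nb_iff)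

lemma R_triangle: "(a, b, c) \<in> R \<Longrightarrow> is_triangle K a b c"
  and R_rot: "(a, b, c) \<in> R \<Longrightarrow> (b, c, a) \<in> R"
  and R_cases: "is_triangle K a b c \<Longrightarrow> (a, b, c) \<in> R \<or> (a, c, b) \<in> R"
  and R_unique: "(a, b, c) \<in> R \<Longrightarrow> (a, b, c') \<in> R \<Longrightarrow> c = c'"
  using R unfolding surface_orientation_def by blast+

lemma R_swap: "(a, b, c) \<in> R \<Longrightarrow> (a, c, b) \<notin> R"
  using R R_triangle[of a b c] unfolding surface_orientation_def by blast

lemma R_distinct: "(a, b, c) \<in> R \<Longrightarrow> a \<noteq> b \<and> b \<noteq> c \<and> a \<noteq> c"
  using R_triangle[of a b c] by (auto simp: is_triangle_def card_insert_if split: if_splits)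

lemma R_edge:
  assumes "(a, b, c) \<in> R"
  shows "(a, b) \<in> E" "(b, c) \<in> E" "(c, a) \<in> E"
proof -
  have e: "(a, b) \<in> E" if "(a, b, c) \<in> R" for a b c
  proof -
    have "convex hull {a, b} \<in> K"
      using R_triangle[OF that] simplicial_face(2)[OF K _ refl, of "{a, b, c}" "{a, b}"]
      by (auto simp: is_triangle_def)
    then show ?thesis using R_distinct[OF that] by (simp add: oriented_edges_def)
  qed
  show "(a, b) \<in> E" "(b, c) \<in> E" "(c, a) \<in> E"
    using e[OF assms] e[OF R_rot[OF assms]] e[OF R_rot[OF R_rot[OF assms]]] .
qed

lemma left_triangle: "(a, b) \<in> E \<Longrightarrow> \<exists>c. (a, b, c) \<in> R"
proof -
  assume "(a, b) \<in> E"
  then obtain c c' where c: "c \<noteq> c'" "is_triangle K a b c" "is_triangle K a b c'"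
    using two_triangles by blast
  show ?thesis
  proof (rule ccontr)
    assume "\<not> ?thesis"
    then have "(a, c, b) \<in> R" "(a, c', b) \<in> R" using R_cases c by blast+
    then have "(b, a, c) \<in> R" "(b, a, c') \<in> R" using R_rot by blast+
    then show False using R_unique c(1) by blast
  qed
qed

lemma nx_eq: "(p, u, w) \<in> R \<Longrightarrow> nx p u = w"
  unfolding next_neighbour_def using R_unique by blast

lemma nx_R: "u \<in> nb p \<Longrightarrow> (p, u, nx p u) \<in> R"
  using left_triangle[of p u] nx_eq by (auto simp: nb_iff)

lemma nx_nb: "u \<in> nb p \<Longrightarrow> nx p u \<in> nb p"
  using R_edge(3)[OF nx_R, of u p] edge_sym by (simp add: nb_iff)

lemma nx_edge: "u \<in> nb p \<Longrightarrow> (nx p u, u) \<in> E"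
  using nx_R R_edge(2) edge_sym by blast

lemma nx_inj: "inj_on (nx p) (nb p)"
proof (rule inj_onI)
  fix u u' assume "u \<in> nb p" "u' \<in> nb p" "nx p u = nx p u'"
  then have "(p, u, nx p u) \<in> R" "(p, u', nx p u) \<in> R" using nx_R by metis+
  then have "(nx p u, p, u) \<in> R" "(nx p u, p, u') \<in> R" using R_rot by blast+
  then show "u = u'" using R_unique by blast
qed

lemma nx_bij: "bij_betw (nx p) (nb p) (nb p)"
  unfolding bij_betw_def
  using nx_inj nx_nb endo_inj_surj[OF finite_nb _ nx_inj] by blast

lemma nx_neq: "u \<in> nb p \<Longrightarrow> nx p u \<noteq> u" "u \<in> nb p \<Longrightarrow> nx p u \<noteq> p" "u \<in> nb p \<Longrightarrow> u \<noteq> p"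
  using R_distinct[OF nx_R, of u p] by auto

lemma R_corner: "(p, u, w) \<in> R \<Longrightarrow> u \<in> nb p \<and> w = nx p u"
  using nx_eq R_edge(1) by (auto simp: nb_iff)

lemma plaquette_nb_nonempty: "p \<in> plaquettes K \<Longrightarrow> nb p \<noteq> {}"
  using link[of p "{}" "nb p"] by auto

text \<open>
  Going around \<open>p\<close> reaches every neighbour: a set closed under \<open>nx p\<close> is a union of components of
  the link.
\<close>

lemma nx_transitive:
  assumes p: "p \<in> plaquettes K" and S: "S \<subseteq> nb p" "S \<noteq> {}" and cl: "\<And>u. u \<in> S \<Longrightarrow> nx p u \<in> S"
  shows "S = nb p"
proof -
  have fin: "finite S" using S(1) by (rule finite_subset) simp
  have surj: "nx p ` S = S"
    by (rule endo_inj_surj[OF fin]) (use cl inj_on_subset[OF nx_inj S(1)] in auto)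
  have "\<not> is_triangle K p u w" if u: "u \<in> S" and w: "w \<in> nb p - S" for u w
  proof
    assume "is_triangle K p u w"
    then consider "(p, u, w) \<in> R" | "(p, w, u) \<in> R" using R_cases by blast
    then show False
    proof cases
      case 1
      then show False using nx_eq[OF 1] cl[OF u] w by auto
    next
      case 2
      obtain u' where "u' \<in> S" "nx p u' = u" using surj u by (metis imageE)
      then have "nx p u' = nx p w" using nx_eq[OF 2] by simp
      then have "u' = w"
        by (rule inj_onD[OF nx_inj]) (use \<open>u' \<in> S\<close> S(1) w in auto)
      then show False using \<open>u' \<in> S\<close> w by blast
    qed
  qed
  then show ?thesis using link[OF p, of S "nb p - S"] S by blast
qed

text \<open>
  Vertices of a complex are extreme points of every simplex that contains them.
\<close>

lemma plaquette_in_triangle: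
  assumes "(a, b, c) \<in> R" "x \<in> plaquettes K"
  shows "x \<in> convex hull {a, b, c} \<longleftrightarrow> x \<in> {a, b, c}"
  using assms vertex_of_simplex[OF K, of x "convex hull {a, b, c}" "{a, b, c}"] R_triangle[OF assms(1)]
    hull_subset[of "{a, b, c}" convex]
  by (auto simp: plaquettes_def is_triangle_def)

lemma R_plaquettes: "(a, b, c) \<in> R \<Longrightarrow> a \<in> plaquettes K \<and> b \<in> plaquettes K \<and> c \<in> plaquettes K"
  using R_edge edge_plaquette by blast

lemma triangle_vertices:
  "(a, b, c) \<in> R \<Longrightarrow> convex hull {a, b, c} \<inter> plaquettes K = {a, b, c}"
  using plaquette_in_triangle[of a b c] R_plaquettes[of a b c] by blast

lemma same_triangle:
  assumes "(a, b, c) \<in> R" "(a', b', c') \<in> R" "convex hull {a, b, c} = convex hull {a', b', c'}"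
  shows "(a', b', c') = (a, b, c) \<or> (a', b', c') = (b, c, a) \<or> (a', b', c') = (c, a, b)"
proof -
  have eq: "{a, b, c} = {a', b', c'}"
    using triangle_vertices[OF assms(1)] triangle_vertices[OF assms(2)]
    unfolding assms(3) by (rule trans[OF sym])
  have r: "(b, c, a) \<in> R" "(c, a, b) \<in> R"
    using R_rot[OF assms(1)] R_rot[OF R_rot[OF assms(1)]] by simp_all
  have n: "(a, c, b) \<notin> R" "(b, a, c) \<notin> R" "(c, b, a) \<notin> R"
    using R_swap[OF assms(1)] R_swap[OF r(1)] R_swap[OF r(2)] by simp_all
  have "a' \<in> {a, b, c}" "b' \<in> {a, b, c}" "c' \<in> {a, b, c}" unfolding eq by simp_all
  then show ?thesis
    using n assms(2) R_distinct[OF assms(2)] by auto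
qed

lemma dual_vertices_iff: "T \<in> dual_vertices K \<longleftrightarrow> (\<exists>a b c. (a, b, c) \<in> R \<and> T = convex hull {a, b, c})"
proof
  assume "T \<in> dual_vertices K"
  then have "T \<in> K" "2 simplex T" by (auto simp: dual_vertices_def)
  then obtain V where V: "\<not> affine_dependent V" "int (card V) = 2 + 1" "T = convex hull V"
    unfolding simplex_def by blast
  then have "card V = 3" by linarith
  then obtain a b c where abc: "V = {a, b, c}" by (auto simp: card_3_iff)
  then have "is_triangle K a b c" using V \<open>T \<in> K\<close> \<open>card V = 3\<close> by (simp add: is_triangle_def)
  then show "\<exists>a b c. (a, b, c) \<in> R \<and> T = convex hull {a, b, c}"
    using R_cases V(3) abc by (metis insert_commute)
next
  assume "\<exists>a b c. (a, b, c) \<in> R \<and> T = convex hull {a, b, c}"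
  then obtain a b c where "(a, b, c) \<in> R" and T: "T = convex hull {a, b, c}" by blast
  have t: "is_triangle K a b c" using \<open>(a, b, c) \<in> R\<close> by (rule R_triangle)
  have "2 simplex T"
    using t unfolding T is_triangle_def by (intro simplex_convex_hull) auto
  then show "T \<in> dual_vertices K" using t T by (simp add: dual_vertices_def is_triangle_def)
qed

lemma finite_dual_vertices: "finite (dual_vertices K)"
  using K unfolding simplicial_complex_def dual_vertices_def by auto

lemma tri_dual_vertex: "u \<in> nb p \<Longrightarrow> tri p u \<in> dual_vertices K"
  using nx_R dual_vertices_iff by blast

lemma dual_vertices_at:
  assumes "p \<in> plaquettes K"
  shows "{T \<in> dual_vertices K. p \<in> T} = tri p ` nb p"
proof
  show "{T \<in> dual_vertices K. p \<in> T} \<subseteq> tri p ` nb p"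
  proof
    fix T assume "T \<in> {T \<in> dual_vertices K. p \<in> T}"
    then obtain a b c where abc: "(a, b, c) \<in> R" "T = convex hull {a, b, c}" "p \<in> T"
      using dual_vertices_iff by auto
    then have "p \<in> {a, b, c}" using plaquette_in_triangle assms by blast
    then consider "p = a" | "p = b" | "p = c" by blast
    then obtain u w where "(p, u, w) \<in> R" "T = convex hull {p, u, w}"
    proof cases
      case 1 then show ?thesis using that abc by blast
    next
      case 2 then show ?thesis using that[of c a] R_rot[OF abc(1)] abc(2) by (simp add: insert_commute)
    next
      case 3 then show ?thesis using that[of a b] R_rot[OF R_rot[OF abc(1)]] abc(2) by (simp add: insert_commute)
    qed
    then show "T \<in> tri p ` nb p" using R_corner by blast
  qed
  show "tri p ` nb p \<subseteq> {T \<in> dual_vertices K. p \<in> T}"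
    using tri_dual_vertex hull_subset[of _ convex] by (auto intro: hull_inc)
qed

lemma tri_inj: "inj_on (tri p) (nb p)"
proof (rule inj_onI)
  fix u u' assume u: "u \<in> nb p" "u' \<in> nb p" "tri p u = tri p u'"
  show "u = u'"
    using same_triangle[OF nx_R[OF u(1)] nx_R[OF u(2)] u(3)] nx_neq[OF u(1)] nx_neq[OF u(2)] by auto
qed

lemma edge_hull_vertices:
  assumes "(a, b) \<in> E" "x \<in> plaquettes K"
  shows "x \<in> convex hull {a, b} \<longleftrightarrow> x \<in> {a, b}"
  using assms vertex_of_simplex[OF K, of x "convex hull {a, b}" "{a, b}"]
    hull_subset[of "{a, b}" convex]
  by (auto simp: plaquettes_def oriented_edges_def)

lemma same_edge:
  assumes "(a, b) \<in> E" "(a', b') \<in> E" "convex hull {a, b} = convex hull {a', b'}"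
  shows "(a', b') = (a, b) \<or> (a', b') = (b, a)"
proof -
  have "{a, b} = {a', b'}"
    using edge_hull_vertices[OF assms(1)] edge_hull_vertices[OF assms(2)] assms
      edge_plaquette[OF assms(1)] edge_plaquette[OF assms(2)] by blast
  then show ?thesis by (auto simp: doubleton_eq_iff)
qed

lemma dual_edges_iff: "X \<in> dual_edges K \<longleftrightarrow> (\<exists>a b. (a, b) \<in> E \<and> X = convex hull {a, b})"
proof
  assume "X \<in> dual_edges K"
  then have "X \<in> K" "1 simplex X" by (auto simp: dual_edges_def)
  then obtain V where V: "\<not> affine_dependent V" "int (card V) = 1 + 1" "X = convex hull V"
    unfolding simplex_def by blast
  then have "card V = 2" by linarith
  then obtain a b where ab: "V = {a, b}" "a \<noteq> b" by (auto simp: card_2_iff)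
  then show "\<exists>a b. (a, b) \<in> E \<and> X = convex hull {a, b}"
    using V \<open>X \<in> K\<close> by (auto simp: oriented_edges_def)
next
  assume "\<exists>a b. (a, b) \<in> E \<and> X = convex hull {a, b}"
  then obtain a b where ab: "(a, b) \<in> E" and X: "X = convex hull {a, b}" by blast
  then have "1 simplex X"
    unfolding X by (intro simplex_convex_hull) (auto simp: affine_independent_2 oriented_edges_def)
  then show "X \<in> dual_edges K" using ab X by (simp add: dual_edges_def oriented_edges_def)
qed

lemma finite_dual_edges: "finite (dual_edges K)"
  using K unfolding simplicial_complex_def dual_edges_def by auto

lemma edge_rep_cases:
  assumes "(a, b) \<in> E"
  shows "edge_rep K (convex hull {a, b}) = (a, b) \<or> edge_rep K (convex hull {a, b}) = (b, a)"
proof -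
  have "case edge_rep K (convex hull {a, b}) of (c, d) \<Rightarrow> (c, d) \<in> E \<and> convex hull {c, d} = convex hull {a, b}"
    unfolding edge_rep_def by (rule someI[of _ "(a, b)"]) (use assms in simp)
  then show ?thesis using same_edge[OF assms] by (auto split: prod.splits)
qed

lemma triangle_rep_cases:
  assumes "(a, b, c) \<in> R"
  shows "triangle_rep R (convex hull {a, b, c}) \<in> {(a, b, c), (b, c, a), (c, a, b)}"
proof -
  have "case triangle_rep R (convex hull {a, b, c}) of (a', b', c') \<Rightarrow>
      (a', b', c') \<in> R \<and> convex hull {a', b', c'} = convex hull {a, b, c}"
    unfolding triangle_rep_def by (rule someI[of _ "(a, b, c)"]) (use assms in simp)
  then show ?thesis using same_triangle[OF assms] by (auto split: prod.splits)
qed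

lemma hull_pair_inj: "inj_on (\<lambda>u. convex hull {p, u}) (nb p)"
  using same_edge by (force intro!: inj_onI simp: nb_iff)

end

section \<open>Colorings and states\<close>

lemma (in LW) generic_shift_exists:
  assumes "finite Y"
  shows "\<exists>g. \<forall>y\<in>Y. generic D (y - g)"
proof -
  obtain g where g: "g \<notin> {y + x | y x. y \<in> Y \<and> x \<in> nongeneric D}"
    using nongeneric_small[OF assms] by blast
  have "generic D (g - y)" if y: "y \<in> Y" for y
  proof (rule ccontr)
    assume "\<not> generic D (g - y)"
    then have "g - y \<in> nongeneric D" by (simp add: generic_def)
    moreover have "g = y + (g - y)" by simp
    ultimately show False using g y by blast
  qed
  then have "generic D (- (y - g))" if "y \<in> Y" for y using that by simp
  then show ?thesis unfolding generic_minus by blast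
qed

locale LW_surface = LW D + oriented_triangulation K R
  for D :: "('g::ab_group_add, 'a) LW_data" and K :: "'e::euclidean_space set set"
    and R :: "('e \<times> 'e \<times> 'e) set"
begin

abbreviation "adm \<equiv> admissible_coloring D K R"
abbreviation "St \<equiv> states D K R"
abbreviation "agree \<equiv> agree_off_plaquette K"

lemma color_minus: "adm \<Phi> \<Longrightarrow> (a, b) \<in> E \<Longrightarrow> \<Phi> (b, a) = - \<Phi> (a, b)"
  by (auto simp: admissible_coloring_def coloring_def)

lemma color_triangle: "adm \<Phi> \<Longrightarrow> (a, b, c) \<in> R \<Longrightarrow> \<Phi> (a, b) + \<Phi> (c, a) + \<Phi> (b, c) = 0"
  by (auto simp: admissible_coloring_def coloring_def)

lemma color_generic: "adm \<Phi> \<Longrightarrow> e \<in> E \<Longrightarrow> generic D (\<Phi> e)"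
  by (auto simp: admissible_coloring_def)

lemma shift_at: "u \<noteq> p \<Longrightarrow> shift_coloring \<Phi> p g (p, u) = \<Phi> (p, u) - g"
  by (simp add: shift_coloring_def boundary_coloring_def)

lemma shift_at': "u \<noteq> p \<Longrightarrow> shift_coloring \<Phi> p g (u, p) = \<Phi> (u, p) + g"
  by (simp add: shift_coloring_def boundary_coloring_def)

lemma shift_off: "a \<noteq> p \<Longrightarrow> b \<noteq> p \<Longrightarrow> shift_coloring \<Phi> p g (a, b) = \<Phi> (a, b)"
  by (simp add: shift_coloring_def boundary_coloring_def)

lemma shift_shift: "shift_coloring (shift_coloring \<Phi> p g) p h = shift_coloring \<Phi> p (g + h)"
  by (auto simp: shift_coloring_def boundary_coloring_def fun_eq_iff algebra_simps)

lemma shift_commute: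
  "shift_coloring (shift_coloring \<Phi> p g) q h = shift_coloring (shift_coloring \<Phi> q h) p g"
  by (simp add: shift_coloring_def fun_eq_iff add.assoc add.commute)

lemma shift_zero: "shift_coloring \<Phi> p 0 = \<Phi>"
  by (auto simp: shift_coloring_def boundary_coloring_def fun_eq_iff)

lemma admissible_shift:
  assumes adm: "adm \<Phi>" and gen: "\<And>u. u \<in> nb p \<Longrightarrow> generic D (\<Phi> (p, u) - g)"
  shows "adm (shift_coloring \<Phi> p g)"
  unfolding admissible_coloring_def coloring_def
proof (intro conjI ballI)
  fix e assume e: "e \<in> E"
  obtain a b where ab: "e = (a, b)" by (cases e) auto
  have ne: "a \<noteq> b" using e ab edge_neq by blast
  have m: "\<Phi> (b, a) = - \<Phi> (a, b)" using color_minus[OF adm] e ab by blast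
  show "case e of (a, b) \<Rightarrow> shift_coloring \<Phi> p g (b, a) = - shift_coloring \<Phi> p g (a, b)"
    unfolding ab split_conv
    using ne m by (auto simp: shift_coloring_def boundary_coloring_def)
  show "generic D (shift_coloring \<Phi> p g e)"
  proof -
    consider "a = p" | "b = p" | "a \<noteq> p" "b \<noteq> p" by blast
    then show ?thesis
    proof cases
      case 1
      then show ?thesis using gen[of b] e ab ne by (simp add: shift_at nb_iff)
    next
      case 2
      have "generic D (- (\<Phi> (p, a) - g))"
        unfolding generic_minus using gen[of a] e ab 2 edge_sym by (auto simp: nb_iff)
      moreover have "\<Phi> (a, p) = - \<Phi> (p, a)" using color_minus[OF adm] edge_sym e ab 2 by blast
      ultimately show ?thesis using 2 ne ab by (simp add: shift_at')
    next
      case 3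
      then show ?thesis using color_generic[OF adm e] ab by (simp add: shift_off)
    qed
  qed
next
  fix x assume x: "x \<in> R"
  obtain a b c where abc: "x = (a, b, c)" by (cases x) auto
  have R: "(a, b, c) \<in> R" using x abc by simp
  have s: "\<Phi> (a, b) + \<Phi> (c, a) + \<Phi> (b, c) = 0" using color_triangle[OF adm R] .
  have "boundary_coloring p g (a, b) + boundary_coloring p g (c, a) + boundary_coloring p g (b, c) = 0"
    using R_distinct[OF R] by (auto simp: boundary_coloring_def)
  then have "(\<Phi> (a, b) + \<Phi> (c, a) + \<Phi> (b, c)) + (boundary_coloring p g (a, b) + boundary_coloring p g (c, a) + boundary_coloring p g (b, c)) = 0"
    using s by simp
  then show "case x of (a, b, c) \<Rightarrow> shift_coloring \<Phi> p g (a, b) + shift_coloring \<Phi> p g (c, a) +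
         shift_coloring \<Phi> p g (b, c) = 0"
    unfolding abc split_conv shift_coloring_def by (simp only: ac_simps)
qed

lemma state_label_set: "r \<in> St \<Phi> \<Longrightarrow> e \<in> E \<Longrightarrow> fst r e \<in> label_set D (\<Phi> e)"
  by (auto simp: states_def)

lemma state_label: "adm \<Phi> \<Longrightarrow> r \<in> St \<Phi> \<Longrightarrow> e \<in> E \<Longrightarrow> fst r e \<in> labels D"
  using state_label_set color_generic label_in_labels by blast

lemma state_deg: "adm \<Phi> \<Longrightarrow> r \<in> St \<Phi> \<Longrightarrow> e \<in> E \<Longrightarrow> deg D (fst r e) = \<Phi> e"
  using state_label_set color_generic deg_label by blast

lemma state_dual: "r \<in> St \<Phi> \<Longrightarrow> (a, b) \<in> E \<Longrightarrow> fst r (b, a) = dual D (fst r (a, b))"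
  by (auto simp: states_def)

lemma state_mult: "r \<in> St \<Phi> \<Longrightarrow> (a, b, c) \<in> R \<Longrightarrow>
  snd r (convex hull {a, b, c}) \<le> mult D (fst r (a, b)) (fst r (c, a)) (fst r (b, c))"
  by (auto simp: states_def)

lemma state_ext: "r \<in> St \<Phi> \<Longrightarrow> e \<notin> E \<Longrightarrow> fst r e = undefined"
    "r \<in> St \<Phi> \<Longrightarrow> T \<notin> dual_vertices K \<Longrightarrow> snd r T = undefined"
  by (cases e; auto simp: states_def extensional_def PiE_def)+

lemma state_eqI:
  assumes "r \<in> St \<Phi>" "t \<in> St \<Phi>'" "\<And>e. e \<in> E \<Longrightarrow> fst r e = fst t e"
    "\<And>T. T \<in> dual_vertices K \<Longrightarrow> snd r T = snd t T"
  shows "r = t"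
proof (rule prod_eqI; rule ext)
  show "fst r e = fst t e" for e
    using assms(3) state_ext(1)[OF assms(1)] state_ext(1)[OF assms(2)] by (cases "e \<in> E") auto
  show "snd r T = snd t T" for T
    using assms(4) state_ext(2)[OF assms(1)] state_ext(2)[OF assms(2)]
    by (cases "T \<in> dual_vertices K") auto
qed

lemma mult_rot_bound:
  assumes "fst s (a, b) \<in> labels D" "fst s (b, c) \<in> labels D" "fst s (c, a) \<in> labels D"
    and "snd s (convex hull {a, b, c}) \<le> mult D (fst s (a, b)) (fst s (c, a)) (fst s (b, c))"
  shows "snd s (convex hull {b, c, a}) \<le> mult D (fst s (b, c)) (fst s (a, b)) (fst s (c, a))"
  using assms mult_cyclic[of "fst s (b, c)" "fst s (a, b)" "fst s (c, a)"]
  by (simp add: insert_commute)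

lemma finite_states:
  assumes adm: "adm \<Phi>"
  shows "finite (St \<Phi>)"
proof -
  let ?S = "\<Pi>\<^sub>E e\<in>E. label_set D (\<Phi> e)"
  let ?B = "\<lambda>\<sigma> T. {n. \<forall>a b c. (a, b, c) \<in> R \<and> T = convex hull {a, b, c} \<longrightarrow>
      n \<le> mult D (\<sigma> (a, b)) (\<sigma> (c, a)) (\<sigma> (b, c))}"
  have "finite ?S"
    using color_generic[OF adm] finite_label_set finite_edges by (intro finite_PiE) auto
  moreover have "finite (?B \<sigma> T)" if T: "T \<in> dual_vertices K" for \<sigma> :: "'e \<times> 'e \<Rightarrow> 'a" and T
  proof -
    obtain a b c where "(a, b, c) \<in> R" "T = convex hull {a, b, c}" using dual_vertices_iff T by blast
    then have "?B \<sigma> T \<subseteq> {..mult D (\<sigma> (a, b)) (\<sigma> (c, a)) (\<sigma> (b, c))}" by blast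
    then show ?thesis by (rule finite_subset) simp
  qed
  then have "finite (PiE (dual_vertices K) (?B \<sigma>))" for \<sigma> :: "'e \<times> 'e \<Rightarrow> 'a"
    using finite_dual_vertices by (intro finite_PiE) auto
  ultimately have "finite (SIGMA \<sigma>:?S. PiE (dual_vertices K) (?B \<sigma>))"
    by (intro finite_SigmaI) auto
  moreover have "St \<Phi> \<subseteq> (SIGMA \<sigma>:?S. PiE (dual_vertices K) (?B \<sigma>))"
  proof
    fix r assume r: "r \<in> St \<Phi>"
    have "fst r \<in> ?S" using r by (cases r) (simp add: states_def)
    moreover have "snd r \<in> PiE (dual_vertices K) (?B (fst r))"
    proof (rule PiE_I)
      show "snd r T \<in> ?B (fst r) T" for T using state_mult[OF r] by auto
      show "snd r T = undefined" if "T \<notin> dual_vertices K" for T by (rule state_ext(2)[OF r that])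
    qed
    ultimately show "r \<in> (SIGMA \<sigma>:?S. PiE (dual_vertices K) (?B \<sigma>))" by (cases r) simp
  qed
  ultimately show ?thesis by (rule finite_subset[rotated])
qed

lemma agree_iff: "agree p r t \<longleftrightarrow>
  (\<forall>a b. (a, b) \<in> E \<longrightarrow> a \<noteq> p \<longrightarrow> b \<noteq> p \<longrightarrow> fst r (a, b) = fst t (a, b)) \<and>
  (\<forall>T. T \<in> dual_vertices K \<longrightarrow> p \<notin> T \<longrightarrow> snd r T = snd t T)"
  by (auto simp: agree_off_plaquette_def)

lemma agree_trans: "agree p r m \<Longrightarrow> agree p m q \<Longrightarrow> agree p r q"
  by (simp add: agree_iff)

lemma agree_sym: "agree p r m \<longleftrightarrow> agree p m r"
  by (simp add: agree_iff eq_commute)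

lemma agree_edge: "agree p r m \<Longrightarrow> (a, b) \<in> E \<Longrightarrow> a \<noteq> p \<Longrightarrow> b \<noteq> p \<Longrightarrow> fst r (a, b) = fst m (a, b)"
  by (auto simp: agree_off_plaquette_def)

lemma agree_vertex: "agree p r m \<Longrightarrow> T \<in> dual_vertices K \<Longrightarrow> p \<notin> T \<Longrightarrow> snd r T = snd m T"
  by (auto simp: agree_off_plaquette_def)

text \<open>
  Every triangle at \<open>p\<close> is \<open>tri p u\<close> for one neighbour \<open>u\<close>, recovered here by the inverse of
  \<open>tri p\<close>.
\<close>

definition change_at :: "'e \<Rightarrow> ('e, 'a) state \<Rightarrow> ('e \<Rightarrow> 'a) \<Rightarrow> ('e \<Rightarrow> nat) \<Rightarrow> ('e, 'a) state" where
  "change_at p r J C =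
    ((\<lambda>e\<in>E. if fst e = p then J (snd e) else if snd e = p then dual D (J (fst e)) else fst r e),
     (\<lambda>T\<in>dual_vertices K. if p \<in> T then C (the_inv_into (nb p) (tri p) T) else snd r T))"

lemma change_at_side [simp]: "u \<in> nb p \<Longrightarrow> fst (change_at p r J C) (p, u) = J u"
  by (simp add: change_at_def nb_iff)

lemma change_at_side' [simp]: "u \<in> nb p \<Longrightarrow> fst (change_at p r J C) (u, p) = dual D (J u)"
  using edge_sym edge_neq by (auto simp: change_at_def nb_iff)

lemma change_at_other_edge [simp]:
  "(a, b) \<in> E \<Longrightarrow> a \<noteq> p \<Longrightarrow> b \<noteq> p \<Longrightarrow> fst (change_at p r J C) (a, b) = fst r (a, b)"
  by (simp add: change_at_def)

lemma change_at_corner [simp]: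
  assumes "p \<in> plaquettes K" "u \<in> nb p"
  shows "snd (change_at p r J C) (tri p u) = C u"
  using tri_dual_vertex[OF assms(2)] the_inv_into_f_f[OF tri_inj assms(2)]
  by (simp add: change_at_def hull_inc)

lemma change_at_other_vertex [simp]:
  "T \<in> dual_vertices K \<Longrightarrow> p \<notin> T \<Longrightarrow> snd (change_at p r J C) T = snd r T"
  by (simp add: change_at_def)

lemma agree_change_at: "agree p r (change_at p r J C)"
  unfolding agree_off_plaquette_def by auto

lemma change_at_state:
  assumes p: "p \<in> plaquettes K" and adm: "adm \<Phi>" "adm \<Phi>'"
    and off: "\<And>a b. a \<noteq> p \<Longrightarrow> b \<noteq> p \<Longrightarrow> \<Phi>' (a, b) = \<Phi> (a, b)"
    and r: "r \<in> St \<Phi>"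
    and J: "\<And>u. u \<in> nb p \<Longrightarrow> J u \<in> label_set D (\<Phi>' (p, u))"
    and C: "\<And>u. u \<in> nb p \<Longrightarrow> C u \<le> mult D (J u) (dual D (J (nx p u))) (dual D (fst r (nx p u, u)))"
  shows "change_at p r J C \<in> St \<Phi>'"
proof -
  let ?m = "change_at p r J C"
  have lab: "fst ?m (a, b) \<in> label_set D (\<Phi>' (a, b)) \<and> fst ?m (b, a) = dual D (fst ?m (a, b))"
    if e: "(a, b) \<in> E" for a b
  proof -
    consider "a = p" | "b = p" | "a \<noteq> p" "b \<noteq> p" by blast
    then show ?thesis
    proof cases
      case 1
      then have "b \<in> nb p" using e by (simp add: nb_iff)
      then show ?thesis using J 1 by simp
    next
      case 2
      then have a: "a \<in> nb p" using edge_sym e by (simp add: nb_iff)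
      have g: "generic D (\<Phi>' (p, a))" using color_generic[OF adm(2)] a by (simp add: nb_iff)
      have "\<Phi>' (a, p) = - \<Phi>' (p, a)" using color_minus[OF adm(2)] a by (simp add: nb_iff)
      then show ?thesis
        using dual_in_label_set[OF g J[OF a]] label_in_labels[OF g J[OF a]] 2 a by (simp add: dual_dual)
    next
      case 3
      then show ?thesis
        using state_label_set[OF r e] state_dual[OF r e] off[OF 3] e edge_sym[OF e] by simp
    qed
  qed
  have lab': "fst ?m e \<in> labels D" if "e \<in> E" for e
    using lab[of "fst e" "snd e"] that color_generic[OF adm(2) that] label_in_labels by (cases e) auto
  have corner: "snd ?m (convex hull {p, u, w}) \<le> mult D (fst ?m (p, u)) (fst ?m (w, p)) (fst ?m (u, w))"
    if puw: "(p, u, w) \<in> R" for u w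
  proof -
    have u: "u \<in> nb p" "w = nx p u" using R_corner[OF puw] by auto
    have "fst r (u, nx p u) = dual D (fst r (nx p u, u))" using state_dual[OF r nx_edge[OF u(1)]] .
    then show ?thesis
      using C[OF u(1)] u p nx_nb[OF u(1)] edge_sym[OF nx_edge[OF u(1)]] nx_neq[OF u(1)] by simp
  qed
  have tri: "snd ?m (convex hull {a, b, c}) \<le> mult D (fst ?m (a, b)) (fst ?m (c, a)) (fst ?m (b, c))"
    if abc: "(a, b, c) \<in> R" for a b c
  proof -
    note e = R_edge[OF abc] and rr = R_rot[OF abc] R_rot[OF R_rot[OF abc]]
    consider "a = p" | "b = p" | "c = p" | "p \<notin> {a, b, c}" by blast
    then show ?thesis
    proof cases
      case 1
      then show ?thesis using corner abc by simp
    next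
      case 2
      then show ?thesis
        using corner[of c a] rr(1) mult_rot_bound[of ?m b c a] mult_rot_bound[of ?m c a b] lab' e by auto
    next
      case 3
      then show ?thesis using corner[of a b] rr(2) mult_rot_bound[of ?m c a b] lab' e by auto
    next
      case 4
      then have "p \<notin> convex hull {a, b, c}" using plaquette_in_triangle[OF abc p] by blast
      moreover have "convex hull {a, b, c} \<in> dual_vertices K" using abc dual_vertices_iff by blast
      moreover have "a \<noteq> p" "b \<noteq> p" "c \<noteq> p" using 4 by auto
      ultimately show ?thesis using state_mult[OF r abc] e by simp
    qed
  qed
  have ext: "fst ?m \<in> extensional E" "snd ?m \<in> extensional (dual_vertices K)"
    by (simp_all add: change_at_def)
  show ?thesis
    unfolding states_def using lab tri ext
    by (cases ?m) (auto simp: PiE_iff)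
qed

text \<open>
  This turns the sum over the intermediate states of a composite at \<open>p\<close> into a sum over
  independent labels of the sides and indices of the corners of \<open>p\<close>.
\<close>

lemma sum_states_agree:
  assumes p: "p \<in> plaquettes K" and adm: "adm \<Phi>" "adm \<Phi>'"
    and off: "\<And>a b. a \<noteq> p \<Longrightarrow> b \<noteq> p \<Longrightarrow> \<Phi>' (a, b) = \<Phi> (a, b)"
    and r: "r \<in> St \<Phi>"
  shows "(\<Sum>m\<in>{m \<in> St \<Phi>'. agree p r m}. F m) =
    (\<Sum>J\<in>PiE (nb p) (\<lambda>u. label_set D (\<Phi>' (p, u))).
     \<Sum>C\<in>PiE (nb p) (\<lambda>u. {0..mult D (J u) (dual D (J (nx p u))) (dual D (fst r (nx p u, u)))}).
      F (change_at p r J C))"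
proof -
  let ?L = "PiE (nb p) (\<lambda>u. label_set D (\<Phi>' (p, u)))"
  let ?M = "\<lambda>J. PiE (nb p) (\<lambda>u. {0..mult D (J u) (dual D (J (nx p u))) (dual D (fst r (nx p u, u)))})"
  have "finite ?L"
    using color_generic[OF adm(2)] finite_label_set by (intro finite_PiE) (auto simp: nb_iff)
  moreover have "finite (?M J)" for J by (intro finite_PiE) auto
  ultimately have "(\<Sum>J\<in>?L. \<Sum>C\<in>?M J. F (change_at p r J C)) =
      (\<Sum>(J, C)\<in>(SIGMA J:?L. ?M J). F (change_at p r J C))"
    by (intro sum.Sigma) auto
  also have "\<dots> = (\<Sum>m\<in>{m \<in> St \<Phi>'. agree p r m}. F m)"
  proof (rule sum.reindex_bij_witness[where i = "\<lambda>m. (\<lambda>u\<in>nb p. fst m (p, u), \<lambda>u\<in>nb p. snd m (tri p u))"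
        and j = "\<lambda>(J, C). change_at p r J C"])
    fix x assume "x \<in> (SIGMA J:?L. ?M J)"
    then obtain J C where x: "x = (J, C)" "J \<in> ?L" "C \<in> ?M J" by (cases x) auto
    have "(\<lambda>u\<in>nb p. fst (change_at p r J C) (p, u)) = restrict J (nb p)"
      by (rule restrict_ext) simp
    moreover have "(\<lambda>u\<in>nb p. snd (change_at p r J C) (tri p u)) = restrict C (nb p)"
      by (rule restrict_ext) (simp add: p)
    ultimately show "(\<lambda>m. (\<lambda>u\<in>nb p. fst m (p, u), \<lambda>u\<in>nb p. snd m (tri p u))) (case x of (J, C) \<Rightarrow> change_at p r J C) = x"
      using PiE_restrict[OF x(2)] PiE_restrict[OF x(3)] x(1) by simp
    have "change_at p r J C \<in> St \<Phi>'"
      by (rule change_at_state[OF p adm off r]) (use x in \<open>auto simp: PiE_iff\<close>)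
    then show "(case x of (J, C) \<Rightarrow> change_at p r J C) \<in> {m \<in> St \<Phi>'. agree p r m}"
      using x agree_change_at by simp
    show "F (case x of (J, C) \<Rightarrow> change_at p r J C) = (case x of (J, C) \<Rightarrow> F (change_at p r J C))"
      by (simp add: x)
  next
    fix m assume "m \<in> {m \<in> St \<Phi>'. agree p r m}"
    then have m: "m \<in> St \<Phi>'" and ag: "agree p r m" by auto
    let ?J = "\<lambda>u\<in>nb p. fst m (p, u)" and ?C = "\<lambda>u\<in>nb p. snd m (tri p u)"
    have J: "?J \<in> ?L" using state_label_set[OF m] by (auto simp: nb_iff)
    have C: "?C \<in> ?M ?J"
    proof (rule PiE_I)
      fix u assume u: "u \<in> nb p"
      have "fst m (nx p u, p) = dual D (fst m (p, nx p u))"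
        using state_dual[OF m] nx_nb[OF u] by (simp add: nb_iff)
      moreover have "fst m (u, nx p u) = dual D (fst r (nx p u, u))"
        using state_dual[OF m nx_edge[OF u]] agree_edge[OF ag nx_edge[OF u]] nx_neq[OF u] by simp
      ultimately show "?C u \<in> {0..mult D (?J u) (dual D (?J (nx p u))) (dual D (fst r (nx p u, u)))}"
        using state_mult[OF m nx_R[OF u]] u nx_nb[OF u] by simp
    qed auto
    have st: "change_at p r ?J ?C \<in> St \<Phi>'"
      by (rule change_at_state[OF p adm off r]) (use J C in \<open>auto simp: PiE_iff\<close>)
    have "change_at p r ?J ?C = m"
    proof (rule state_eqI[OF st m])
      fix e assume e: "e \<in> E"
      obtain a b where ab: "e = (a, b)" by (cases e) auto
      consider "a = p" | "b = p" | "a \<noteq> p" "b \<noteq> p" by blast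
      then show "fst (change_at p r ?J ?C) e = fst m e"
      proof cases
        case 1
        then show ?thesis using e ab by (simp add: nb_iff[symmetric])
      next
        case 2
        then have "a \<in> nb p" using e ab edge_sym by (auto simp: nb_iff)
        then show ?thesis using 2 ab state_dual[OF m, of p a] by (simp add: nb_iff[symmetric])
      next
        case 3
        then show ?thesis using e ab agree_edge[OF ag] by simp
      qed
    next
      fix T assume T: "T \<in> dual_vertices K"
      show "snd (change_at p r ?J ?C) T = snd m T"
      proof (cases "p \<in> T")
        case True
        then obtain u where "u \<in> nb p" "T = tri p u" using T dual_vertices_at[OF p] by blast
        then show ?thesis using p by simp
      next
        case False
        then show ?thesis using T agree_vertex[OF ag] by simp
      qed
    qed
    then show "(case (\<lambda>u\<in>nb p. fst m (p, u), \<lambda>u\<in>nb p. snd m (tri p u)) of (J, C) \<Rightarrow> change_at p r J C) = m"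
      by simp
    show "(\<lambda>u\<in>nb p. fst m (p, u), \<lambda>u\<in>nb p. snd m (tri p u)) \<in> (SIGMA J:?L. ?M J)"
      using J C by blast
  qed
  finally show ?thesis by simp
qed

section \<open>Kernels of the plaquette operators and their products\<close>

text \<open>
  The factor of \<open>plaquette_coeff\<close> at the corner between the sides \<open>(p, u)\<close> and \<open>(p, nx p u)\<close>.
\<close>

definition factor :: "'e \<Rightarrow> 'a \<Rightarrow> ('e, 'a) state \<Rightarrow> ('e, 'a) state \<Rightarrow> 'e \<Rightarrow> nat \<Rightarrow> nat \<Rightarrow> complex" where
  "factor p s r t u a b = dcoef D (fst t (p, u)) *
    corner s (fst t (p, u)) (fst r (p, u)) (fst r (nx p u, u)) (fst t (p, nx p u)) (fst r (p, nx p u))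
      a (snd r (tri p u)) (snd t (tri p u)) b"

lemma plaquette_coeff_factor:
  "plaquette_coeff D K R p s r t =
    (\<Sum>A\<in>PiE (nb p) (\<lambda>u. mult_ix D (fst t (p, u)) s (dual D (fst r (p, u)))).
      \<Prod>u\<in>nb p. factor p s r t u (A u) (A (nx p u)))"
  by (cases r; cases t) (simp add: plaquette_coeff_def factor_def corner_def Let_def)

definition kernel :: "'e \<Rightarrow> 'a \<Rightarrow> ('e, 'a) state \<Rightarrow> ('e, 'a) state \<Rightarrow> complex" where
  "kernel p s r t = (if agree p r t then plaquette_coeff D K R p s r t else 0)"

definition deg_kernel :: "'e \<Rightarrow> 'g \<Rightarrow> ('e, 'a) state \<Rightarrow> ('e, 'a) state \<Rightarrow> complex" where
  "deg_kernel p g r t = (\<Sum>s\<in>label_set D g. bcoef D s * kernel p s r t)"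

lemma plaquette_op_deg_kernel:
  assumes "generic D g"
  shows "plaquette_op_deg D K R \<Phi> p g \<psi> = (\<lambda>t. if t \<in> St (shift_coloring \<Phi> p g)
    then \<Sum>r\<in>St \<Phi>. \<psi> r * deg_kernel p g r t else 0)"
proof
  fix t
  have "plaquette_op_deg D K R \<Phi> p g \<psi> t = (\<Sum>s\<in>label_set D g. \<Sum>r\<in>St \<Phi>.
      if t \<in> St (shift_coloring \<Phi> p g) then \<psi> r * (bcoef D s * kernel p s r t) else 0)"
    unfolding plaquette_op_deg_def plaquette_op_label_def sum_distrib_left
    using deg_label[OF assms] by (intro sum.cong refl) (auto simp: kernel_def)
  also have "\<dots> = (if t \<in> St (shift_coloring \<Phi> p g)
      then \<Sum>r\<in>St \<Phi>. \<psi> r * deg_kernel p g r t else 0)"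
    by (auto simp: deg_kernel_def sum_distrib_left intro: sum.swap)
  finally show "plaquette_op_deg D K R \<Phi> p g \<psi> t = (if t \<in> St (shift_coloring \<Phi> p g)
      then \<Sum>r\<in>St \<Phi>. \<psi> r * deg_kernel p g r t else 0)" .
qed

text \<open>
  The intermediate states are those agreeing with \<open>r\<close> off \<open>p\<close>, so their sum is the left-hand side
  of \<open>cycle_fusion\<close>.
\<close>

lemma kernel_product:
  assumes p: "p \<in> plaquettes K" and st: "s \<in> labels D" "t \<in> labels D"
    and gen: "generic D (deg D s + deg D t)"
    and adm: "adm \<Phi>" "adm (shift_coloring \<Phi> p (deg D t))" "adm (shift_coloring \<Phi> p (deg D s + deg D t))"
    and r: "r \<in> St \<Phi>" and q: "q \<in> St (shift_coloring \<Phi> p (deg D s + deg D t))"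
  shows "(\<Sum>m\<in>St (shift_coloring \<Phi> p (deg D t)). kernel p t r m * kernel p s m q) =
    (\<Sum>x\<in>label_set D (deg D s + deg D t). of_nat (mult D s t (dual D x)) * kernel p x r q)"
proof (cases "agree p r q")
  case False
  have "kernel p t r m * kernel p s m q = 0" for m
    using False agree_trans[of p r m q] by (auto simp: kernel_def)
  then have "(\<Sum>m\<in>St (shift_coloring \<Phi> p (deg D t)). kernel p t r m * kernel p s m q) = 0"
    by (intro sum.neutral) blast
  then show ?thesis using False by (simp add: kernel_def)
next
  case True
  define \<Phi>' where "\<Phi>' = shift_coloring \<Phi> p (deg D t)"
  let ?N = "nb p"
  let ?j = "\<lambda>u. fst r (p, u)" and ?j'' = "\<lambda>u. fst q (p, u)" and ?k = "\<lambda>u. fst r (nx p u, u)"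
  let ?t = "\<lambda>J C. \<Sum>A\<in>PiE ?N (\<lambda>u. mult_ix D (J u) t (dual D (?j u))). \<Prod>u\<in>?N. dcoef D (J u) *
      corner t (J u) (?j u) (?k u) (J (nx p u)) (?j (nx p u)) (A u) (snd r (tri p u)) (C u) (A (nx p u))"
    and ?s = "\<lambda>J C. \<Sum>A\<in>PiE ?N (\<lambda>u. mult_ix D (?j'' u) s (dual D (J u))). \<Prod>u\<in>?N. dcoef D (?j'' u) *
      corner s (?j'' u) (J u) (?k u) (?j'' (nx p u)) (J (nx p u)) (A u) (C u) (snd q (tri p u)) (A (nx p u))"
  have adm': "adm \<Phi>'" using adm(2) by (simp add: \<Phi>'_def)
  have off: "\<Phi>' (a, b) = \<Phi> (a, b)" if "a \<noteq> p" "b \<noteq> p" for a b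
    using that by (simp add: \<Phi>'_def shift_off)
  have \<Phi>'_side: "\<Phi>' (p, u) = deg D (?j u) - deg D t" if "u \<in> ?N" for u
    using that nx_neq(3)[OF that] state_deg[OF adm(1) r] by (simp add: \<Phi>'_def shift_at nb_iff)
  have ag: "agree p m q" if "agree p r m" for m
    using that True agree_trans[of p m r q] agree_sym[of p m r] by blast
  have "(\<Sum>m\<in>St \<Phi>'. kernel p t r m * kernel p s m q) =
      (\<Sum>m\<in>{m \<in> St \<Phi>'. agree p r m}. plaquette_coeff D K R p t r m * plaquette_coeff D K R p s m q)"
    using finite_states[OF adm'] ag
    by (intro sum.mono_neutral_cong_right) (auto simp: kernel_def)
  also have "\<dots> = (\<Sum>J\<in>PiE ?N (\<lambda>u. label_set D (\<Phi>' (p, u))).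
     \<Sum>C\<in>PiE ?N (\<lambda>u. {0..mult D (J u) (dual D (J (nx p u))) (dual D (?k u))}).
      plaquette_coeff D K R p t r (change_at p r J C) * plaquette_coeff D K R p s (change_at p r J C) q)"
    by (rule sum_states_agree[OF p adm(1) adm' off r])
  also have "\<dots> = (\<Sum>J\<in>PiE ?N (\<lambda>u. label_set D (deg D (?j u) - deg D t)).
      \<Sum>C\<in>PiE ?N (\<lambda>u. {0..mult D (J u) (dual D (J (nx p u))) (dual D (?k u))}).
      ?t J C *
      ?s J C)"
  proof (intro sum.cong refl arg_cong2[where f = "(*)"])
    show "PiE ?N (\<lambda>u. label_set D (\<Phi>' (p, u))) = PiE ?N (\<lambda>u. label_set D (deg D (?j u) - deg D t))"
      by (intro PiE_cong) (simp add: \<Phi>'_side)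
    fix J C
    show "plaquette_coeff D K R p t r (change_at p r J C) =
      ?t J C"
      unfolding plaquette_coeff_factor factor_def
      using nx_nb p by (intro sum.cong prod.cong PiE_cong) auto
    show "plaquette_coeff D K R p s (change_at p r J C) q =
      ?s J C"
      unfolding plaquette_coeff_factor factor_def
      using nx_nb p nx_edge nx_neq by (intro sum.cong prod.cong PiE_cong) auto
  qed
  also have "\<dots> = (\<Sum>x\<in>label_set D (deg D s + deg D t). of_nat (mult D s t (dual D x)) *
      (\<Sum>A\<in>PiE ?N (\<lambda>u. mult_ix D (?j'' u) x (dual D (?j u))). \<Prod>u\<in>?N. dcoef D (?j'' u) *
        corner x (?j'' u) (?j u) (?k u) (?j'' (nx p u)) (?j (nx p u)) (A u) (snd r (tri p u)) (snd q (tri p u)) (A (nx p u))))"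
  proof (rule cycle_fusion[OF finite_nb plaquette_nb_nonempty[OF p] nx_bij _ st gen])
    show "S = ?N" if "S \<subseteq> ?N" "S \<noteq> {}" "\<And>u. u \<in> S \<Longrightarrow> nx p u \<in> S" for S
      by (rule nx_transitive[OF p that])
    show "?j u \<in> labels D \<and> ?j'' u \<in> labels D \<and> ?k u \<in> labels D" if "u \<in> ?N" for u
      using that state_label[OF adm(1) r] state_label[OF adm(3) q] nx_edge by (auto simp: nb_iff)
    show "generic D (deg D (?j u) - deg D t)" if "u \<in> ?N" for u
      using color_generic[OF adm', of "(p, u)"] that by (simp add: \<Phi>'_side nb_iff[symmetric])
  qed
  also have "\<dots> = (\<Sum>x\<in>label_set D (deg D s + deg D t). of_nat (mult D s t (dual D x)) * kernel p x r q)"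
    using True by (simp add: kernel_def plaquette_coeff_factor factor_def)
  finally show ?thesis by (simp add: \<Phi>'_def)
qed

lemma deg_kernel_product:
  assumes p: "p \<in> plaquettes K" and gh: "generic D g" "generic D h" "generic D (g + h)"
    and adm: "adm \<Phi>" "adm (shift_coloring \<Phi> p h)" "adm (shift_coloring \<Phi> p (g + h))"
    and r: "r \<in> St \<Phi>" and q: "q \<in> St (shift_coloring \<Phi> p (g + h))"
  shows "(\<Sum>m\<in>St (shift_coloring \<Phi> p h). deg_kernel p h r m * deg_kernel p g m q) =
    deg_kernel p (g + h) r q"
proof -
  have pr: "(\<Sum>m\<in>St (shift_coloring \<Phi> p h). kernel p t r m * kernel p s m q) =
      (\<Sum>x\<in>label_set D (g + h). of_nat (mult D (dual D x) s t) * kernel p x r q)"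
    if s: "s \<in> label_set D g" and t: "t \<in> label_set D h" for s t
  proof -
    have l: "s \<in> labels D" "t \<in> labels D" and d: "deg D s = g" "deg D t = h"
      using s t gh label_in_labels deg_label by auto
    have "mult D s t (dual D x) = mult D (dual D x) s t" if "x \<in> label_set D (g + h)" for x
      using that l gh label_in_labels[of "g + h" x] mult_cyclic[of "dual D x" s t] by simp
    then show ?thesis
      using kernel_product[OF p l, of \<Phi> r q] gh adm r q d by simp
  qed
  have "(\<Sum>m\<in>St (shift_coloring \<Phi> p h). deg_kernel p h r m * deg_kernel p g m q) =
    (\<Sum>m\<in>St (shift_coloring \<Phi> p h). \<Sum>t\<in>label_set D h. \<Sum>s\<in>label_set D g.
      bcoef D s * bcoef D t * (kernel p t r m * kernel p s m q))"
    unfolding deg_kernel_def sum_product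
    by (intro sum.cong refl) (simp add: mult_ac)
  also have "\<dots> = (\<Sum>s\<in>label_set D g. \<Sum>t\<in>label_set D h. bcoef D s * bcoef D t *
      (\<Sum>m\<in>St (shift_coloring \<Phi> p h). kernel p t r m * kernel p s m q))"
    unfolding sum_distrib_left
    by (subst (2) sum.swap, subst sum.swap, rule sum.cong[OF refl], rule sum.swap)
  also have "\<dots> = (\<Sum>s\<in>label_set D g. \<Sum>t\<in>label_set D h. \<Sum>x\<in>label_set D (g + h).
      bcoef D s * bcoef D t * of_nat (mult D (dual D x) s t) * kernel p x r q)"
    by (intro sum.cong refl) (simp add: pr sum_distrib_left mult.assoc)
  also have "\<dots> = (\<Sum>x\<in>label_set D (g + h). (\<Sum>s\<in>label_set D g. \<Sum>t\<in>label_set D h.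
      bcoef D s * bcoef D t * of_nat (mult D (dual D x) s t)) * kernel p x r q)"
    unfolding sum_distrib_right by (simp only: sum.swap[of _ "label_set D (g + h)"])
  also have "\<dots> = deg_kernel p (g + h) r q"
    unfolding deg_kernel_def using bcoef_sum[OF gh] by simp
  finally show ?thesis .
qed

lemma plaquette_op_deg_product:
  assumes p: "p \<in> plaquettes K" and gh: "generic D g" "generic D h" "generic D (g + h)"
    and adm: "adm \<Phi>" "adm (shift_coloring \<Phi> p h)" "adm (shift_coloring \<Phi> p (g + h))"
  shows "plaquette_op_deg D K R (shift_coloring \<Phi> p h) p g (plaquette_op_deg D K R \<Phi> p h \<psi>) =
    plaquette_op_deg D K R \<Phi> p (g + h) \<psi>"
proof
  fix q
  have sh: "shift_coloring (shift_coloring \<Phi> p h) p g = shift_coloring \<Phi> p (g + h)"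
    by (simp add: shift_shift add.commute)
  have "(\<Sum>m\<in>St (shift_coloring \<Phi> p h). (\<Sum>r\<in>St \<Phi>. \<psi> r * deg_kernel p h r m) * deg_kernel p g m q) =
      (\<Sum>r\<in>St \<Phi>. \<psi> r * deg_kernel p (g + h) r q)" if q: "q \<in> St (shift_coloring \<Phi> p (g + h))"
  proof -
    have "(\<Sum>m\<in>St (shift_coloring \<Phi> p h). (\<Sum>r\<in>St \<Phi>. \<psi> r * deg_kernel p h r m) * deg_kernel p g m q) =
      (\<Sum>r\<in>St \<Phi>. \<psi> r * (\<Sum>m\<in>St (shift_coloring \<Phi> p h). deg_kernel p h r m * deg_kernel p g m q))"
      unfolding sum_distrib_left sum_distrib_right by (subst sum.swap) (simp add: mult.assoc)
    also have "\<dots> = (\<Sum>r\<in>St \<Phi>. \<psi> r * deg_kernel p (g + h) r q)"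
      using deg_kernel_product[OF p gh adm _ q] by simp
    finally show ?thesis .
  qed
  then show "plaquette_op_deg D K R (shift_coloring \<Phi> p h) p g (plaquette_op_deg D K R \<Phi> p h \<psi>) q =
    plaquette_op_deg D K R \<Phi> p (g + h) \<psi> q"
    by (simp add: plaquette_op_deg_kernel gh sh)
qed

end

section \<open>Exchange of two operators at a common edge\<close>

lemma sum_Sigma3:
  assumes "finite L" "\<And>r. r \<in> L \<Longrightarrow> finite (X r)" "\<And>r. r \<in> L \<Longrightarrow> finite (Y r)"
  shows "(\<Sum>r\<in>L. \<Sum>x\<in>X r. \<Sum>y\<in>Y r. h r x y) =
    (\<Sum>w\<in>(SIGMA r:L. X r \<times> Y r). h (fst w) (fst (snd w)) (snd (snd w)))"
proof -
  have "(\<Sum>x\<in>X r. \<Sum>y\<in>Y r. h r x y) = (\<Sum>w\<in>X r \<times> Y r. h r (fst w) (snd w))" for r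
    by (simp add: sum.cartesian_product')
  then have "(\<Sum>r\<in>L. \<Sum>x\<in>X r. \<Sum>y\<in>Y r. h r x y) = (\<Sum>r\<in>L. \<Sum>w\<in>X r \<times> Y r. h r (fst w) (snd w))"
    by simp
  also have "\<dots> = (\<Sum>(r, w)\<in>(SIGMA r:L. X r \<times> Y r). h r (fst w) (snd w))"
    using assms by (intro sum.Sigma) auto
  finally show ?thesis by (simp add: case_prod_unfold)
qed

lemma sum_swap22:
  "(\<Sum>a\<in>A. \<Sum>b\<in>B. \<Sum>c\<in>C. \<Sum>d\<in>M. f a b c d) = (\<Sum>c\<in>C. \<Sum>d\<in>M. \<Sum>a\<in>A. \<Sum>b\<in>B. f a b c d)"
proof -
  have "(\<Sum>a\<in>A. \<Sum>b\<in>B. \<Sum>c\<in>C. \<Sum>d\<in>M. f a b c d) =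
      (\<Sum>x\<in>A \<times> B. \<Sum>y\<in>C \<times> M. f (fst x) (snd x) (fst y) (snd y))"
    by (simp add: sum.cartesian_product')
  also have "\<dots> = (\<Sum>y\<in>C \<times> M. \<Sum>x\<in>A \<times> B. f (fst x) (snd x) (fst y) (snd y))"
    by (rule sum.swap)
  finally show ?thesis by (simp add: sum.cartesian_product')
qed

lemma sum_swap_out:
  "(\<Sum>x\<in>L. \<Sum>c\<in>C x. \<Sum>d\<in>M x. \<Sum>a\<in>A. f x c d a) = (\<Sum>a\<in>A. \<Sum>x\<in>L. \<Sum>c\<in>C x. \<Sum>d\<in>M x. f x c d a)"
  by (simp only: sum.swap[of _ A])

context LW
begin

text \<open>
  The part of \<open>B\<^sub>p\<^sup>s B\<^sub>q\<^sup>t\<close> at a common edge \<open>(p, q)\<close>, with labels \<open>j\<close> before, \<open>x\<close> in between and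
  \<open>j''\<close> after. One common triangle has the further labels \<open>k\<close>, \<open>l\<close> on the sides of \<open>p\<close>, \<open>q\<close> and
  vertex index \<open>c\<close>, the other one \<open>e\<close>, \<open>f\<close> and \<open>d\<close>; the numbered indices \<open>a\<close>, \<open>b\<close> belong to these
  sides of \<open>p\<close>, \<open>q\<close>.
\<close>

definition edge_sum :: "'a \<Rightarrow> 'a \<Rightarrow> 'a \<Rightarrow> 'a \<Rightarrow>
  'a \<Rightarrow> 'a \<Rightarrow> 'a \<Rightarrow> 'a \<Rightarrow> nat \<Rightarrow> nat \<Rightarrow> nat \<Rightarrow> nat \<Rightarrow>
  'a \<Rightarrow> 'a \<Rightarrow> 'a \<Rightarrow> 'a \<Rightarrow> nat \<Rightarrow> nat \<Rightarrow> nat \<Rightarrow> nat \<Rightarrow> complex" where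
  "edge_sum s t j j'' k k' l l' a1 b1 c c'' e e' f f' a2 b2 d d'' =
    (\<Sum>x\<in>label_set D (deg D j + deg D t). dcoef D x *
      (\<Sum>a\<in>mult_ix D j'' s (dual D x). \<Sum>b\<in>mult_ix D (dual D x) t j.
        (\<Sum>c'\<in>mult_ix D x (dual D k) l'.
          corner t l' l k (dual D x) (dual D j) b1 c c' b *
          corner s j'' x (dual D l') k' k a c' c'' a1) *
        (\<Sum>c'\<in>mult_ix D (dual D x) (dual D f') e.
          corner t (dual D x) (dual D j) (dual D e) f' f b d c' b2 *
          corner s e' e f' j'' x a2 c' d'' a)))"

text \<open>
  Expand the product at the first triangle by \<open>corner_exchange\<close>. The product at the second
  triangle is recovered from its opposite order by the same lemma with the roles of the two
  plaquettes exchanged; as the transition symbols coincide, the sum over \<open>x\<close> assembles the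
  exchanged second product.
\<close>

lemma edge_sum_exchange:
  assumes lab: "{s, t, j, j'', k, k', l, l', e, e', f, f'} \<subseteq> labels D"
    and deg: "deg D j'' = deg D j + deg D t - deg D s"
    and gen: "generic D (deg D j + deg D t)" "generic D (deg D j - deg D s)"
    and ix: "a1 \<in> mult_ix D k' s (dual D k)" "b1 \<in> mult_ix D l' t (dual D l)"
      "a2 \<in> mult_ix D e' s (dual D e)" "b2 \<in> mult_ix D f' t (dual D f)"
  shows "edge_sum s t j j'' k k' l l' a1 b1 c c'' e e' f f' a2 b2 d d'' =
    edge_sum t s (dual D j) (dual D j'') f f' e e' b2 a2 d d'' l l' k k' b1 a1 c c''"
proof -
  have L: "s \<in> labels D" "t \<in> labels D" "j \<in> labels D" "j'' \<in> labels D"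
    "k \<in> labels D" "k' \<in> labels D" "l \<in> labels D" "l' \<in> labels D"
    "e \<in> labels D" "e' \<in> labels D" "f \<in> labels D" "f' \<in> labels D"
    using lab by auto
  define X where "X = label_set D (deg D j + deg D t)"
  define Y where "Y = label_set D (deg D j - deg D s)"
  define P1 where "P1 x a b = (\<Sum>c'\<in>mult_ix D x (dual D k) l'.
          corner t l' l k (dual D x) (dual D j) b1 c c' b *
          corner s j'' x (dual D l') k' k a c' c'' a1)" for x a b
  define P2 where "P2 x a b = (\<Sum>c'\<in>mult_ix D (dual D x) (dual D f') e.
          corner t (dual D x) (dual D j) (dual D e) f' f b d c' b2 *
          corner s e' e f' j'' x a2 c' d'' a)" for x a b
  define Q1 where "Q1 y a b = (\<Sum>c'\<in>mult_ix D y (dual D k') l.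
          corner s y j (dual D l) k' k a c c' a1 *
          corner t l' l k' (dual D j'') (dual D y) b1 c' c'' b)" for y a b
  define Q2 where "Q2 y a b = (\<Sum>c'\<in>mult_ix D (dual D y) (dual D f) e'.
          corner s e' e f y j a2 d c' a *
          corner t (dual D j'') (dual D y) (dual D e') f' f b c' d'' b2)" for y a b
  define M where "M x y b a a' b' =
    sixj D (dual D j) (dual D t) (dual D x) j'' (dual D s) y b a a' b'" for x y b a a' b'
  let ?Xa = "\<lambda>x. mult_ix D j'' s (dual D x)" and ?Xb = "\<lambda>x. mult_ix D (dual D x) t j"
  let ?Ya = "\<lambda>y. mult_ix D y s (dual D j)" and ?Yb = "\<lambda>y. mult_ix D (dual D j'') t y"
  have X_lab: "x \<in> labels D" if "x \<in> X" for x using label_in_labels gen(1) that by (auto simp: X_def)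
  have Y_lab: "y \<in> labels D" if "y \<in> Y" for y using label_in_labels gen(2) that by (auto simp: Y_def)
  have dY: "deg D j'' - deg D t = deg D j - deg D s" using deg by (simp add: algebra_simps)
  have dX: "deg D (dual D j'') - deg D s = - (deg D j + deg D t)" using deg L by (simp add: algebra_simps)
  have P1: "P1 x a b = (\<Sum>y\<in>Y. \<Sum>a'\<in>?Ya y. \<Sum>b'\<in>?Yb y. dcoef D y * M x y b a a' b' * Q1 y a' b')"
    if x: "x \<in> X" and a: "a \<in> ?Xa x" and b: "b \<in> ?Xb x" for x a b
    unfolding P1_def Q1_def M_def Y_def dY[symmetric]
    using L X_lab[OF x] gen(2) by (intro corner_exchange[OF _ a b ix(1,2)]) (auto simp: dY)
  have Q2: "Q2 y a b = (\<Sum>x\<in>X. \<Sum>b'\<in>?Xb x. \<Sum>a'\<in>?Xa x. dcoef D x * M x y b' a' a b * P2 x a' b')"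
    if y: "y \<in> Y" and a: "a \<in> ?Ya y" and b: "b \<in> ?Yb y" for y a b
  proof -
    have yl: "y \<in> labels D" by (rule Y_lab[OF y])
    have "(\<Sum>c'\<in>mult_ix D (dual D y) (dual D f) e'.
        corner s e' e f (dual D (dual D y)) (dual D (dual D j)) a2 d c' a *
        corner t (dual D j'') (dual D y) (dual D e') f' f b c' d'' b2) =
      (\<Sum>x\<in>label_set D (deg D (dual D j'') - deg D s).
        \<Sum>b'\<in>mult_ix D x t (dual D (dual D j)). \<Sum>a'\<in>mult_ix D (dual D (dual D j'')) s x.
          dcoef D x * sixj D (dual D (dual D j)) (dual D s) (dual D (dual D y)) (dual D j'') (dual D t) x a b b' a' *
        (\<Sum>c'\<in>mult_ix D x (dual D f') e.
          corner t x (dual D j) (dual D e) f' f b' d c' b2 *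
          corner s e' e f' (dual D (dual D j'')) (dual D x) a2 c' d'' a'))"
      using L yl gen(1) a b ix(3,4)
      by (intro corner_exchange) (simp_all only: dX generic_minus, auto simp: dual_dual)
    also have "\<dots> = (\<Sum>x\<in>X. \<Sum>b'\<in>?Xb x. \<Sum>a'\<in>?Xa x. dcoef D x * M x y b' a' a b * P2 x a' b')"
      unfolding dX sum_label_dual[OF gen(1)] X_def[symmetric]
    proof (rule sum.cong[OF refl])
      fix x assume "x \<in> X"
      then have x: "x \<in> labels D" by (rule X_lab)
      have sym: "sixj D j (dual D s) y (dual D j'') (dual D t) (dual D x) a b b' a' = M x y b' a' a b" for a' b'
        unfolding M_def using L yl x by (intro sixj_exchange_symmetry[symmetric]) auto
      show "(\<Sum>b'\<in>mult_ix D (dual D x) t (dual D (dual D j)). \<Sum>a'\<in>mult_ix D (dual D (dual D j'')) s (dual D x).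
          dcoef D (dual D x) * sixj D (dual D (dual D j)) (dual D s) (dual D (dual D y)) (dual D j'') (dual D t) (dual D x) a b b' a' *
        (\<Sum>c'\<in>mult_ix D (dual D x) (dual D f') e.
          corner t (dual D x) (dual D j) (dual D e) f' f b' d c' b2 *
          corner s e' e f' (dual D (dual D j'')) (dual D (dual D x)) a2 c' d'' a')) =
        (\<Sum>b'\<in>?Xb x. \<Sum>a'\<in>?Xa x. dcoef D x * M x y b' a' a b * P2 x a' b')"
        using L x yl dcoef[OF x] by (simp add: dual_dual sym P2_def)
    qed
    finally show ?thesis using L yl by (simp add: Q2_def dual_dual)
  qed
  have "edge_sum s t j j'' k k' l l' a1 b1 c c'' e e' f f' a2 b2 d d'' =
      (\<Sum>x\<in>X. dcoef D x * (\<Sum>a\<in>?Xa x. \<Sum>b\<in>?Xb x. P1 x a b * P2 x a b))"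
    by (simp only: edge_sum_def X_def P1_def P2_def)
  also have "\<dots> = (\<Sum>x\<in>X. \<Sum>a\<in>?Xa x. \<Sum>b\<in>?Xb x. \<Sum>y\<in>Y. \<Sum>a'\<in>?Ya y. \<Sum>b'\<in>?Yb y.
      dcoef D x * dcoef D y * M x y b a a' b' * Q1 y a' b' * P2 x a b)"
    unfolding sum_distrib_left
    by (intro sum.cong refl) (simp add: P1 sum_distrib_left sum_distrib_right mult_ac)
  also have "\<dots> = (\<Sum>y\<in>Y. \<Sum>a'\<in>?Ya y. \<Sum>b'\<in>?Yb y. \<Sum>x\<in>X. \<Sum>b\<in>?Xb x. \<Sum>a\<in>?Xa x.
      dcoef D x * dcoef D y * M x y b a a' b' * Q1 y a' b' * P2 x a b)"
  proof -
    have fin: "finite X" "finite Y" using finite_label_set gen by (auto simp: X_def Y_def)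
    note SX = sum_Sigma3[OF fin(1) finite_mult_ix finite_mult_ix] and SY = sum_Sigma3[OF fin(2) finite_mult_ix finite_mult_ix]
    have "(\<Sum>x\<in>X. \<Sum>a\<in>?Xa x. \<Sum>b\<in>?Xb x. \<Sum>y\<in>Y. \<Sum>a'\<in>?Ya y. \<Sum>b'\<in>?Yb y.
        dcoef D x * dcoef D y * M x y b a a' b' * Q1 y a' b' * P2 x a b) =
      (\<Sum>y\<in>Y. \<Sum>a'\<in>?Ya y. \<Sum>b'\<in>?Yb y. \<Sum>x\<in>X. \<Sum>a\<in>?Xa x. \<Sum>b\<in>?Xb x.
        dcoef D x * dcoef D y * M x y b a a' b' * Q1 y a' b' * P2 x a b)"
      unfolding SX SY by (rule sum.swap)
    also have "\<dots> = (\<Sum>y\<in>Y. \<Sum>a'\<in>?Ya y. \<Sum>b'\<in>?Yb y. \<Sum>x\<in>X. \<Sum>b\<in>?Xb x. \<Sum>a\<in>?Xa x.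
        dcoef D x * dcoef D y * M x y b a a' b' * Q1 y a' b' * P2 x a b)"
      by (intro sum.cong refl sum.swap)
    finally show ?thesis .
  qed
  also have "\<dots> = (\<Sum>y\<in>Y. \<Sum>b\<in>?Yb y. \<Sum>a\<in>?Ya y. \<Sum>x\<in>X. \<Sum>b'\<in>?Xb x. \<Sum>a'\<in>?Xa x.
      dcoef D x * dcoef D y * M x y b' a' a b * Q1 y a b * P2 x a' b')"
    by (intro sum.cong refl sum.swap)
  also have "\<dots> = (\<Sum>y\<in>Y. \<Sum>b\<in>?Yb y. \<Sum>a\<in>?Ya y. dcoef D y * (Q2 y a b * Q1 y a b))"
  proof (intro sum.cong refl)
    fix y a b assume "y \<in> Y" "b \<in> ?Yb y" "a \<in> ?Ya y"
    then show "(\<Sum>x\<in>X. \<Sum>b'\<in>?Xb x. \<Sum>a'\<in>?Xa x.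
      dcoef D x * dcoef D y * M x y b' a' a b * Q1 y a b * P2 x a' b') = dcoef D y * (Q2 y a b * Q1 y a b)"
      by (simp add: Q2 sum_distrib_left sum_distrib_right mult_ac)
  qed
  also have "\<dots> = (\<Sum>y\<in>Y. dcoef D y * (\<Sum>b\<in>?Yb y. \<Sum>a\<in>?Ya y. Q2 y a b * Q1 y a b))"
    by (simp only: sum_distrib_left)
  also have "\<dots> = edge_sum t s (dual D j) (dual D j'') f f' e e' b2 a2 d d'' l l' k k' b1 a1 c c''"
  proof -
    have dY': "deg D (dual D j) + deg D s = - (deg D j - deg D s)" using L by simp
    show ?thesis
      unfolding edge_sum_def dY' sum_label_dual[OF gen(2)] Y_def[symmetric]
    proof (rule sum.cong[OF refl])
      fix y assume "y \<in> Y"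
      then have y: "y \<in> labels D" by (rule Y_lab)
      show "dcoef D y * (\<Sum>b\<in>?Yb y. \<Sum>a\<in>?Ya y. Q2 y a b * Q1 y a b) =
        dcoef D (dual D y) * (\<Sum>a\<in>mult_ix D (dual D j'') t (dual D (dual D y)).
          \<Sum>b\<in>mult_ix D (dual D (dual D y)) s (dual D j).
         (\<Sum>c'\<in>mult_ix D (dual D y) (dual D f) e'.
             corner s e' e f (dual D (dual D y)) (dual D (dual D j)) a2 d c' b *
             corner t (dual D j'') (dual D y) (dual D e') f' f a c' d'' b2) *
         (\<Sum>c'\<in>mult_ix D (dual D (dual D y)) (dual D k') l.
             corner s (dual D (dual D y)) (dual D (dual D j)) (dual D l) k' k b c c' a1 *
             corner t l' l k' (dual D j'') (dual D y) b1 c' c'' a))"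
        using L y dcoef[OF y] by (simp add: dual_dual Q1_def Q2_def)
    qed
  qed
  finally show ?thesis .
qed

end

section \<open>Commutation at different plaquettes\<close>

context LW_surface
begin

text \<open>
  An edge \<open>pq\<close> lies in exactly two triangles, one on each side: a triangle containing \<open>p\<close> and \<open>q\<close>
  is a corner of \<open>p\<close> whose side or whose next side is \<open>(p, q)\<close>.
\<close>

lemma common_triangles:
  assumes q: "q \<in> nb p"
  shows "{T \<in> dual_vertices K. p \<in> T \<and> q \<in> T} = {tri p q, tri q p}"
    and "tri p q \<noteq> tri q p" and "nx p (nx q p) = q" and "nx q (nx p q) = p"
    and "nx q p \<in> nb p" and "nx p q \<in> nb q"
    and "tri p (nx q p) = tri q p" and "tri q (nx p q) = tri p q" and "nx p q \<noteq> nx q p"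
proof -
  have p: "p \<in> nb q" using q nb_sym by blast
  have R1: "(p, q, nx p q) \<in> R" "(q, nx p q, p) \<in> R" using nx_R[OF q] R_rot by blast+
  have R2: "(q, p, nx q p) \<in> R" "(p, nx q p, q) \<in> R" using nx_R[OF p] R_rot by blast+
  show n: "nx p (nx q p) = q" "nx q (nx p q) = p" using nx_eq R1 R2 by blast+
  show m: "nx q p \<in> nb p" "nx p q \<in> nb q" using R_corner R1 R2 by blast+
  show t: "tri p (nx q p) = tri q p" "tri q (nx p q) = tri p q"
    unfolding n by (simp_all add: insert_commute)
  show ne: "nx p q \<noteq> nx q p" using R1(1) R2(1) R_rot[OF R2(1)] R_swap by metis
  show "tri p q \<noteq> tri q p"
  proof
    assume "tri p q = tri q p"
    then have "tri p q = tri p (nx q p)" by (simp only: t(1))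
    then have "q = nx q p" by (rule inj_onD[OF tri_inj _ q m(1)])
    then show False using nx_neq(2)[OF p] by simp
  qed
  have pK: "p \<in> plaquettes K" "q \<in> plaquettes K" using q edge_plaquette by (auto simp: nb_iff)
  show "{T \<in> dual_vertices K. p \<in> T \<and> q \<in> T} = {tri p q, tri q p}"
  proof
    show "{T \<in> dual_vertices K. p \<in> T \<and> q \<in> T} \<subseteq> {tri p q, tri q p}"
    proof
      fix T assume T: "T \<in> {T \<in> dual_vertices K. p \<in> T \<and> q \<in> T}"
      then obtain u where u: "u \<in> nb p" "T = tri p u" using dual_vertices_at[OF pK(1)] by blast
      then have "q \<in> {p, u, nx p u}" using T plaquette_in_triangle[OF nx_R[OF u(1)] pK(2)] by blast
      then have "q = u \<or> q = nx p u" using nx_neq(3)[OF q] by auto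
      then have "u = q \<or> u = nx q p" using n(1) inj_onD[OF nx_inj _ u(1) m(1)] by metis
      then show "T \<in> {tri p q, tri q p}" using u(2) t(1) by auto
    qed
    show "{tri p q, tri q p} \<subseteq> {T \<in> dual_vertices K. p \<in> T \<and> q \<in> T}"
      using tri_dual_vertex[OF q] tri_dual_vertex[OF p] by (auto intro: hull_inc)
  qed
qed

lemma R_neq: "(a, b, c) \<in> R \<Longrightarrow> a \<noteq> b \<and> b \<noteq> c \<and> a \<noteq> c \<and> b \<noteq> a \<and> c \<noteq> b \<and> c \<noteq> a"
  using R_distinct by blast

lemma common_triangle_adjacent:
  assumes "p \<in> plaquettes K" "q \<in> plaquettes K" "p \<noteq> q" "T \<in> dual_vertices K" "p \<in> T" "q \<in> T"
  shows "q \<in> nb p"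
proof -
  obtain u where u: "u \<in> nb p" "T = tri p u" using assms dual_vertices_at[of p] by blast
  then have "q \<in> {p, u, nx p u}" using assms plaquette_in_triangle[OF nx_R[OF u(1)] assms(2)] by blast
  then show ?thesis using assms(3) u(1) nx_nb by auto
qed

text \<open>
  The index attached to the side \<open>(p, u0)\<close> occurs only in the factors of the two corners at this
  side.
\<close>

lemma plaquette_coeff_split:
  assumes v: "v \<in> nb p" and u0: "u0 = nx p v"
  shows "plaquette_coeff D K R p s r t =
    (\<Sum>A\<in>PiE (nb p - {u0}) (\<lambda>u. mult_ix D (fst t (p, u)) s (dual D (fst r (p, u)))).
      (\<Prod>u\<in>nb p - {u0, v}. factor p s r t u (A u) (A (nx p u))) *
      (\<Sum>a\<in>mult_ix D (fst t (p, u0)) s (dual D (fst r (p, u0))).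
        factor p s r t u0 a (A (nx p u0)) * factor p s r t v (A v) a))"
proof -
  let ?I = "\<lambda>u. mult_ix D (fst t (p, u)) s (dual D (fst r (p, u)))"
  have u0N: "u0 \<in> nb p" using nx_nb[OF v] u0 by simp
  have ne: "u0 \<noteq> v" "nx p u0 \<noteq> u0" "nx p u0 \<in> nb p" using nx_neq v u0 u0N nx_nb by auto
  have N: "nb p = insert u0 (nb p - {u0})" using u0N by blast
  have inj: "inj_on (\<lambda>(y, g). g(u0 := y)) (?I u0 \<times> PiE (nb p - {u0}) ?I)"
    by (rule inj_combinator) simp
  have "plaquette_coeff D K R p s r t = (\<Sum>A\<in>PiE (insert u0 (nb p - {u0})) ?I.
      \<Prod>u\<in>nb p. factor p s r t u (A u) (A (nx p u)))"
    unfolding plaquette_coeff_factor N[symmetric] ..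
  also have "\<dots> = (\<Sum>(a, A)\<in>?I u0 \<times> PiE (nb p - {u0}) ?I.
      \<Prod>u\<in>nb p. factor p s r t u ((A(u0 := a)) u) ((A(u0 := a)) (nx p u)))"
    unfolding PiE_insert_eq by (subst sum.reindex[OF inj]) (simp add: case_prod_unfold)
  also have "\<dots> = (\<Sum>A\<in>PiE (nb p - {u0}) ?I. \<Sum>a\<in>?I u0.
      \<Prod>u\<in>nb p. factor p s r t u ((A(u0 := a)) u) ((A(u0 := a)) (nx p u)))"
    by (subst sum.swap) (simp add: sum.cartesian_product)
  also have "\<dots> = (\<Sum>A\<in>PiE (nb p - {u0}) ?I. \<Sum>a\<in>?I u0.
      (\<Prod>u\<in>nb p - {u0, v}. factor p s r t u (A u) (A (nx p u))) *
      (factor p s r t u0 a (A (nx p u0)) * factor p s r t v (A v) a))"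
  proof (intro sum.cong refl)
    fix A a
    have "nb p = insert u0 (insert v (nb p - {u0, v}))" using u0N v by blast
    then have "(\<Prod>u\<in>nb p. factor p s r t u ((A(u0 := a)) u) ((A(u0 := a)) (nx p u))) =
      (\<Prod>u\<in>insert u0 (insert v (nb p - {u0, v})). factor p s r t u ((A(u0 := a)) u) ((A(u0 := a)) (nx p u)))"
      by simp
    also have "\<dots> = factor p s r t u0 a (A (nx p u0)) * (factor p s r t v (A v) a *
        (\<Prod>u\<in>nb p - {u0, v}. factor p s r t u ((A(u0 := a)) u) ((A(u0 := a)) (nx p u))))"
      using ne u0 by simp
    also have "(\<Prod>u\<in>nb p - {u0, v}. factor p s r t u ((A(u0 := a)) u) ((A(u0 := a)) (nx p u))) =
        (\<Prod>u\<in>nb p - {u0, v}. factor p s r t u (A u) (A (nx p u)))"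
    proof (rule prod.cong[OF refl])
      fix u assume u: "u \<in> nb p - {u0, v}"
      then have "nx p u \<noteq> u0" using u0 v inj_onD[OF nx_inj, of p u v] by auto
      then show "factor p s r t u ((A(u0 := a)) u) ((A(u0 := a)) (nx p u)) = factor p s r t u (A u) (A (nx p u))"
        using u by simp
    qed
    finally show "(\<Prod>u\<in>nb p. factor p s r t u ((A(u0 := a)) u) ((A(u0 := a)) (nx p u))) =
      (\<Prod>u\<in>nb p - {u0, v}. factor p s r t u (A u) (A (nx p u))) *
      (factor p s r t u0 a (A (nx p u0)) * factor p s r t v (A v) a)"
      by (simp only: mult_ac)
  qed
  finally show ?thesis by (simp only: sum_distrib_left)
qed

text \<open>
  A corner of \<open>p\<close> that does not contain \<open>q\<close> does not see what happens at \<open>q\<close>.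
\<close>

lemma factor_agree:
  assumes "u \<in> nb p" "q \<in> plaquettes K" "q \<noteq> p" "q \<noteq> u" "q \<noteq> nx p u"
    and "agree q r r'" "agree q t t'"
  shows "factor p s r t u a b = factor p s r' t' u a b"
proof -
  have e: "(p, u) \<in> E" "(p, nx p u) \<in> E" "(nx p u, u) \<in> E"
    using assms(1) nx_nb nx_edge by (auto simp: nb_iff)
  have T: "tri p u \<in> dual_vertices K" "q \<notin> tri p u"
    using tri_dual_vertex[OF assms(1)] plaquette_in_triangle[OF nx_R[OF assms(1)] assms(2)] assms by auto
  have n: "p \<noteq> q" "u \<noteq> q" "nx p u \<noteq> q" using assms by auto
  show ?thesis
    using agree_edge[OF assms(6) e(1)] agree_edge[OF assms(6) e(2)] agree_edge[OF assms(6) e(3)]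
      agree_edge[OF assms(7) e(1)] agree_edge[OF assms(7) e(2)]
      agree_vertex[OF assms(6) T] agree_vertex[OF assms(7) T] n
    by (simp add: factor_def)
qed

lemma plaquette_coeff_agree:
  assumes pq: "p \<in> plaquettes K" "q \<in> plaquettes K" "p \<noteq> q" "q \<notin> nb p"
    and ag: "agree q r r'" "agree q t t'"
  shows "plaquette_coeff D K R p s r t = plaquette_coeff D K R p s r' t'"
proof -
  have e: "fst r (p, u) = fst r' (p, u) \<and> fst t (p, u) = fst t' (p, u)" if "u \<in> nb p" for u
    using that pq agree_edge[OF ag(1)] agree_edge[OF ag(2)] by (auto simp: nb_iff)
  have f: "factor p s r t u a b = factor p s r' t' u a b" if "u \<in> nb p" for u a b
    using that pq nx_nb ag by (intro factor_agree) auto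
  show ?thesis
    unfolding plaquette_coeff_factor
    by (intro sum.cong PiE_cong prod.cong refl) (simp_all add: e f)
qed

text \<open>
  The index families and corner factors of \<open>p\<close> away from its common side with \<open>q\<close>.
\<close>

definition outer_ix :: "'e \<Rightarrow> 'e \<Rightarrow> 'a \<Rightarrow> ('e, 'a) state \<Rightarrow> ('e, 'a) state \<Rightarrow> ('e \<Rightarrow> nat) set" where
  "outer_ix p q s r t = PiE (nb p - {q}) (\<lambda>u. mult_ix D (fst t (p, u)) s (dual D (fst r (p, u))))"

definition outer_factor :: "'e \<Rightarrow> 'e \<Rightarrow> 'a \<Rightarrow> ('e, 'a) state \<Rightarrow> ('e, 'a) state \<Rightarrow> ('e \<Rightarrow> nat) \<Rightarrow> complex" where
  "outer_factor p q s r t A = (\<Prod>u\<in>nb p - {q, nx q p}. factor p s r t u (A u) (A (nx p u)))"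

lemma plaquette_coeff_outer:
  assumes q: "q \<in> nb p" and pq: "p \<in> plaquettes K" "q \<in> plaquettes K"
    and ag: "agree q r r'" "agree q t t'"
  shows "plaquette_coeff D K R p s r t =
    (\<Sum>A\<in>outer_ix p q s r' t'. outer_factor p q s r' t' A *
      (\<Sum>a\<in>mult_ix D (fst t (p, q)) s (dual D (fst r (p, q))).
        factor p s r t q a (A (nx p q)) * factor p s r t (nx q p) (A (nx q p)) a))"
proof -
  note ct = common_triangles[OF q]
  have pne: "p \<noteq> q" using nx_neq(3)[OF q] by simp
  have e: "fst r (p, u) = fst r' (p, u) \<and> fst t (p, u) = fst t' (p, u)" if "u \<in> nb p - {q}" for u
    using that pne agree_edge[OF ag(1)] agree_edge[OF ag(2)] by (auto simp: nb_iff)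
  have ix: "PiE (nb p - {q}) (\<lambda>u. mult_ix D (fst t (p, u)) s (dual D (fst r (p, u)))) = outer_ix p q s r' t'"
    unfolding outer_ix_def by (intro PiE_cong) (simp add: e)
  have f: "(\<Prod>u\<in>nb p - {q, nx q p}. factor p s r t u (A u) (A (nx p u))) = outer_factor p q s r' t' A" for A
    unfolding outer_factor_def
  proof (rule prod.cong[OF refl])
    fix u assume u: "u \<in> nb p - {q, nx q p}"
    have "nx p u \<noteq> q"
    proof
      assume "nx p u = q"
      then have "nx p u = nx p (nx q p)" using ct(3) by simp
      then have "u = nx q p" by (rule inj_onD[OF nx_inj]) (use u ct(5) in simp_all)
      then show False using u by blast
    qed
    then show "factor p s r t u (A u) (A (nx p u)) = factor p s r' t' u (A u) (A (nx p u))"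
      using u pq pne ag by (intro factor_agree) auto
  qed
  show ?thesis
    using plaquette_coeff_split[OF ct(5) ct(3)[symmetric], of s r t] unfolding ix f .
qed

definition common_sum :: "'e \<Rightarrow> 'e \<Rightarrow> 'a \<Rightarrow> 'a \<Rightarrow> ('e, 'a) state \<Rightarrow> ('e, 'a) state \<Rightarrow>
    ('e \<Rightarrow> nat) \<Rightarrow> ('e \<Rightarrow> nat) \<Rightarrow> complex" where
  "common_sum p q s t r z A A' = edge_sum s t (fst r (p, q)) (fst z (p, q))
    (fst r (p, nx p q)) (fst z (p, nx p q)) (fst r (q, nx p q)) (fst z (q, nx p q))
    (A (nx p q)) (A' (nx p q)) (snd r (tri p q)) (snd z (tri p q))
    (fst r (p, nx q p)) (fst z (p, nx q p)) (fst r (q, nx q p)) (fst z (q, nx q p))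
    (A (nx q p)) (A' (nx q p)) (snd r (tri q p)) (snd z (tri q p))"

text \<open>
  Vertex indices of states start at 0, the multiplicity indices of 6j-symbols at 1.
\<close>

lemma sum_from_0_mult_ix: "f 0 = 0 \<Longrightarrow> (\<Sum>c\<in>{0..mult D i j k}. f c) = (\<Sum>c\<in>mult_ix D i j k. f c)"
  for f :: "nat \<Rightarrow> complex"
  by (rule sum.mono_neutral_right) (auto simp: mult_ix_def not_less_eq_eq)

definition agree2 :: "'e \<Rightarrow> 'e \<Rightarrow> ('e, 'a) state \<Rightarrow> ('e, 'a) state \<Rightarrow> bool" where
  "agree2 p q r z \<longleftrightarrow>
    (\<forall>a b. (a, b) \<in> E \<longrightarrow> a \<notin> {p, q} \<longrightarrow> b \<notin> {p, q} \<longrightarrow> fst r (a, b) = fst z (a, b)) \<and>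
    (\<forall>T. T \<in> dual_vertices K \<longrightarrow> p \<notin> T \<longrightarrow> q \<notin> T \<longrightarrow> snd r T = snd z T)"

text \<open>
  The states between \<open>r\<close> and \<open>z\<close>, when the operator at \<open>q\<close> is applied before the one at \<open>p\<close>: at
  \<open>q\<close> they are already \<open>z\<close>, at \<open>p\<close> still \<open>r\<close>, and on what the two plaquettes share they are given
  by \<open>x\<close>, \<open>c1\<close>, \<open>c2\<close>.
\<close>

definition mixed :: "'e \<Rightarrow> 'e \<Rightarrow> ('e, 'a) state \<Rightarrow> ('e, 'a) state \<Rightarrow> 'a \<Rightarrow> nat \<Rightarrow> nat \<Rightarrow> ('e, 'a) state" where
  "mixed p q r z x c1 c2 =
    ((\<lambda>e\<in>E. if e = (p, q) then x else if e = (q, p) then dual D x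
        else if fst e = q \<or> snd e = q then fst z e else fst r e),
     (\<lambda>T\<in>dual_vertices K. if p \<in> T \<and> q \<in> T then (if T = tri p q then c1 else c2)
        else if q \<in> T then snd z T else snd r T))"

lemma agree_between:
  assumes "agree q r m" "agree p m z"
  shows "agree2 p q r z"
  using assms by (simp add: agree2_def agree_iff)

lemma agree2_commute: "agree2 p q r z = agree2 q p r z"
  by (auto simp: agree2_def)

context
  fixes p q :: 'e and r z :: "('e, 'a) state" and \<Phi> \<Phi>' \<Phi>'' :: "'e \<times> 'e \<Rightarrow> 'g"
  assumes pq: "p \<in> plaquettes K" "q \<in> plaquettes K" "p \<noteq> q"
    and adm: "adm \<Phi>" "adm \<Phi>'" "adm \<Phi>''"
    and off_q: "\<And>a b. a \<noteq> q \<Longrightarrow> b \<noteq> q \<Longrightarrow> \<Phi>' (a, b) = \<Phi> (a, b)"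
    and off_p: "\<And>a b. a \<noteq> p \<Longrightarrow> b \<noteq> p \<Longrightarrow> \<Phi>'' (a, b) = \<Phi>' (a, b)"
    and r: "r \<in> St \<Phi>" and z: "z \<in> St \<Phi>''" and ag: "agree2 p q r z"
begin

lemma mixed_edges:
  "q \<in> nb p \<Longrightarrow> fst (mixed p q r z x c1 c2) (p, q) = x"
  "q \<in> nb p \<Longrightarrow> fst (mixed p q r z x c1 c2) (q, p) = dual D x"
  "(a, b) \<in> E \<Longrightarrow> a \<noteq> q \<Longrightarrow> b \<noteq> q \<Longrightarrow> fst (mixed p q r z x c1 c2) (a, b) = fst r (a, b)"
  "(a, b) \<in> E \<Longrightarrow> a \<noteq> p \<Longrightarrow> b \<noteq> p \<Longrightarrow> fst (mixed p q r z x c1 c2) (a, b) = fst z (a, b)"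
  using ag pq(3) edge_sym by (auto simp: mixed_def nb_iff agree2_def)

lemma mixed_vertices:
  "q \<in> nb p \<Longrightarrow> snd (mixed p q r z x c1 c2) (tri p q) = c1"
  "q \<in> nb p \<Longrightarrow> snd (mixed p q r z x c1 c2) (tri q p) = c2"
  "T \<in> dual_vertices K \<Longrightarrow> q \<notin> T \<Longrightarrow> snd (mixed p q r z x c1 c2) T = snd r T"
  "T \<in> dual_vertices K \<Longrightarrow> p \<notin> T \<Longrightarrow> snd (mixed p q r z x c1 c2) T = snd z T"
  using ag common_triangles(2)[of q p] tri_dual_vertex[of q p] tri_dual_vertex[of p q] nb_sym[of q p]
  by (auto simp: mixed_def agree2_def hull_inc)

lemma agree_mixed: "agree q r (mixed p q r z x c1 c2)" "agree p (mixed p q r z x c1 c2) z"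
  using mixed_edges(3,4) mixed_vertices(3,4) by (auto simp: agree_iff)

lemma mixed_state:
  assumes x: "q \<in> nb p \<Longrightarrow> x \<in> label_set D (\<Phi>' (p, q))"
    and c1: "q \<in> nb p \<Longrightarrow> c1 \<le> mult D x (dual D (fst r (p, nx p q))) (fst z (q, nx p q))"
    and c2: "q \<in> nb p \<Longrightarrow> c2 \<le> mult D (dual D x) (dual D (fst z (q, nx q p))) (fst r (p, nx q p))"
  shows "mixed p q r z x c1 c2 \<in> St \<Phi>'"
proof -
  let ?m = "mixed p q r z x c1 c2"
  have lab: "fst ?m (a, b) \<in> label_set D (\<Phi>' (a, b)) \<and> fst ?m (b, a) = dual D (fst ?m (a, b))"
    if e: "(a, b) \<in> E" for a b
  proof -
    consider "a \<noteq> q" "b \<noteq> q" | "a \<noteq> p" "b \<noteq> p" | "a = p" "b = q" | "a = q" "b = p"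
      using edge_neq[OF e] pq(3) by auto
    then show ?thesis
    proof cases
      case 1
      then show ?thesis
        using mixed_edges(3)[OF e] mixed_edges(3)[OF edge_sym[OF e]] state_label_set[OF r e]
          state_dual[OF r e] off_q by simp
    next
      case 2
      then show ?thesis
        using mixed_edges(4)[OF e] mixed_edges(4)[OF edge_sym[OF e]] state_label_set[OF z e]
          state_dual[OF z e] off_p by simp
    next
      case 3
      then have "q \<in> nb p" using e by (simp add: nb_iff)
      then show ?thesis using 3 x mixed_edges by simp
    next
      case 4
      then have n: "q \<in> nb p" using e edge_sym by (simp add: nb_iff)
      then have pqE: "(p, q) \<in> E" by (simp add: nb_iff)
      have g: "generic D (\<Phi>' (p, q))" using color_generic[OF adm(2) pqE] .
      have "\<Phi>' (q, p) = - \<Phi>' (p, q)" using color_minus[OF adm(2) pqE] .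
      then show ?thesis
        using 4 n x[OF n] mixed_edges dual_in_label_set[OF g x[OF n]] label_in_labels[OF g x[OF n]]
        by (simp add: dual_dual)
    qed
  qed
  have lab': "fst ?m e \<in> labels D" if "e \<in> E" for e
    using lab[of "fst e" "snd e"] that color_generic[OF adm(2) that] label_in_labels by (cases e) auto
  have tri1: "snd ?m (convex hull {p, q, w}) \<le> mult D (fst ?m (p, q)) (fst ?m (w, p)) (fst ?m (q, w))"
    if pqw: "(p, q, w) \<in> R" for w
  proof -
    have n: "q \<in> nb p" "w = nx p q" using R_corner[OF pqw] by auto
    note e = R_edge[OF pqw] R_neq[OF pqw]
    have "fst r (w, p) = dual D (fst r (p, w))" using state_dual[OF r edge_sym[OF e(3)]] .
    then show ?thesis using c1[OF n(1)] n e mixed_edges mixed_vertices by simp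
  qed
  have tri2: "snd ?m (convex hull {q, p, w}) \<le> mult D (fst ?m (q, p)) (fst ?m (w, q)) (fst ?m (p, w))"
    if qpw: "(q, p, w) \<in> R" for w
  proof -
    have n: "q \<in> nb p" "w = nx q p" using R_corner[OF qpw] nb_sym by auto
    note e = R_edge[OF qpw] R_neq[OF qpw]
    have "fst z (w, q) = dual D (fst z (q, w))" using state_dual[OF z edge_sym[OF e(3)]] .
    then show ?thesis using c2[OF n(1)] n e mixed_edges mixed_vertices by simp
  qed
  have tri: "snd ?m (convex hull {a, b, c}) \<le> mult D (fst ?m (a, b)) (fst ?m (c, a)) (fst ?m (b, c))"
    if abc: "(a, b, c) \<in> R" for a b c
  proof -
    note e = R_edge[OF abc] and rr = R_rot[OF abc] R_rot[OF R_rot[OF abc]] and ne = R_distinct[OF abc]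
    have T: "convex hull {a, b, c} \<in> dual_vertices K" using abc dual_vertices_iff by blast
    have rot1: ?thesis if "snd ?m (convex hull {c, a, b}) \<le> mult D (fst ?m (c, a)) (fst ?m (b, c)) (fst ?m (a, b))"
      using mult_rot_bound[of ?m c a b, OF _ _ _ that] lab' e by blast
    have rot2: ?thesis if "snd ?m (convex hull {b, c, a}) \<le> mult D (fst ?m (b, c)) (fst ?m (a, b)) (fst ?m (c, a))"
      using rot1 mult_rot_bound[of ?m b c a, OF _ _ _ that] lab' e by blast
    consider "q \<notin> {a, b, c}" | "p \<notin> {a, b, c}" | "a = p" "b = q" | "a = q" "b = p" | "b = p" "c = q"
      | "b = q" "c = p" | "c = p" "a = q" | "c = q" "a = p" using ne pq(3) by auto
    then show ?thesis
    proof cases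
      case 1
      then have "q \<notin> convex hull {a, b, c}" using plaquette_in_triangle[OF abc pq(2)] by blast
      moreover have "a \<noteq> q" "b \<noteq> q" "c \<noteq> q" using 1 by auto
      ultimately show ?thesis using state_mult[OF r abc] T e mixed_edges(3) mixed_vertices(3) by simp
    next
      case 2
      then have "p \<notin> convex hull {a, b, c}" using plaquette_in_triangle[OF abc pq(1)] by blast
      moreover have "a \<noteq> p" "b \<noteq> p" "c \<noteq> p" using 2 by auto
      ultimately show ?thesis using state_mult[OF z abc] T e mixed_edges(4) mixed_vertices(4) by simp
    next
      case 3 then show ?thesis using tri1 abc by blast
    next
      case 4 then show ?thesis using tri2 abc by blast
    next
      case 5 then show ?thesis using rot2 tri1 rr(1) by blast
    next
      case 6 then show ?thesis using rot2 tri2 rr(1) by blast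
    next
      case 7 then show ?thesis using rot1 tri1 rr(2) by blast
    next
      case 8 then show ?thesis using rot1 tri2 rr(2) by blast
    qed
  qed
  have ext: "fst ?m \<in> extensional E" "snd ?m \<in> extensional (dual_vertices K)"
    by (simp_all add: mixed_def)
  show ?thesis
    unfolding states_def using lab tri ext by (cases ?m) (auto simp: PiE_iff)
qed

lemma state_between_eq_mixed:
  assumes m: "m \<in> St \<Phi>'" and "agree q r m" "agree p m z"
    and x: "q \<in> nb p \<Longrightarrow> x = fst m (p, q)"
    and c: "q \<in> nb p \<Longrightarrow> c1 = snd m (tri p q) \<and> c2 = snd m (tri q p)"
  shows "mixed p q r z x c1 c2 = m"
proof -
  have xm: "x \<in> label_set D (\<Phi>' (p, q))" if "q \<in> nb p"
    using state_label_set[OF m] x that by (simp add: nb_iff)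
  have c1m: "c1 \<le> mult D x (dual D (fst r (p, nx p q))) (fst z (q, nx p q))" if n: "q \<in> nb p"
  proof -
    have R1: "(p, q, nx p q) \<in> R" by (rule nx_R[OF n])
    note e = R_edge[OF R1] R_neq[OF R1]
    have "fst m (nx p q, p) = dual D (fst r (p, nx p q))"
      using state_dual[OF m edge_sym[OF e(3)]] agree_edge[OF assms(2) edge_sym[OF e(3)]] e pq by simp
    moreover have "fst m (q, nx p q) = fst z (q, nx p q)"
      using agree_edge[OF assms(3) e(2)] e pq by simp
    ultimately show ?thesis using state_mult[OF m R1] x[OF n] c[OF n] by simp
  qed
  have c2m: "c2 \<le> mult D (dual D x) (dual D (fst z (q, nx q p))) (fst r (p, nx q p))" if n: "q \<in> nb p"
  proof -
    have R2: "(q, p, nx q p) \<in> R" using nx_R n nb_sym by blast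
    note e = R_edge[OF R2] R_neq[OF R2]
    have "fst m (nx q p, q) = dual D (fst z (q, nx q p))"
      using state_dual[OF m edge_sym[OF e(3)]] agree_edge[OF assms(3) edge_sym[OF e(3)]] e pq by simp
    moreover have "fst m (p, nx q p) = fst r (p, nx q p)"
      using agree_edge[OF assms(2) e(2)] e pq by simp
    moreover have "fst m (q, p) = dual D x" using state_dual[OF m edge_sym[OF e(1)]] x[OF n] by simp
    ultimately show ?thesis using state_mult[OF m R2] c[OF n] by simp
  qed
  have st: "mixed p q r z x c1 c2 \<in> St \<Phi>'" by (rule mixed_state[OF xm c1m c2m])
  show ?thesis
  proof (rule state_eqI[OF st m])
    fix e assume "e \<in> E"
    then obtain a b where ab: "e = (a, b)" "(a, b) \<in> E" by (cases e) auto
    consider "a \<noteq> q" "b \<noteq> q" | "a \<noteq> p" "b \<noteq> p" | "a = p" "b = q" | "a = q" "b = p"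
      using edge_neq[OF ab(2)] pq(3) by auto
    then show "fst (mixed p q r z x c1 c2) e = fst m e"
    proof cases
      case 1
      then show ?thesis using ab mixed_edges(3) agree_edge[OF assms(2)] by simp
    next
      case 2
      then show ?thesis using ab mixed_edges(4) agree_edge[OF assms(3)] by simp
    next
      case 3
      then have "q \<in> nb p" using ab by (simp add: nb_iff)
      then show ?thesis using 3 ab x mixed_edges by simp
    next
      case 4
      then have n: "q \<in> nb p" using ab edge_sym by (simp add: nb_iff)
      have "fst m (q, p) = dual D (fst m (p, q))" using state_dual[OF m] n by (simp add: nb_iff)
      then show ?thesis using 4 ab n x mixed_edges by simp
    qed
  next
    fix T assume T: "T \<in> dual_vertices K"
    show "snd (mixed p q r z x c1 c2) T = snd m T"
    proof (cases "p \<in> T \<and> q \<in> T")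
      case True
      then have n: "q \<in> nb p" using common_triangle_adjacent pq T by blast
      then have "T = tri p q \<or> T = tri q p" using common_triangles(1) True T by blast
      then show ?thesis using c n mixed_vertices(1,2) by auto
    next
      case False
      then show ?thesis
        using T mixed_vertices(3,4) agree_vertex[OF assms(2)] agree_vertex[OF assms(3)] by auto
    qed
  qed
qed

lemma sum_between_nonadjacent:
  assumes n: "q \<notin> nb p"
  shows "(\<Sum>m\<in>{m \<in> St \<Phi>'. agree q r m \<and> agree p m z}. F m) = F (mixed p q r z undefined 0 0)"
proof -
  have "m = mixed p q r z undefined 0 0" if "m \<in> St \<Phi>'" "agree q r m" "agree p m z" for m
    using state_between_eq_mixed[OF that, of undefined 0 0] n by simp
  moreover have "mixed p q r z undefined 0 0 \<in> St \<Phi>'" by (rule mixed_state) (use n in auto)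
  ultimately have "{m \<in> St \<Phi>'. agree q r m \<and> agree p m z} = {mixed p q r z undefined 0 0}"
    using agree_mixed by blast
  then show ?thesis by simp
qed

text \<open>
  An intermediate state is determined by \<open>r\<close> and \<open>z\<close> except for the label of the common edge and
  the indices at the two common triangles.
\<close>

lemma sum_between_adjacent:
  assumes n: "q \<in> nb p"
  shows "(\<Sum>m\<in>{m \<in> St \<Phi>'. agree q r m \<and> agree p m z}. F m) =
    (\<Sum>x\<in>label_set D (\<Phi>' (p, q)).
     \<Sum>c1\<in>{0..mult D x (dual D (fst r (p, nx p q))) (fst z (q, nx p q))}.
     \<Sum>c2\<in>{0..mult D (dual D x) (dual D (fst z (q, nx q p))) (fst r (p, nx q p))}.
      F (mixed p q r z x c1 c2))"
proof -
  let ?L = "label_set D (\<Phi>' (p, q))"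
  let ?C1 = "\<lambda>x. {0..mult D x (dual D (fst r (p, nx p q))) (fst z (q, nx p q))}"
  let ?C2 = "\<lambda>x. {0..mult D (dual D x) (dual D (fst z (q, nx q p))) (fst r (p, nx q p))}"
  have fin: "finite ?L" using n color_generic[OF adm(2)] finite_label_set by (simp add: nb_iff)
  have "(\<Sum>x\<in>?L. \<Sum>c1\<in>?C1 x. \<Sum>c2\<in>?C2 x. F (mixed p q r z x c1 c2)) =
      (\<Sum>(x, c1, c2)\<in>(SIGMA x:?L. ?C1 x \<times> ?C2 x). F (mixed p q r z x c1 c2))"
    using fin by (subst sum_Sigma3) (auto simp: case_prod_unfold)
  also have "\<dots> = (\<Sum>m\<in>{m \<in> St \<Phi>'. agree q r m \<and> agree p m z}. F m)"
  proof (rule sum.reindex_bij_witness[where i = "\<lambda>m. (fst m (p, q), snd m (tri p q), snd m (tri q p))"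
        and j = "\<lambda>(x, c1, c2). mixed p q r z x c1 c2"])
    fix w assume "w \<in> (SIGMA x:?L. ?C1 x \<times> ?C2 x)"
    then obtain x c1 c2 where w: "w = (x, c1, c2)" "x \<in> ?L" "c1 \<in> ?C1 x" "c2 \<in> ?C2 x" by (cases w) auto
    show "(\<lambda>m. (fst m (p, q), snd m (tri p q), snd m (tri q p))) (case w of (x, c1, c2) \<Rightarrow> mixed p q r z x c1 c2) = w"
      using w n mixed_edges(1) mixed_vertices(1,2) by simp
    show "(case w of (x, c1, c2) \<Rightarrow> mixed p q r z x c1 c2) \<in> {m \<in> St \<Phi>'. agree q r m \<and> agree p m z}"
    proof -
      have "mixed p q r z x c1 c2 \<in> St \<Phi>'" by (rule mixed_state) (use w in auto)
      then show ?thesis using w(1) agree_mixed by simp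
    qed
    show "F (case w of (x, c1, c2) \<Rightarrow> mixed p q r z x c1 c2) = (case w of (x, c1, c2) \<Rightarrow> F (mixed p q r z x c1 c2))"
      using w by simp
  next
    fix m assume m: "m \<in> {m \<in> St \<Phi>'. agree q r m \<and> agree p m z}"
    then have eq: "mixed p q r z (fst m (p, q)) (snd m (tri p q)) (snd m (tri q p)) = m"
      by (intro state_between_eq_mixed) auto
    then show "(case (fst m (p, q), snd m (tri p q), snd m (tri q p)) of (x, c1, c2) \<Rightarrow> mixed p q r z x c1 c2) = m"
      by simp
    have mS: "m \<in> St \<Phi>'" and a1: "agree q r m" and a2: "agree p m z" using m by auto
    have R1: "(p, q, nx p q) \<in> R" by (rule nx_R[OF n])
    have R2: "(q, p, nx q p) \<in> R" using nx_R n nb_sym by blast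
    note e = R_edge[OF R1] R_neq[OF R1] and e' = R_edge[OF R2] R_neq[OF R2]
    have "fst m (nx p q, p) = dual D (fst r (p, nx p q))" "fst m (q, nx p q) = fst z (q, nx p q)"
      using state_dual[OF mS edge_sym[OF e(3)]] agree_edge[OF a1 edge_sym[OF e(3)]]
        agree_edge[OF a2 e(2)] e pq by simp_all
    moreover have "fst m (nx q p, q) = dual D (fst z (q, nx q p))" "fst m (p, nx q p) = fst r (p, nx q p)"
      "fst m (q, p) = dual D (fst m (p, q))"
      using state_dual[OF mS edge_sym[OF e'(3)]] agree_edge[OF a2 edge_sym[OF e'(3)]]
        agree_edge[OF a1 e'(2)] state_dual[OF mS edge_sym[OF e'(1)]] e' pq by simp_all
    ultimately show "(fst m (p, q), snd m (tri p q), snd m (tri q p)) \<in> (SIGMA x:?L. ?C1 x \<times> ?C2 x)"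
      using state_mult[OF mS R1] state_mult[OF mS R2] state_label_set[OF mS e(1)] by simp
  qed
  finally show ?thesis by simp
qed

text \<open>
  The part of the two coefficients that depends on the intermediate state is a sum over the label
  of the common edge and over the indices at the two common triangles; it is \<open>edge_sum\<close>. The
  remaining factors depend on the initial and final states only.
\<close>

lemma kernel_pair_adjacent:
  assumes n: "q \<in> nb p" and st: "s \<in> labels D" "t \<in> labels D"
    and col: "\<Phi>' (p, q) = deg D (fst r (p, q)) + deg D t"
  shows "(\<Sum>m\<in>St \<Phi>'. kernel q t r m * kernel p s m z) =
    (\<Sum>A\<in>outer_ix p q s r z. \<Sum>A'\<in>outer_ix q p t r z.
      outer_factor p q s r z A * outer_factor q p t r z A' *
      (dcoef D (fst z (p, q)) * dcoef D (fst z (q, nx p q)) * dcoef D (fst z (p, nx q p))) *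
      common_sum p q s t r z A A')"
proof -
  let ?w1 = "nx p q" and ?w2 = "nx q p"
  let ?j = "fst r (p, q)" and ?j'' = "fst z (p, q)"
    and ?k = "fst r (p, ?w1)" and ?k' = "fst z (p, ?w1)" and ?l = "fst r (q, ?w1)" and ?l' = "fst z (q, ?w1)"
    and ?e = "fst r (p, ?w2)" and ?e' = "fst z (p, ?w2)" and ?f = "fst r (q, ?w2)" and ?f' = "fst z (q, ?w2)"
    and ?c = "snd r (tri p q)" and ?c'' = "snd z (tri p q)" and ?d = "snd r (tri q p)" and ?d'' = "snd z (tri q p)"
  let ?T1 = "\<lambda>x b1 a1 c' a b. corner t ?l' ?l ?k (dual D x) (dual D ?j) b1 ?c c' b *
      corner s ?j'' x (dual D ?l') ?k' ?k a c' ?c'' a1"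
    and ?T2 = "\<lambda>x b2 a2 c' a b. corner t (dual D x) (dual D ?j) (dual D ?e) ?f' ?f b ?d c' b2 *
      corner s ?e' ?e ?f' ?j'' x a2 c' ?d'' a"
    and ?Xa = "\<lambda>x. mult_ix D ?j'' s (dual D x)" and ?Xb = "\<lambda>x. mult_ix D (dual D x) t ?j"
    and ?C1 = "\<lambda>x. mult_ix D x (dual D ?k) ?l'" and ?C1' = "\<lambda>x. {0..mult D x (dual D ?k) ?l'}"
    and ?C2 = "\<lambda>x. mult_ix D (dual D x) (dual D ?f') ?e" and ?C2' = "\<lambda>x. {0..mult D (dual D x) (dual D ?f') ?e}"
    and ?O = "outer_ix p q s r z" and ?O' = "outer_ix q p t r z"
    and ?W = "\<lambda>A A'. outer_factor p q s r z A * outer_factor q p t r z A' *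
      (dcoef D ?j'' * dcoef D ?l' * dcoef D ?e')"
  let ?L = "label_set D (\<Phi>' (p, q))"
  note ct = common_triangles[OF n]
  have n': "p \<in> nb q" using n nb_sym by blast
  have nq1: "nx q ?w1 = p" and np2: "nx p ?w2 = q" using ct by auto
  have R1: "(p, q, ?w1) \<in> R" and R2: "(q, p, ?w2) \<in> R" using nx_R n n' by auto
  note e1 = R_edge[OF R1] R_neq[OF R1] and e2 = R_edge[OF R2] R_neq[OF R2]
  have gen: "generic D (\<Phi>' (p, q))" using color_generic[OF adm(2)] n by (simp add: nb_iff)
  have rl: "fst r e \<in> labels D" and zl: "fst z e \<in> labels D" if "e \<in> E" for e
    using that state_label[OF adm(1) r] state_label[OF adm(3) z] by auto
  have lab: "?j \<in> labels D" "?j'' \<in> labels D" "?k \<in> labels D" "?k' \<in> labels D" "?l \<in> labels D" "?l' \<in> labels D"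
    "?e \<in> labels D" "?e' \<in> labels D" "?f \<in> labels D" "?f' \<in> labels D"
    using rl zl e1 e2 edge_sym by blast+
  have rqp: "fst r (q, p) = dual D ?j" using state_dual[OF r e1(1)] .
  have rw2p: "fst r (?w2, p) = dual D ?e" using state_dual[OF r e2(2)] .
  have zw1q: "fst z (?w1, q) = dual D ?l'" using state_dual[OF z e1(2)] .

  have body: "plaquette_coeff D K R q t r (mixed p q r z x c1 c2) * plaquette_coeff D K R p s (mixed p q r z x c1 c2) z =
    (\<Sum>A\<in>?O. \<Sum>A'\<in>?O'.
      ?W A A' *
      (dcoef D x * (\<Sum>a\<in>?Xa x. \<Sum>b\<in>?Xb x.
        (?T1 x (A' ?w1) (A ?w1) c1 a b) * (?T2 x (A' ?w2) (A ?w2) c2 a b))))"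
    if x: "x \<in> ?L" for x c1 c2
  proof -
    let ?m = "mixed p q r z x c1 c2"
    have xl: "x \<in> labels D" using label_in_labels[OF gen x] .
    have dx: "dcoef D (dual D x) = dcoef D x" using dcoef[OF xl] by simp
    have me: "fst ?m (p, q) = x" "fst ?m (q, p) = dual D x" "fst ?m (p, ?w1) = ?k" "fst ?m (?w1, q) = dual D ?l'"
      "fst ?m (p, ?w2) = ?e" "fst ?m (q, ?w2) = ?f'" "fst ?m (q, ?w1) = ?l'"
      using mixed_edges n e1 e2 edge_sym zw1q by auto
    have mv: "snd ?m (tri p q) = c1" "snd ?m (tri q p) = c2" using mixed_vertices(1,2) n by auto
    have F1: "factor p s ?m z q a b' = dcoef D ?j'' * corner s ?j'' x (dual D ?l') ?k' ?k a c1 ?c'' b'" for a b'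
      by (simp add: factor_def me mv)
    have F2: "factor p s ?m z ?w2 a b' = dcoef D ?e' * corner s ?e' ?e ?f' ?j'' x a c2 ?d'' b'" for a b'
      unfolding factor_def np2 using ct(7) by (simp add: me mv np2)
    have G1: "factor q t r ?m p a b' = dcoef D x * corner t (dual D x) (dual D ?j) (dual D ?e) ?f' ?f a ?d c2 b'" for a b'
      by (simp add: factor_def me mv rqp rw2p dx)
    have G2: "factor q t r ?m ?w1 a b' = dcoef D ?l' * corner t ?l' ?l ?k (dual D x) (dual D ?j) a ?c c1 b'" for a b'
      unfolding factor_def nq1 using ct(8) by (simp add: me mv rqp nq1)
    have "agree p r r" "agree q z z" by (simp_all add: agree_iff)
    then have c1: "plaquette_coeff D K R q t r ?m = (\<Sum>A'\<in>?O'. outer_factor q p t r z A' *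
      (\<Sum>b\<in>?Xb x. factor q t r ?m p b (A' ?w2) * factor q t r ?m ?w1 (A' ?w1) b))"
      and c2: "plaquette_coeff D K R p s ?m z = (\<Sum>A\<in>?O. outer_factor p q s r z A *
      (\<Sum>a\<in>?Xa x. factor p s ?m z q a (A ?w1) * factor p s ?m z ?w2 (A ?w2) a))"
      using plaquette_coeff_outer[OF n' pq(2,1), of r r ?m z t] plaquette_coeff_outer[OF n pq(1,2), of ?m r z z s]
        agree_mixed agree_sym[of q r ?m] lab(1) by (simp_all add: me rqp dual_dual)
    have pr: "(\<Sum>a\<in>?Xa x. factor p s ?m z q a (A ?w1) * factor p s ?m z ?w2 (A ?w2) a) *
        (\<Sum>b\<in>?Xb x. factor q t r ?m p b (A' ?w2) * factor q t r ?m ?w1 (A' ?w1) b) =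
      (dcoef D ?j'' * dcoef D ?l' * dcoef D ?e') *
      (dcoef D x * (\<Sum>a\<in>?Xa x. \<Sum>b\<in>?Xb x.
        (?T1 x (A' ?w1) (A ?w1) c1 a b) * (?T2 x (A' ?w2) (A ?w2) c2 a b)))" for A A'
      unfolding F1 F2 G1 G2 sum_product unfolding sum_distrib_left
      by (intro sum.cong refl) (simp only: mult_ac)
    have "plaquette_coeff D K R q t r ?m * plaquette_coeff D K R p s ?m z =
      plaquette_coeff D K R p s ?m z * plaquette_coeff D K R q t r ?m" by (rule mult.commute)
    also have "\<dots> = (\<Sum>A\<in>?O. \<Sum>A'\<in>?O'.
        (outer_factor p q s r z A *
          (\<Sum>a\<in>?Xa x. factor p s ?m z q a (A ?w1) * factor p s ?m z ?w2 (A ?w2) a)) *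
        (outer_factor q p t r z A' *
          (\<Sum>b\<in>?Xb x. factor q t r ?m p b (A' ?w2) * factor q t r ?m ?w1 (A' ?w1) b)))"
      unfolding c1 c2 by (rule sum_product)
    also have "\<dots> = (\<Sum>A\<in>?O. \<Sum>A'\<in>?O'.
        outer_factor p q s r z A * outer_factor q p t r z A' *
        ((\<Sum>a\<in>?Xa x. factor p s ?m z q a (A ?w1) * factor p s ?m z ?w2 (A ?w2) a) *
          (\<Sum>b\<in>?Xb x. factor q t r ?m p b (A' ?w2) * factor q t r ?m ?w1 (A' ?w1) b)))"
      by (intro sum.cong[OF refl]) (simp only: mult_ac)
    finally show ?thesis unfolding pr by (simp only: mult.assoc)
  qed
  have inner: "(\<Sum>c1\<in>?C1' x. \<Sum>c2\<in>?C2' x.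
      \<Sum>a\<in>?Xa x. \<Sum>b\<in>?Xb x.
        (?T1 x b1 a1 c1 a b) * (?T2 x b2 a2 c2 a b)) =
     (\<Sum>a\<in>?Xa x. \<Sum>b\<in>?Xb x.
        (\<Sum>c1\<in>?C1 x. ?T1 x b1 a1 c1 a b) *
        (\<Sum>c2\<in>?C2 x. ?T2 x b2 a2 c2 a b))"
    if x: "x \<in> ?L" for x a1 b1 a2 b2
  proof -
    have xl: "x \<in> labels D" using label_in_labels[OF gen x] .
    have z1: "corner t ?l' ?l ?k (dual D x) (dual D ?j) b1 ?c 0 b = 0" for b
      using lab xl st by (intro corner_eq_0) (auto simp: mult_ix_def)
    have z2: "corner t (dual D x) (dual D ?j) (dual D ?e) ?f' ?f b ?d 0 b2 = 0" for b
      using lab xl st by (intro corner_eq_0) (auto simp: mult_ix_def)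
    have "(\<Sum>a\<in>?Xa x. \<Sum>b\<in>?Xb x.
        (\<Sum>c1\<in>?C1 x. ?T1 x b1 a1 c1 a b) *
        (\<Sum>c2\<in>?C2 x. ?T2 x b2 a2 c2 a b)) =
      (\<Sum>a\<in>?Xa x. \<Sum>b\<in>?Xb x.
        (\<Sum>c1\<in>?C1' x. ?T1 x b1 a1 c1 a b) *
        (\<Sum>c2\<in>?C2' x. ?T2 x b2 a2 c2 a b))"
      by (intro sum.cong refl arg_cong2[where f = "(*)"] sum_from_0_mult_ix[symmetric]) (simp_all add: z1 z2)
    also have "\<dots> = (\<Sum>a\<in>?Xa x. \<Sum>b\<in>?Xb x.
      \<Sum>c1\<in>?C1' x. \<Sum>c2\<in>?C2' x.
        (?T1 x b1 a1 c1 a b) * (?T2 x b2 a2 c2 a b))"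
      unfolding sum_product ..
    also have "\<dots> = (\<Sum>c1\<in>?C1' x. \<Sum>c2\<in>?C2' x.
      \<Sum>a\<in>?Xa x. \<Sum>b\<in>?Xb x.
        (?T1 x b1 a1 c1 a b) * (?T2 x b2 a2 c2 a b))"
      by (rule sum_swap22)
    finally show ?thesis by simp
  qed
  have "(\<Sum>m\<in>St \<Phi>'. kernel q t r m * kernel p s m z) =
      (\<Sum>m\<in>{m \<in> St \<Phi>'. agree q r m \<and> agree p m z}. plaquette_coeff D K R q t r m * plaquette_coeff D K R p s m z)"
    using finite_states[OF adm(2)]
    by (intro sum.mono_neutral_cong_right) (auto simp: kernel_def)
  also have "\<dots> = (\<Sum>x\<in>?L. \<Sum>c1\<in>?C1' x. \<Sum>c2\<in>?C2' x.
      plaquette_coeff D K R q t r (mixed p q r z x c1 c2) * plaquette_coeff D K R p s (mixed p q r z x c1 c2) z)"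
    by (rule sum_between_adjacent[OF n])
  also have "\<dots> = (\<Sum>x\<in>?L. \<Sum>c1\<in>?C1' x. \<Sum>c2\<in>?C2' x.
     \<Sum>A\<in>?O. \<Sum>A'\<in>?O'.
      ?W A A' *
      (dcoef D x * (\<Sum>a\<in>?Xa x. \<Sum>b\<in>?Xb x.
        (?T1 x (A' ?w1) (A ?w1) c1 a b) * (?T2 x (A' ?w2) (A ?w2) c2 a b))))"
    by (intro sum.cong refl body)
  also have "\<dots> = (\<Sum>A\<in>?O. \<Sum>A'\<in>?O'.
      \<Sum>x\<in>?L. \<Sum>c1\<in>?C1' x. \<Sum>c2\<in>?C2' x.
      ?W A A' *
      (dcoef D x * (\<Sum>a\<in>?Xa x. \<Sum>b\<in>?Xb x.
        (?T1 x (A' ?w1) (A ?w1) c1 a b) * (?T2 x (A' ?w2) (A ?w2) c2 a b))))"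
    unfolding sum_swap_out[where A = "?O"] by (rule sum.cong[OF refl]) (rule sum_swap_out)
  also have "\<dots> = (\<Sum>A\<in>?O. \<Sum>A'\<in>?O'.
      ?W A A' *
      (\<Sum>x\<in>?L. dcoef D x * (\<Sum>a\<in>?Xa x. \<Sum>b\<in>?Xb x.
        (\<Sum>c1\<in>?C1 x. ?T1 x (A' ?w1) (A ?w1) c1 a b) *
        (\<Sum>c2\<in>?C2 x. ?T2 x (A' ?w2) (A ?w2) c2 a b))))"
  proof (intro sum.cong refl)
    fix A A' :: "'e \<Rightarrow> nat"
    show "(\<Sum>x\<in>?L. \<Sum>c1\<in>?C1' x. \<Sum>c2\<in>?C2' x.
      ?W A A' * (dcoef D x * (\<Sum>a\<in>?Xa x. \<Sum>b\<in>?Xb x.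
        (?T1 x (A' ?w1) (A ?w1) c1 a b) * (?T2 x (A' ?w2) (A ?w2) c2 a b)))) =
      ?W A A' * (\<Sum>x\<in>?L. dcoef D x * (\<Sum>a\<in>?Xa x. \<Sum>b\<in>?Xb x.
        (\<Sum>c1\<in>?C1 x. ?T1 x (A' ?w1) (A ?w1) c1 a b) *
        (\<Sum>c2\<in>?C2 x. ?T2 x (A' ?w2) (A ?w2) c2 a b)))"
      unfolding sum_distrib_left[symmetric]
      by (rule arg_cong2[where f = "(*)", OF refl], rule sum.cong[OF refl],
          rule arg_cong2[where f = "(*)", OF refl], rule inner)
  qed
  finally show ?thesis unfolding common_sum_def edge_sum_def col .
qed

end

text \<open>
  For plaquettes without a common edge, either order has one intermediate state and the corner
  factors coincide. Otherwise the expressions of \<open>kernel_pair_adjacent\<close> for the two orders match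
  term by term by \<open>edge_sum_exchange\<close>.
\<close>

lemma kernel_commute:
  assumes pq: "p \<in> plaquettes K" "q \<in> plaquettes K" "p \<noteq> q"
    and st: "s \<in> labels D" "t \<in> labels D"
    and adm: "adm \<Phi>" "adm (shift_coloring \<Phi> q (deg D t))" "adm (shift_coloring \<Phi> p (deg D s))"
      "adm (shift_coloring (shift_coloring \<Phi> q (deg D t)) p (deg D s))"
    and r: "r \<in> St \<Phi>" and z: "z \<in> St (shift_coloring (shift_coloring \<Phi> q (deg D t)) p (deg D s))"
  shows "(\<Sum>m\<in>St (shift_coloring \<Phi> q (deg D t)). kernel q t r m * kernel p s m z) =
    (\<Sum>m\<in>St (shift_coloring \<Phi> p (deg D s)). kernel p s r m * kernel q t m z)"
proof (cases "agree2 p q r z")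
  case False
  then have zero: "kernel q t r m * kernel p s m z = 0" "kernel p s r m * kernel q t m z = 0" for m
    using agree_between[of q r m p z] agree_between[of p r m q z] agree2_commute[of p q r z]
    by (auto simp: kernel_def)
  show ?thesis unfolding zero by simp
next
  case ag: True
  then have ag': "agree2 q p r z" by (simp add: agree2_commute)
  let ?\<Phi>q = "shift_coloring \<Phi> q (deg D t)" and ?\<Phi>p = "shift_coloring \<Phi> p (deg D s)"
  let ?\<Phi>'' = "shift_coloring ?\<Phi>q p (deg D s)"
  have eq: "?\<Phi>'' = shift_coloring ?\<Phi>p q (deg D t)" by (rule shift_commute)
  have adm': "adm (shift_coloring ?\<Phi>p q (deg D t))" and z': "z \<in> St (shift_coloring ?\<Phi>p q (deg D t))"
    using adm(4) z eq by simp_all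
  have qp: "q \<noteq> p" using pq(3) by simp
  show ?thesis
  proof (cases "q \<in> nb p")
    case False
    then have n': "p \<notin> nb q" using nb_sym by blast
    let ?m = "mixed p q r z undefined 0 0" and ?m' = "mixed q p r z undefined 0 0"
    note B = sum_between_nonadjacent[OF pq adm(1,2,4) shift_off shift_off r z ag False]
      and B' = sum_between_nonadjacent[OF pq(2,1) qp adm(1,3) adm' shift_off shift_off r z' ag' n']
    note am = agree_mixed[OF pq adm(1,2,4) shift_off shift_off r z ag, of undefined 0 0]
      and am' = agree_mixed[OF pq(2,1) qp adm(1,3) adm' shift_off shift_off r z' ag', of undefined 0 0]
    have "(\<Sum>m\<in>St ?\<Phi>q. kernel q t r m * kernel p s m z) =
      (\<Sum>m\<in>{m \<in> St ?\<Phi>q. agree q r m \<and> agree p m z}. plaquette_coeff D K R q t r m * plaquette_coeff D K R p s m z)"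
      using finite_states[OF adm(2)]
      by (intro sum.mono_neutral_cong_right) (auto simp: kernel_def)
    also have "\<dots> = plaquette_coeff D K R q t r ?m * plaquette_coeff D K R p s ?m z" by (rule B)
    also have "plaquette_coeff D K R q t r ?m = plaquette_coeff D K R q t ?m' z"
      by (rule plaquette_coeff_agree[OF pq(2,1) qp n' am'(1) am(2)])
    also have "plaquette_coeff D K R p s ?m z = plaquette_coeff D K R p s r ?m'"
      using plaquette_coeff_agree[OF pq False am(1) am'(2)] by simp
    also have "plaquette_coeff D K R q t ?m' z * plaquette_coeff D K R p s r ?m' =
      (\<Sum>m\<in>{m \<in> St ?\<Phi>p. agree p r m \<and> agree q m z}. plaquette_coeff D K R p s r m * plaquette_coeff D K R q t m z)"
      by (rule trans[OF mult.commute B'[symmetric]])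
    also have "\<dots> = (\<Sum>m\<in>St ?\<Phi>p. kernel p s r m * kernel q t m z)"
      using finite_states[OF adm(3)]
      by (intro sum.mono_neutral_cong_left) (auto simp: kernel_def)
    finally show ?thesis .
  next
    case n: True
    then have n': "p \<in> nb q" using nb_sym by blast
    have R1: "(p, q, nx p q) \<in> R" and R2: "(q, p, nx q p) \<in> R" using nx_R n n' by auto
    note e1 = R_edge[OF R1] R_neq[OF R1] and e2 = R_edge[OF R2] R_neq[OF R2]
    have E: "(p, q) \<in> E" "(q, p) \<in> E" "(p, nx p q) \<in> E" "(q, nx p q) \<in> E" "(p, nx q p) \<in> E" "(q, nx q p) \<in> E"
      using e1 e2 edge_sym by blast+
    have rl: "fst r e \<in> labels D" and zl: "fst z e \<in> labels D" if "e \<in> E" for e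
      using that state_label[OF adm(1) r] state_label[OF adm(4) z] by auto
    have dr: "deg D (fst r (p, q)) = \<Phi> (p, q)" "deg D (fst r (q, p)) = \<Phi> (q, p)"
      using state_deg[OF adm(1) r] E by auto
    have col: "?\<Phi>q (p, q) = deg D (fst r (p, q)) + deg D t" "?\<Phi>p (q, p) = deg D (fst r (q, p)) + deg D s"
      using pq(3) by (simp_all add: dr shift_at')
    have col2: "?\<Phi>p (p, q) = deg D (fst r (p, q)) - deg D s" using qp by (simp add: dr shift_at)
    have dz: "deg D (fst z (p, q)) = deg D (fst r (p, q)) + deg D t - deg D s"
      using state_deg[OF adm(4) z E(1)] qp pq(3) by (simp add: dr shift_at shift_at')
    have duals: "fst r (q, p) = dual D (fst r (p, q))" "fst z (q, p) = dual D (fst z (p, q))"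
      using state_dual[OF r E(1)] state_dual[OF z E(1)] by auto
    have dd: "dcoef D (fst z (q, p)) = dcoef D (fst z (p, q))" using duals dcoef[OF zl[OF E(1)]] by simp
    have exch: "common_sum p q s t r z A A' =
      common_sum q p t s r z A' A"
      if A: "A \<in> outer_ix p q s r z" and A': "A' \<in> outer_ix q p t r z" for A A'
      unfolding common_sum_def duals
    proof (rule edge_sum_exchange)
      have "A u \<in> mult_ix D (fst z (p, u)) s (dual D (fst r (p, u)))" if "u \<in> nb p - {q}" for u
        using A that unfolding outer_ix_def by (rule PiE_mem)
      then show "A (nx p q) \<in> mult_ix D (fst z (p, nx p q)) s (dual D (fst r (p, nx p q)))"
        "A (nx q p) \<in> mult_ix D (fst z (p, nx q p)) s (dual D (fst r (p, nx q p)))"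
        using E e1 e2 by (simp_all add: nb_iff)
      have "A' u \<in> mult_ix D (fst z (q, u)) t (dual D (fst r (q, u)))" if "u \<in> nb q - {p}" for u
        using A' that unfolding outer_ix_def by (rule PiE_mem)
      then show "A' (nx p q) \<in> mult_ix D (fst z (q, nx p q)) t (dual D (fst r (q, nx p q)))"
        "A' (nx q p) \<in> mult_ix D (fst z (q, nx q p)) t (dual D (fst r (q, nx q p)))"
        using E e1 e2 by (simp_all add: nb_iff)
      show "generic D (deg D (fst r (p, q)) + deg D t)" using color_generic[OF adm(2) E(1)] col by simp
      show "generic D (deg D (fst r (p, q)) - deg D s)" using color_generic[OF adm(3) E(1)] col2 by simp
    qed (use rl zl E st dz in auto)
    have "(\<Sum>m\<in>St ?\<Phi>q. kernel q t r m * kernel p s m z) =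
      (\<Sum>A\<in>outer_ix p q s r z. \<Sum>A'\<in>outer_ix q p t r z.
      outer_factor p q s r z A * outer_factor q p t r z A' *
      (dcoef D (fst z (p, q)) * dcoef D (fst z (q, nx p q)) * dcoef D (fst z (p, nx q p))) *
      common_sum p q s t r z A A')"
      by (rule kernel_pair_adjacent[OF pq adm(1,2,4) shift_off shift_off r z ag n st col(1)])
    also have "\<dots> = (\<Sum>A'\<in>outer_ix q p t r z. \<Sum>A\<in>outer_ix p q s r z.
      outer_factor q p t r z A' * outer_factor p q s r z A *
      (dcoef D (fst z (q, p)) * dcoef D (fst z (p, nx q p)) * dcoef D (fst z (q, nx p q))) *
      common_sum q p t s r z A' A)"
      by (subst sum.swap, intro sum.cong refl) (simp add: exch dd)
    also have "\<dots> = (\<Sum>m\<in>St ?\<Phi>p. kernel p s r m * kernel q t m z)"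
      by (rule kernel_pair_adjacent[OF pq(2,1) qp adm(1,3) adm' shift_off shift_off r z' ag' n' st(2,1) col(2), symmetric])
    finally show ?thesis .
  qed
qed

lemma deg_kernel_compose:
  "(\<Sum>m\<in>M. deg_kernel q h r m * deg_kernel p g m z) =
    (\<Sum>t\<in>label_set D h. \<Sum>s\<in>label_set D g. bcoef D s * bcoef D t * (\<Sum>m\<in>M. kernel q t r m * kernel p s m z))"
proof -
  have "(\<Sum>m\<in>M. deg_kernel q h r m * deg_kernel p g m z) =
    (\<Sum>m\<in>M. \<Sum>t\<in>label_set D h. \<Sum>s\<in>label_set D g. bcoef D s * bcoef D t * (kernel q t r m * kernel p s m z))"
    unfolding deg_kernel_def sum_product by (intro sum.cong refl) (simp add: mult_ac)
  also have "\<dots> = (\<Sum>t\<in>label_set D h. \<Sum>s\<in>label_set D g. \<Sum>m\<in>M. bcoef D s * bcoef D t * (kernel q t r m * kernel p s m z))"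
    by (subst sum.swap, rule sum.cong[OF refl], rule sum.swap)
  finally show ?thesis by (simp only: sum_distrib_left)
qed

lemma plaquette_op_deg_commute:
  assumes pq: "p \<in> plaquettes K" "q \<in> plaquettes K" "p \<noteq> q" and gh: "generic D g" "generic D h"
    and adm: "adm \<Phi>" "adm (shift_coloring \<Phi> q h)" "adm (shift_coloring \<Phi> p g)"
      "adm (shift_coloring (shift_coloring \<Phi> q h) p g)"
  shows "plaquette_op_deg D K R (shift_coloring \<Phi> q h) p g (plaquette_op_deg D K R \<Phi> q h \<psi>) =
    plaquette_op_deg D K R (shift_coloring \<Phi> p g) q h (plaquette_op_deg D K R \<Phi> p g \<psi>)"
proof
  fix z
  let ?\<Phi>q = "shift_coloring \<Phi> q h" and ?\<Phi>p = "shift_coloring \<Phi> p g"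
  have eq: "shift_coloring ?\<Phi>p q h = shift_coloring ?\<Phi>q p g" by (rule shift_commute)
  have deg_commute: "(\<Sum>m\<in>St ?\<Phi>q. deg_kernel q h r m * deg_kernel p g m z) =
      (\<Sum>m\<in>St ?\<Phi>p. deg_kernel p g r m * deg_kernel q h m z)"
    if r: "r \<in> St \<Phi>" and z: "z \<in> St (shift_coloring ?\<Phi>q p g)" for r
  proof -
    have "(\<Sum>m\<in>St ?\<Phi>q. deg_kernel q h r m * deg_kernel p g m z) =
        (\<Sum>t\<in>label_set D h. \<Sum>s\<in>label_set D g. bcoef D s * bcoef D t * (\<Sum>m\<in>St ?\<Phi>q. kernel q t r m * kernel p s m z))"
      by (rule deg_kernel_compose)
    also have "\<dots> = (\<Sum>t\<in>label_set D h. \<Sum>s\<in>label_set D g. bcoef D s * bcoef D t * (\<Sum>m\<in>St ?\<Phi>p. kernel p s r m * kernel q t m z))"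
    proof (rule sum.cong[OF refl], rule sum.cong[OF refl], rule arg_cong2[where f = "(*)", OF refl])
      fix s t assume "t \<in> label_set D h" "s \<in> label_set D g"
      then have l: "s \<in> labels D" "t \<in> labels D" and d: "deg D s = g" "deg D t = h"
        using gh label_in_labels deg_label by auto
      show "(\<Sum>m\<in>St ?\<Phi>q. kernel q t r m * kernel p s m z) = (\<Sum>m\<in>St ?\<Phi>p. kernel p s r m * kernel q t m z)"
        using kernel_commute[OF pq l, of \<Phi> r z] adm r z d by simp
    qed
    also have "\<dots> = (\<Sum>m\<in>St ?\<Phi>p. deg_kernel p g r m * deg_kernel q h m z)"
      by (subst sum.swap) (simp only: deg_kernel_compose mult.commute[of "bcoef D _" "bcoef D _"])
    finally show ?thesis .
  qed
  have comp: "(\<Sum>m\<in>M. (\<Sum>r\<in>St \<Phi>. \<psi> r * k r m) * k' m z) = (\<Sum>r\<in>St \<Phi>. \<psi> r * (\<Sum>m\<in>M. k r m * k' m z))"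
    for M and k k' :: "('e, 'a) state \<Rightarrow> ('e, 'a) state \<Rightarrow> complex"
    unfolding sum_distrib_left sum_distrib_right by (subst sum.swap) (simp add: mult.assoc)
  show "plaquette_op_deg D K R ?\<Phi>q p g (plaquette_op_deg D K R \<Phi> q h \<psi>) z =
    plaquette_op_deg D K R ?\<Phi>p q h (plaquette_op_deg D K R \<Phi> p g \<psi>) z"
    by (simp add: plaquette_op_deg_kernel gh eq comp deg_commute cong: sum.cong)
qed

end

section \<open>Adjoints with respect to the Hermitian form\<close>

context LW_surface
begin

definition weight :: "('e, 'a) state \<Rightarrow> complex" where
  "weight t = basis_form D K R t t"

lemma herm_form_weight:
  assumes "adm \<Phi>"
  shows "herm_form D K R \<Phi> \<psi> \<phi> = (\<Sum>t\<in>St \<Phi>. cnj (\<psi> t) * \<phi> t * weight t)"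
  unfolding herm_form_def
proof (rule sum.cong[OF refl])
  fix t assume t: "t \<in> St \<Phi>"
  have "(\<Sum>t'\<in>St \<Phi>. cnj (\<psi> t) * \<phi> t' * basis_form D K R t t') =
      (\<Sum>t'\<in>St \<Phi>. if t = t' then cnj (\<psi> t) * \<phi> t * weight t else 0)"
    by (intro sum.cong refl) (auto simp: weight_def basis_form_def)
  then show "(\<Sum>t'\<in>St \<Phi>. cnj (\<psi> t) * \<phi> t' * basis_form D K R t t') = cnj (\<psi> t) * \<phi> t * weight t"
    using finite_states[OF assms] t by (simp add: sum.delta)
qed

lemma gam_rot: "i \<in> labels D \<Longrightarrow> j \<in> labels D \<Longrightarrow> k \<in> labels D \<Longrightarrow> n \<in> mult_ix D i j k \<Longrightarrow>
    gam D n i j k = gam D n j k i"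
  using gam by blast

lemma gam_at_corner:
  assumes adm: "adm \<Phi>" and t: "t \<in> St \<Phi>" and abc: "(a, b, c) \<in> R"
    and nz: "snd t (convex hull {a, b, c}) \<noteq> 0"
  shows "gam_at D R t (convex hull {a, b, c}) =
    gam D (snd t (convex hull {a, b, c})) (fst t (a, b)) (fst t (c, a)) (fst t (b, c))"
proof -
  have l: "fst t (a, b) \<in> labels D" "fst t (c, a) \<in> labels D" "fst t (b, c) \<in> labels D"
    using state_label[OF adm t] R_edge[OF abc] by blast+
  let ?n = "snd t (convex hull {a, b, c})"
  have n: "?n \<in> mult_ix D (fst t (a, b)) (fst t (c, a)) (fst t (b, c))"
    using nz state_mult[OF t abc] by (simp add: mult_ix_def)
  have rot: "gam D ?n (fst t (b, c)) (fst t (a, b)) (fst t (c, a)) =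
      gam D ?n (fst t (a, b)) (fst t (c, a)) (fst t (b, c))"
    "gam D ?n (fst t (c, a)) (fst t (b, c)) (fst t (a, b)) =
      gam D ?n (fst t (a, b)) (fst t (c, a)) (fst t (b, c))"
    using gam_rot[of "fst t (a, b)" "fst t (c, a)" "fst t (b, c)" ?n]
      gam_rot[of "fst t (b, c)" "fst t (a, b)" "fst t (c, a)" ?n] l n
      mult_ix_rot[OF l] mult_ix_rot2[OF l] by simp_all
  show ?thesis
    using triangle_rep_cases[OF abc] nz rot by (cases t) (auto simp: gam_at_def)
qed

lemma gam_at_off:
  assumes p: "p \<in> plaquettes K" and ag: "agree p r t"
    and T: "T \<in> dual_vertices K" "p \<notin> T"
  shows "gam_at D R r T = gam_at D R t T"
proof -
  obtain a b c where abc: "(a, b, c) \<in> R" "T = convex hull {a, b, c}" using T dual_vertices_iff by blast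
  have ne: "a \<noteq> p" "b \<noteq> p" "c \<noteq> p" using T(2) abc hull_inc[of _ "{a, b, c}" convex] by auto
  have e: "fst r (a, b) = fst t (a, b)" "fst r (b, c) = fst t (b, c)" "fst r (c, a) = fst t (c, a)"
    using agree_edge[OF ag] R_edge[OF abc(1)] ne by blast+
  have v: "snd r T = snd t T" by (rule agree_vertex[OF ag T])
  show ?thesis
    using triangle_rep_cases[OF abc(1)] e v abc(2) by (cases r; cases t) (auto simp: gam_at_def)
qed

definition local_weight :: "'e \<Rightarrow> ('e, 'a) state \<Rightarrow> 'e \<Rightarrow> complex" where
  "local_weight p t u = gam_at D R t (tri p u) * (bet D (fst t (p, u)) / dcoef D (fst t (p, u)))"

text \<open>
  States that agree off \<open>p\<close> have a common factor \<open>w\<close> from the edges and triangles not incident to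
  \<open>p\<close>.
\<close>

lemma weight_split:
  assumes p: "p \<in> plaquettes K" and adm: "adm \<Phi>" "adm \<Phi>'" and r: "r \<in> St \<Phi>" and t: "t \<in> St \<Phi>'"
    and ag: "agree p r t"
  obtains w where "weight r = w * (\<Prod>u\<in>nb p. local_weight p r u)"
    "weight t = w * (\<Prod>u\<in>nb p. local_weight p t u)"
proof -
  let ?T = "{T \<in> dual_vertices K. p \<notin> T}" and ?E = "{X \<in> dual_edges K. p \<notin> X}"
  let ?bd = "\<lambda>s X. bet D (fst s (edge_rep K X)) / dcoef D (fst s (edge_rep K X))"
  have side: "?bd s (convex hull {p, u}) = bet D (fst s (p, u)) / dcoef D (fst s (p, u))"
    if "adm \<Psi>" "s \<in> St \<Psi>" "u \<in> nb p" for \<Psi> s u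
  proof -
    have e: "(p, u) \<in> E" using that by (simp add: nb_iff)
    have "fst s (p, u) \<in> labels D" "fst s (u, p) = dual D (fst s (p, u))"
      using state_label[OF that(1,2) e] state_dual[OF that(2) e] by auto
    then show ?thesis using edge_rep_cases[OF e] bet dcoef by auto
  qed
  have edges: "{X \<in> dual_edges K. p \<in> X} = (\<lambda>u. convex hull {p, u}) ` nb p"
  proof
    show "{X \<in> dual_edges K. p \<in> X} \<subseteq> (\<lambda>u. convex hull {p, u}) ` nb p"
    proof
      fix X assume "X \<in> {X \<in> dual_edges K. p \<in> X}"
      then obtain a b where ab: "(a, b) \<in> E" "X = convex hull {a, b}" "p \<in> X"
        using dual_edges_iff by auto
      then have "p = a \<or> p = b" using edge_hull_vertices[OF ab(1) p] by auto
      then show "X \<in> (\<lambda>u. convex hull {p, u}) ` nb p"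
        using ab edge_sym[OF ab(1)] by (auto simp: nb_iff insert_commute)
    qed
    have "convex hull {p, u} \<in> dual_edges K" if "u \<in> nb p" for u
      using that dual_edges_iff by (metis nb_iff)
    then show "(\<lambda>u. convex hull {p, u}) ` nb p \<subseteq> {X \<in> dual_edges K. p \<in> X}"
      by (auto simp: hull_inc)
  qed
  have split: "weight s = ((\<Prod>T\<in>?T. gam_at D R s T) * (\<Prod>X\<in>?E. ?bd s X)) * (\<Prod>u\<in>nb p. local_weight p s u)"
    if s: "adm \<Psi>" "s \<in> St \<Psi>" for \<Psi> s
  proof -
    have "weight s = (\<Prod>T\<in>dual_vertices K. gam_at D R s T) * (\<Prod>X\<in>dual_edges K. ?bd s X)"
      by (simp add: weight_def basis_form_def prod_dividef)
    also have "(\<Prod>T\<in>dual_vertices K. gam_at D R s T) =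
        (\<Prod>T\<in>{T \<in> dual_vertices K. p \<in> T}. gam_at D R s T) * (\<Prod>T\<in>?T. gam_at D R s T)"
      using finite_dual_vertices by (subst prod.union_disjoint[symmetric]) (auto intro: prod.cong)
    also have "(\<Prod>X\<in>dual_edges K. ?bd s X) =
        (\<Prod>X\<in>{X \<in> dual_edges K. p \<in> X}. ?bd s X) * (\<Prod>X\<in>?E. ?bd s X)"
      using finite_dual_edges by (subst prod.union_disjoint[symmetric]) (auto intro: prod.cong)
    also have "(\<Prod>T\<in>{T \<in> dual_vertices K. p \<in> T}. gam_at D R s T) = (\<Prod>u\<in>nb p. gam_at D R s (tri p u))"
      unfolding dual_vertices_at[OF p] by (simp add: prod.reindex[OF tri_inj])
    also have "(\<Prod>X\<in>{X \<in> dual_edges K. p \<in> X}. ?bd s X) =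
        (\<Prod>u\<in>nb p. bet D (fst s (p, u)) / dcoef D (fst s (p, u)))"
      unfolding edges prod.reindex[OF hull_pair_inj] o_def
      by (rule prod.cong[OF refl]) (rule side[OF s])
    finally show ?thesis unfolding local_weight_def prod.distrib by (simp only: mult_ac)
  qed
  have A: "(\<Prod>T\<in>?T. gam_at D R t T) = (\<Prod>T\<in>?T. gam_at D R r T)"
    by (rule prod.cong[OF refl]) (use gam_at_off[OF p ag] in auto)
  have B: "(\<Prod>X\<in>?E. ?bd t X) = (\<Prod>X\<in>?E. ?bd r X)"
  proof (rule prod.cong[OF refl])
    fix X assume X: "X \<in> ?E"
    then obtain a b where ab: "(a, b) \<in> E" "X = convex hull {a, b}" using dual_edges_iff by auto
    have "a \<noteq> p" "b \<noteq> p" using X ab hull_inc[of _ "{a, b}" convex] by auto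
    then have "fst r (a, b) = fst t (a, b)" "fst r (b, a) = fst t (b, a)"
      using agree_edge[OF ag] ab(1) edge_sym[OF ab(1)] by blast+
    then show "?bd t X = ?bd r X" using edge_rep_cases[OF ab(1)] ab(2) by auto
  qed
  show thesis
    by (rule that[OF split[OF adm(1) r]]) (use split[OF adm(2) t] in \<open>simp only: A B\<close>)
qed

text \<open>
  Corner by corner, the conjugate of a factor of the coefficient times the local weight of the
  target is the corresponding factor of the adjoint times the local weight of the source, up to a
  quotient \<open>X (nx u) / X u\<close>, where \<open>X u\<close> is attached to a side. The relation between \<open>\<gamma>\<close> and \<open>\<beta>\<close>
  is used twice: at the vertex index of the target and at the side index. Around the cycle the
  quotients cancel. If a vertex index is 0, both factors vanish.
\<close>

lemma kernel_adjoint: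
  assumes p: "p \<in> plaquettes K" and s: "s \<in> labels D" and adm: "adm \<Phi>" "adm \<Phi>'"
    and r: "r \<in> St \<Phi>" and t: "t \<in> St \<Phi>'"
  shows "cnj (kernel p s r t) * weight t = kernel p (dual D s) t r * weight r"
proof (cases "agree p r t")
  case False
  then show ?thesis using agree_sym[of p r t] by (simp add: kernel_def)
next
  case ag: True
  obtain w where w: "weight r = w * (\<Prod>u\<in>nb p. local_weight p r u)"
    "weight t = w * (\<Prod>u\<in>nb p. local_weight p t u)"
    using weight_split[OF p adm r t ag] .
  have lr: "fst r (p, u) \<in> labels D" and lt: "fst t (p, u) \<in> labels D"
    and lk: "fst r (nx p u, u) \<in> labels D" "fst t (nx p u, u) = fst r (nx p u, u)" if "u \<in> nb p" for u
    using that state_label[OF adm(1) r] state_label[OF adm(2) t] nx_edge[OF that]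
      agree_edge[OF ag nx_edge[OF that]] nx_neq[OF that] by (auto simp: nb_iff)
  have range_eq: "mult_ix D (fst t (p, u)) s (dual D (fst r (p, u))) =
      mult_ix D (fst r (p, u)) (dual D s) (dual D (fst t (p, u)))" if "u \<in> nb p" for u
    using mult_ix_dual[of "fst t (p, u)" s "dual D (fst r (p, u))"] lr[OF that] lt[OF that] s
    by (simp add: dual_dual)
  have termwise: "cnj (\<Prod>u\<in>nb p. factor p s r t u (A u) (A (nx p u))) * (\<Prod>u\<in>nb p. local_weight p t u) =
      (\<Prod>u\<in>nb p. factor p (dual D s) t r u (A u) (A (nx p u))) * (\<Prod>u\<in>nb p. local_weight p r u)"
    if A: "A \<in> PiE (nb p) (\<lambda>u. mult_ix D (fst t (p, u)) s (dual D (fst r (p, u))))" for A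
  proof -
    have Aix: "A u \<in> mult_ix D (fst t (p, u)) s (dual D (fst r (p, u)))" if "u \<in> nb p" for u
      using A that by (rule PiE_mem)
    define h where "h u = gam D (A u) (dual D s) (dual D (fst t (p, u))) (fst r (p, u))" for u
    define X where "X u = h u * bet D (fst r (p, u))" for u
    have h_ix: "A u \<in> mult_ix D (dual D s) (dual D (fst t (p, u))) (fst r (p, u))" if "u \<in> nb p" for u
      using Aix[OF that] range_eq[OF that] lr[OF that] lt[OF that] s
        mult_ix_rot[of "fst r (p, u)" "dual D s" "dual D (fst t (p, u))"] by simp
    have X_nz: "X u \<noteq> 0" if "u \<in> nb p" for u
      unfolding X_def h_def using h_ix[OF that] lr[OF that] lt[OF that] s gam bet by simp
    have one: "cnj (factor p s r t u (A u) (A (nx p u))) * local_weight p t u =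
      factor p (dual D s) t r u (A u) (A (nx p u)) * local_weight p r u * (X (nx p u) / X u)"
      if u: "u \<in> nb p" for u
    proof -
      let ?w = "nx p u"
      let ?j = "fst r (p, u)" and ?j' = "fst t (p, u)" and ?l = "fst r (p, ?w)" and ?l' = "fst t (p, ?w)"
        and ?k = "fst r (?w, u)" and ?c = "snd r (tri p u)" and ?c' = "snd t (tri p u)"
      have wN: "?w \<in> nb p" by (rule nx_nb[OF u])
      note lab = lr[OF u] lt[OF u] lr[OF wN] lt[OF wN] lk(1)[OF u]
      have re: "fst r (?w, p) = dual D ?l" "fst r (u, ?w) = dual D ?k"
        "fst t (?w, p) = dual D ?l'" "fst t (u, ?w) = dual D ?k"
        using state_dual[OF r, of p ?w] state_dual[OF t, of p ?w] wN
          state_dual[OF r nx_edge[OF u]] state_dual[OF t nx_edge[OF u]] lk(2)[OF u] by (simp_all add: nb_iff)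
      show ?thesis
      proof (cases "?c = 0 \<or> ?c' = 0")
        case True
        then have "corner s ?j' ?j ?k ?l' ?l (A u) ?c ?c' (A ?w) = 0"
          "corner (dual D s) ?j ?j' ?k ?l ?l' (A u) ?c' ?c (A ?w) = 0"
          using lab s by (auto intro!: corner_eq_0 simp: mult_ix_def)
        then show ?thesis using lk(2)[OF u] by (simp add: factor_def)
      next
        case False
        have c: "?c \<in> mult_ix D ?j (dual D ?l) (dual D ?k)" and c': "?c' \<in> mult_ix D ?j' (dual D ?l') (dual D ?k)"
          using False state_mult[OF r nx_R[OF u]] state_mult[OF t nx_R[OF u]] re by (simp_all add: mult_ix_def)
        have gr: "gam_at D R r (tri p u) = gam D ?c ?j (dual D ?l) (dual D ?k)"
          and gt: "gam_at D R t (tri p u) = gam D ?c' ?j' (dual D ?l') (dual D ?k)"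
          using gam_at_corner[OF adm(1) r nx_R[OF u]] gam_at_corner[OF adm(2) t nx_R[OF u]] False re by simp_all
        have cc: "cnj (corner s ?j' ?j ?k ?l' ?l (A u) ?c ?c' (A ?w)) =
            corner (dual D s) ?j ?j' ?k ?l ?l' (A u) ?c' ?c (A ?w) *
            gam D (A u) ?j' s (dual D ?j) * gam D ?c ?j (dual D ?l) (dual D ?k) *
            gam D ?c' (dual D ?j') ?k ?l' * h ?w *
            (bet D ?j' * bet D s * bet D ?j * bet D ?l * bet D ?k * bet D ?l')"
          unfolding h_def using lab s Aix[OF u] Aix[OF wN] c c' by (intro corner_cnj) auto
        have h_u: "gam D (A u) ?j' s (dual D ?j) * h u * bet D ?j' * bet D s * bet D ?j = 1"
        proof -
          have "gam D (A u) ?j (dual D s) (dual D ?j') = h u"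
            unfolding h_def using gam_rot[of ?j "dual D s" "dual D ?j'" "A u"] lab s Aix[OF u] range_eq[OF u] by simp
          then show ?thesis
            using gam_bet[of ?j' s "dual D ?j" "A u"] lab s Aix[OF u] bet[OF lab(1)] by (simp add: dual_dual)
        qed
        have g_c': "gam D ?c' ?j' (dual D ?l') (dual D ?k) * gam D ?c' (dual D ?j') ?k ?l' *
            bet D ?j' * bet D ?l' * bet D ?k = 1"
        proof -
          have m: "mult_ix D (dual D ?j') ?k ?l' = mult_ix D ?j' (dual D ?l') (dual D ?k)"
            using mult_ix_dual[of ?j' "dual D ?l'" "dual D ?k"] mult_ix_rot2[of ?k ?l' "dual D ?j'"] lab
            by (simp add: dual_dual)
          have "gam D ?c' ?k ?l' (dual D ?j') = gam D ?c' (dual D ?j') ?k ?l'"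
            using gam_rot[of "dual D ?j'" ?k ?l' ?c'] lab c' m by simp
          then show ?thesis
            using gam_bet[of ?j' "dual D ?l'" "dual D ?k" ?c'] lab c' bet[OF lab(4)] bet[OF lab(5)]
            by (simp add: dual_dual)
        qed
        have d: "dcoef D ?j \<noteq> 0" "dcoef D ?j' \<noteq> 0" "cnj (dcoef D ?j') = dcoef D ?j'" "bet D ?j \<noteq> 0"
          using dcoef[OF lab(1)] dcoef[OF lab(2)] bet[OF lab(1)] by auto
        have hn: "h u \<noteq> 0" using X_nz[OF u] by (simp add: X_def)
        let ?co = "corner (dual D s) ?j ?j' ?k ?l ?l' (A u) ?c' ?c (A ?w)"
        let ?g = "gam D ?c ?j (dual D ?l) (dual D ?k)"
        have "cnj (factor p s r t u (A u) (A ?w)) * local_weight p t u =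
          ?co * ?g * h ?w * bet D ?l * (gam D (A u) ?j' s (dual D ?j) * bet D ?j' * bet D s * bet D ?j) *
          (gam D ?c' ?j' (dual D ?l') (dual D ?k) * gam D ?c' (dual D ?j') ?k ?l' *
            bet D ?j' * bet D ?l' * bet D ?k)"
          using d by (simp add: factor_def local_weight_def gt cc)
        also have "gam D (A u) ?j' s (dual D ?j) * bet D ?j' * bet D s * bet D ?j = 1 / h u"
          using h_u hn by (simp add: field_simps)
        finally have "cnj (factor p s r t u (A u) (A ?w)) * local_weight p t u = ?co * ?g * h ?w * bet D ?l / h u"
          unfolding g_c' by simp
        moreover have "factor p (dual D s) t r u (A u) (A ?w) * local_weight p r u = ?co * ?g * bet D ?j"
          using d lk(2)[OF u] by (simp add: factor_def local_weight_def gr)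
        ultimately show ?thesis using d hn by (simp add: X_def)
      qed
    qed
    have "(\<Prod>u\<in>nb p. X (nx p u) / X u) = (\<Prod>u\<in>nb p. X (nx p u)) / (\<Prod>u\<in>nb p. X u)"
      by (rule prod_dividef)
    also have "(\<Prod>u\<in>nb p. X (nx p u)) = (\<Prod>u\<in>nb p. X u)"
      by (rule prod.reindex_bij_betw[OF nx_bij])
    finally have tele: "(\<Prod>u\<in>nb p. X (nx p u) / X u) = 1" using X_nz by (simp add: prod_zero_iff)
    have "cnj (\<Prod>u\<in>nb p. factor p s r t u (A u) (A (nx p u))) * (\<Prod>u\<in>nb p. local_weight p t u) =
      (\<Prod>u\<in>nb p. cnj (factor p s r t u (A u) (A (nx p u))) * local_weight p t u)"
      by (simp add: prod.distrib)
    also have "\<dots> = (\<Prod>u\<in>nb p. factor p (dual D s) t r u (A u) (A (nx p u)) * local_weight p r u * (X (nx p u) / X u))"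
      by (rule prod.cong[OF refl]) (rule one)
    also have "\<dots> = (\<Prod>u\<in>nb p. factor p (dual D s) t r u (A u) (A (nx p u))) * (\<Prod>u\<in>nb p. local_weight p r u)"
      unfolding prod.distrib tele by simp
    finally show ?thesis .
  qed
  have "cnj (plaquette_coeff D K R p s r t) * (\<Prod>u\<in>nb p. local_weight p t u) =
      plaquette_coeff D K R p (dual D s) t r * (\<Prod>u\<in>nb p. local_weight p r u)"
  proof -
    have "cnj (plaquette_coeff D K R p s r t) * (\<Prod>u\<in>nb p. local_weight p t u) =
      (\<Sum>A\<in>PiE (nb p) (\<lambda>u. mult_ix D (fst t (p, u)) s (dual D (fst r (p, u)))).
        cnj (\<Prod>u\<in>nb p. factor p s r t u (A u) (A (nx p u))) * (\<Prod>u\<in>nb p. local_weight p t u))"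
      unfolding plaquette_coeff_factor cnj_sum sum_distrib_right ..
    also have "\<dots> = (\<Sum>A\<in>PiE (nb p) (\<lambda>u. mult_ix D (fst t (p, u)) s (dual D (fst r (p, u)))).
        (\<Prod>u\<in>nb p. factor p (dual D s) t r u (A u) (A (nx p u))) * (\<Prod>u\<in>nb p. local_weight p r u))"
      by (rule sum.cong[OF refl]) (rule termwise)
    also have "PiE (nb p) (\<lambda>u. mult_ix D (fst t (p, u)) s (dual D (fst r (p, u)))) =
        PiE (nb p) (\<lambda>u. mult_ix D (fst r (p, u)) (dual D s) (dual D (fst t (p, u))))"
      by (rule PiE_cong) (rule range_eq)
    finally show ?thesis unfolding plaquette_coeff_factor sum_distrib_right .
  qed
  then show ?thesis using ag agree_sym[of p r t] w by (simp add: kernel_def mult_ac)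
qed

lemma deg_kernel_adjoint:
  assumes p: "p \<in> plaquettes K" and g: "generic D g" and adm: "adm \<Phi>" "adm \<Phi>'"
    and r: "r \<in> St \<Phi>" and t: "t \<in> St \<Phi>'"
  shows "cnj (deg_kernel p g r t) * weight t = deg_kernel p (- g) t r * weight r"
proof -
  have "cnj (deg_kernel p g r t) * weight t =
      (\<Sum>s\<in>label_set D g. cnj (bcoef D s) * (cnj (kernel p s r t) * weight t))"
    by (simp add: deg_kernel_def sum_distrib_right mult.assoc)
  also have "\<dots> = (\<Sum>s\<in>label_set D g. bcoef D (dual D s) * kernel p (dual D s) t r * weight r)"
  proof (rule sum.cong[OF refl])
    fix s assume "s \<in> label_set D g"
    then have s: "s \<in> labels D" using label_in_labels g by blast
    show "cnj (bcoef D s) * (cnj (kernel p s r t) * weight t) =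
        bcoef D (dual D s) * kernel p (dual D s) t r * weight r"
      using kernel_adjoint[OF p s adm r t] bcoef[OF s] by simp
  qed
  also have "\<dots> = deg_kernel p (- g) t r * weight r"
    by (simp add: deg_kernel_def sum_distrib_right sum_label_dual[OF g])
  finally show ?thesis .
qed

lemma plaquette_op_deg_adjoint:
  assumes p: "p \<in> plaquettes K" and g: "generic D g" and adm: "adm \<Phi>" "adm (shift_coloring \<Phi> p g)"
  shows "herm_form D K R (shift_coloring \<Phi> p g) (plaquette_op_deg D K R \<Phi> p g \<psi>) \<phi> =
    herm_form D K R \<Phi> \<psi> (plaquette_op_deg D K R (shift_coloring \<Phi> p g) p (- g) \<phi>)"
proof -
  let ?\<Phi>' = "shift_coloring \<Phi> p g"
  have ret: "shift_coloring ?\<Phi>' p (- g) = \<Phi>" by (simp add: shift_shift shift_zero)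
  have g': "generic D (- g)" using g by simp
  have "herm_form D K R ?\<Phi>' (plaquette_op_deg D K R \<Phi> p g \<psi>) \<phi> =
      (\<Sum>t\<in>St ?\<Phi>'. \<Sum>r\<in>St \<Phi>. cnj (\<psi> r) * \<phi> t * (cnj (deg_kernel p g r t) * weight t))"
    unfolding herm_form_weight[OF adm(2)] plaquette_op_deg_kernel[OF g]
    by (intro sum.cong refl) (simp add: sum_distrib_left sum_distrib_right mult_ac)
  also have "\<dots> = (\<Sum>t\<in>St ?\<Phi>'. \<Sum>r\<in>St \<Phi>. cnj (\<psi> r) * \<phi> t * (deg_kernel p (- g) t r * weight r))"
    using deg_kernel_adjoint[OF p g adm] by (intro sum.cong refl) simp
  also have "\<dots> = (\<Sum>r\<in>St \<Phi>. \<Sum>t\<in>St ?\<Phi>'. cnj (\<psi> r) * \<phi> t * (deg_kernel p (- g) t r * weight r))"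
    by (rule sum.swap)
  also have "\<dots> = herm_form D K R \<Phi> \<psi> (plaquette_op_deg D K R ?\<Phi>' p (- g) \<phi>)"
    unfolding herm_form_weight[OF adm(1)] plaquette_op_deg_kernel[OF g'] ret
    by (intro sum.cong refl) (simp add: sum_distrib_left sum_distrib_right mult_ac)
  finally show ?thesis .
qed

end

section \<open>The plaquette projectors\<close>

context LW_surface
begin

text \<open>
  Each condition excludes a translate of the nongeneric set, and finitely many translates do not
  cover the group.
\<close>

lemma admissible_shift_exists:
  assumes "adm \<Phi>" "finite Z"
  shows "\<exists>g. generic D g \<and> adm (shift_coloring \<Phi> p (- g)) \<and> (\<forall>y\<in>Z. generic D (y - g))"
proof -
  have "finite (insert 0 (Z \<union> (\<lambda>u. - \<Phi> (p, u)) ` nb p))" using assms(2) by simp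
  from generic_shift_exists[OF this] obtain g where
    g: "\<And>y. y \<in> insert 0 (Z \<union> (\<lambda>u. - \<Phi> (p, u)) ` nb p) \<Longrightarrow> generic D (y - g)" by blast
  have "generic D (- g)" using g[of 0] by simp
  then have "generic D g" by simp
  moreover have "adm (shift_coloring \<Phi> p (- g))"
  proof (rule admissible_shift[OF assms(1)])
    fix u assume "u \<in> nb p"
    then have "generic D (- (\<Phi> (p, u) - (- g)))" using g[of "- \<Phi> (p, u)"] by simp
    then show "generic D (\<Phi> (p, u) - (- g))" by (simp only: generic_minus)
  qed
  ultimately show ?thesis using g by blast
qed

text \<open>
  \<open>B\<^sup>h B\<^sup>-\<^sup>h = B\<^sup>g B\<^sup>h\<^sup>-\<^sup>g B\<^sup>-\<^sup>h = B\<^sup>g B\<^sup>-\<^sup>g\<close>.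
\<close>

lemma degree_independent_step:
  assumes p: "p \<in> plaquettes K" and adm: "adm \<Phi>"
    and g: "generic D g" "adm (shift_coloring \<Phi> p (- g))"
    and h: "generic D h" "adm (shift_coloring \<Phi> p (- h))" and gh: "generic D (h - g)"
  shows "plaquette_op_deg D K R (shift_coloring \<Phi> p (- h)) p h (plaquette_op_deg D K R \<Phi> p (- h) \<psi>) =
    plaquette_op_deg D K R (shift_coloring \<Phi> p (- g)) p g (plaquette_op_deg D K R \<Phi> p (- g) \<psi>)"
proof -
  let ?\<Phi>g = "shift_coloring \<Phi> p (- g)" and ?\<Phi>h = "shift_coloring \<Phi> p (- h)"
  have s: "shift_coloring ?\<Phi>h p (h - g) = ?\<Phi>g" "shift_coloring ?\<Phi>h p (g + (h - g)) = \<Phi>"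
    by (simp_all add: shift_shift shift_zero)
  have 1: "plaquette_op_deg D K R ?\<Phi>g p g (plaquette_op_deg D K R ?\<Phi>h p (h - g) \<phi>) =
      plaquette_op_deg D K R ?\<Phi>h p h \<phi>" for \<phi>
    using plaquette_op_deg_product[OF p g(1) gh, of ?\<Phi>h \<phi>] g h adm unfolding s by simp
  have 2: "plaquette_op_deg D K R ?\<Phi>h p (h - g) (plaquette_op_deg D K R \<Phi> p (- h) \<psi>) =
      plaquette_op_deg D K R \<Phi> p (- g) \<psi>"
    using plaquette_op_deg_product[OF p gh, of "- h" \<Phi> \<psi>] g h adm by simp
  show ?thesis unfolding 1[symmetric] 2 ..
qed

text \<open>
  Two admissible degrees are compared through a third one whose differences with both are generic.
\<close>

lemma plaquette_op_eq:
  assumes p: "p \<in> plaquettes K" and adm: "adm \<Phi>"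
    and g: "generic D g" "adm (shift_coloring \<Phi> p (- g))"
  shows "plaquette_op D K R \<Phi> p \<psi> =
    plaquette_op_deg D K R (shift_coloring \<Phi> p (- g)) p g (plaquette_op_deg D K R \<Phi> p (- g) \<psi>)"
proof -
  define h where "h = (SOME g. generic D g \<and> adm (shift_coloring \<Phi> p (- g)))"
  have h: "generic D h" "adm (shift_coloring \<Phi> p (- h))"
    using someI[of "\<lambda>g. generic D g \<and> adm (shift_coloring \<Phi> p (- g))" g] g by (simp_all add: h_def)
  obtain k where k: "generic D k" "adm (shift_coloring \<Phi> p (- k))"
    and d: "generic D (g - k)" "generic D (h - k)"
    using admissible_shift_exists[OF adm, of "{g, h}" p] by auto
  have "plaquette_op D K R \<Phi> p \<psi> =
      plaquette_op_deg D K R (shift_coloring \<Phi> p (- h)) p h (plaquette_op_deg D K R \<Phi> p (- h) \<psi>)"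
    by (simp add: plaquette_op_def h_def Let_def)
  also have "\<dots> = plaquette_op_deg D K R (shift_coloring \<Phi> p (- k)) p k (plaquette_op_deg D K R \<Phi> p (- k) \<psi>)"
    by (rule degree_independent_step[OF p adm k h d(2)])
  also have "\<dots> = plaquette_op_deg D K R (shift_coloring \<Phi> p (- g)) p g (plaquette_op_deg D K R \<Phi> p (- g) \<psi>)"
    by (rule degree_independent_step[OF p adm k g d(1), symmetric])
  finally show ?thesis .
qed

text \<open>
  \<open>B\<^sup>g (B\<^sup>-\<^sup>g B\<^sup>h) B\<^sup>-\<^sup>h = B\<^sup>g B\<^sup>h\<^sup>-\<^sup>g B\<^sup>-\<^sup>h = B\<^sup>h B\<^sup>-\<^sup>h\<close> for \<open>g\<close>, \<open>h\<close> with generic difference.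
\<close>

lemma plaquette_op_idem:
  assumes p: "p \<in> plaquettes K" and adm: "adm \<Phi>"
  shows "plaquette_op D K R \<Phi> p (plaquette_op D K R \<Phi> p \<psi>) = plaquette_op D K R \<Phi> p \<psi>"
proof -
  obtain g where g: "generic D g" "adm (shift_coloring \<Phi> p (- g))"
    using admissible_shift_exists[OF adm, of "{}" p] by auto
  obtain h where h: "generic D h" "adm (shift_coloring \<Phi> p (- h))" and gh: "generic D (g - h)"
    using admissible_shift_exists[OF adm, of "{g}" p] by auto
  have "generic D (- (g - h))" using gh by (simp only: generic_minus)
  then have hg: "generic D (h - g)" by simp
  let ?\<Phi>g = "shift_coloring \<Phi> p (- g)" and ?\<Phi>h = "shift_coloring \<Phi> p (- h)"
  have s: "shift_coloring ?\<Phi>h p h = \<Phi>" "shift_coloring ?\<Phi>h p (h - g) = ?\<Phi>g"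
    by (simp_all add: shift_shift shift_zero)
  have 1: "plaquette_op_deg D K R \<Phi> p (- g) (plaquette_op_deg D K R ?\<Phi>h p h \<phi>) =
      plaquette_op_deg D K R ?\<Phi>h p (h - g) \<phi>" for \<phi>
    using plaquette_op_deg_product[OF p _ h(1), of "- g" ?\<Phi>h \<phi>] g h hg adm by (simp add: s)
  have 2: "plaquette_op_deg D K R ?\<Phi>g p g (plaquette_op_deg D K R ?\<Phi>h p (h - g) \<phi>) =
      plaquette_op_deg D K R ?\<Phi>h p h \<phi>" for \<phi>
    using plaquette_op_deg_product[OF p g(1) hg, of ?\<Phi>h \<phi>] g h adm by (simp add: s)
  have "plaquette_op D K R \<Phi> p (plaquette_op D K R \<Phi> p \<psi>) = plaquette_op_deg D K R ?\<Phi>g p g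
      (plaquette_op_deg D K R \<Phi> p (- g) (plaquette_op D K R \<Phi> p \<psi>))"
    by (rule plaquette_op_eq[OF p adm g])
  also have "\<dots> = plaquette_op_deg D K R ?\<Phi>h p h (plaquette_op_deg D K R \<Phi> p (- h) \<psi>)"
    unfolding plaquette_op_eq[OF p adm h] 1 2 ..
  also have "\<dots> = plaquette_op D K R \<Phi> p \<psi>"
    by (rule plaquette_op_eq[OF p adm h, symmetric])
  finally show ?thesis .
qed

text \<open>
  The degree \<open>h\<close> at \<open>q\<close> is chosen after the degree \<open>g\<close> at \<open>p\<close>, so that the coloring shifted at
  both plaquettes is admissible too; then the four factors can be interchanged one at a time.
\<close>

lemma plaquette_op_commute:
  assumes pq: "p \<in> plaquettes K" "q \<in> plaquettes K" and adm: "adm \<Phi>"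
  shows "plaquette_op D K R \<Phi> p (plaquette_op D K R \<Phi> q \<psi>) =
    plaquette_op D K R \<Phi> q (plaquette_op D K R \<Phi> p \<psi>)"
proof (cases "p = q")
  case False
  obtain g where g: "generic D g" "adm (shift_coloring \<Phi> p (- g))"
    using admissible_shift_exists[OF adm, of "{}" p] by auto
  let ?\<Phi>p = "shift_coloring \<Phi> p (- g)"
  obtain h where h: "generic D h" "adm (shift_coloring \<Phi> q (- h))"
    and hy: "\<And>y. y \<in> (\<lambda>u. - ?\<Phi>p (q, u)) ` nb q \<Longrightarrow> generic D (y - h)"
    using admissible_shift_exists[OF adm, of "(\<lambda>u. - ?\<Phi>p (q, u)) ` nb q" q] by auto
  let ?\<Phi>q = "shift_coloring \<Phi> q (- h)" and ?\<Phi>pq = "shift_coloring ?\<Phi>p q (- h)"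
  have admpq: "adm ?\<Phi>pq"
  proof (rule admissible_shift[OF g(2)])
    fix u assume "u \<in> nb q"
    then have "generic D (- (?\<Phi>p (q, u) - (- h)))" using hy[of "- ?\<Phi>p (q, u)"] by simp
    then show "generic D (?\<Phi>p (q, u) - (- h))" by (simp only: generic_minus)
  qed
  have e: "?\<Phi>pq = shift_coloring ?\<Phi>q p (- g)" by (rule shift_commute)
  have "shift_coloring ?\<Phi>pq p g = ?\<Phi>q" unfolding e by (simp add: shift_shift shift_zero)
  then have s: "shift_coloring ?\<Phi>q p (- g) = ?\<Phi>pq" "shift_coloring ?\<Phi>p p g = \<Phi>" "shift_coloring ?\<Phi>q q h = \<Phi>"
    "shift_coloring ?\<Phi>pq q h = ?\<Phi>p" "shift_coloring ?\<Phi>pq p g = ?\<Phi>q"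
    by (simp_all add: e[symmetric] shift_shift shift_zero)
  have g': "generic D (- g)" and h': "generic D (- h)" using g h by simp_all
  let ?B = "plaquette_op_deg D K R"
  have 1: "?B \<Phi> p (- g) (?B ?\<Phi>q q h \<phi>) = ?B ?\<Phi>pq q h (?B ?\<Phi>q p (- g) \<phi>)" for \<phi>
    using plaquette_op_deg_commute[OF pq False g' h(1), of ?\<Phi>q \<phi>] adm g h admpq by (simp add: s)
  have 2: "?B ?\<Phi>q p (- g) (?B \<Phi> q (- h) \<phi>) = ?B ?\<Phi>p q (- h) (?B \<Phi> p (- g) \<phi>)" for \<phi>
    using plaquette_op_deg_commute[OF pq False g' h', of \<Phi> \<phi>] adm g h admpq by (simp add: s)
  have 3: "?B ?\<Phi>p p g (?B ?\<Phi>pq q h \<phi>) = ?B ?\<Phi>q q h (?B ?\<Phi>pq p g \<phi>)" for \<phi>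
    using plaquette_op_deg_commute[OF pq False g(1) h(1), of ?\<Phi>pq \<phi>] adm g h admpq by (simp add: s)
  have 4: "?B ?\<Phi>pq p g (?B ?\<Phi>p q (- h) \<phi>) = ?B \<Phi> q (- h) (?B ?\<Phi>p p g \<phi>)" for \<phi>
    using plaquette_op_deg_commute[OF pq False g(1) h', of ?\<Phi>p \<phi>] adm g h admpq by (simp add: s)
  show ?thesis
    unfolding plaquette_op_eq[OF pq(1) adm g] plaquette_op_eq[OF pq(2) adm h] 1 2 3 4 ..
qed simp

lemma plaquette_op_hermitian:
  assumes p: "p \<in> plaquettes K" and adm: "adm \<Phi>"
  shows "herm_form D K R \<Phi> (plaquette_op D K R \<Phi> p \<psi>) \<phi> = herm_form D K R \<Phi> \<psi> (plaquette_op D K R \<Phi> p \<phi>)"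
proof -
  obtain g where g: "generic D g" "adm (shift_coloring \<Phi> p (- g))"
    using admissible_shift_exists[OF adm, of "{}" p] by auto
  let ?\<Phi>g = "shift_coloring \<Phi> p (- g)"
  have s: "shift_coloring ?\<Phi>g p g = \<Phi>" by (simp add: shift_shift shift_zero)
  have "herm_form D K R \<Phi> (plaquette_op_deg D K R ?\<Phi>g p g \<psi>') \<phi> =
      herm_form D K R ?\<Phi>g \<psi>' (plaquette_op_deg D K R \<Phi> p (- g) \<phi>)" for \<psi>'
    using plaquette_op_deg_adjoint[OF p g(1), of ?\<Phi>g \<psi>' \<phi>] g adm by (simp add: s)
  moreover have "herm_form D K R ?\<Phi>g (plaquette_op_deg D K R \<Phi> p (- g) \<psi>) \<phi>' =
      herm_form D K R \<Phi> \<psi> (plaquette_op_deg D K R ?\<Phi>g p g \<phi>')" for \<phi>'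
    using plaquette_op_deg_adjoint[OF p, of "- g" \<Phi> \<psi> \<phi>'] g adm by simp
  ultimately show ?thesis by (simp add: plaquette_op_eq[OF p adm g])
qed

end

theorem theorem2p5:
  fixes D :: "('g::ab_group_add, 'a) LW_data"
    and \<Sigma> :: "'x topology"
    and K :: "'e::euclidean_space set set"
    and h :: "'e \<Rightarrow> 'x"
    and R :: "('e \<times> 'e \<times> 'e) set"
    and \<Phi> :: "'e \<times> 'e \<Rightarrow> 'g"
  assumes "LW D"
    and "closed_surface \<Sigma>"
    and "connected_space \<Sigma>"
    and "triangulates K h \<Sigma>"
    and "surface_orientation K R"
    and "admissible_coloring D K R \<Phi>"
  shows
    "(\<forall>p\<in>plaquettes K. \<forall>\<psi>\<in>state_space D K R \<Phi>.
        plaquette_op D K R \<Phi> p (plaquette_op D K R \<Phi> p \<psi>) = plaquette_op D K R \<Phi> p \<psi>) \<and>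
     (\<forall>p\<in>plaquettes K. \<forall>q\<in>plaquettes K. \<forall>\<psi>\<in>state_space D K R \<Phi>.
        plaquette_op D K R \<Phi> p (plaquette_op D K R \<Phi> q \<psi>) =
        plaquette_op D K R \<Phi> q (plaquette_op D K R \<Phi> p \<psi>)) \<and>
     (\<forall>p\<in>plaquettes K. \<forall>\<psi>\<in>state_space D K R \<Phi>. \<forall>\<phi>\<in>state_space D K R \<Phi>.
        herm_form D K R \<Phi> (plaquette_op D K R \<Phi> p \<psi>) \<phi> =
        herm_form D K R \<Phi> \<psi> (plaquette_op D K R \<Phi> p \<phi>))"
proof -
  interpret oriented_triangulation K R
    using assms by (intro oriented_triangulation_closed_surface)
  interpret LW D by fact
  interpret LW_surface D K R ..
  show ?thesis
    using plaquette_op_idem plaquette_op_commute plaquette_op_hermitian assms(6) by blast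
qed

end
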